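(* Let $\theta \in H^\infty(\mathbb{D})$ be a nonconstant inner function. An operator $X \in \mathcal{B}(H^2(\mathbb{T}))$ is a $\theta$-paired operator if and only if the following two conditions are satisfied: (1) $\theta H^2(\mathbb{T})$ is invariant under $X$. (2) There exist a nonzero $h_0 \in \mathcal{K}_\theta$ and $\nu \in H^\infty(\mathbb{D})$ such that \[ X h_0 = \nu h_0 \] and \[ [X, T_z] = (X - T_\nu) P_{\theta H^2(\mathbb{T})} T_z P_{\mathcal{K}_\theta}. \] Moreover, if $X = S^\theta_{\varphi,\psi}$ is a $\theta$-paired operator, then the representing symbols $\varphi, \psi \in H^\infty(\mathbb{D})$ are unique for fixed $\theta$.
   Context: $\mathbb{T}$ is the unit circle and $\mathbb{D}$ the open unit disc in $\mathbb{C}$. $H^2(\mathbb{T})$ is the closed subspace of $L^2(\mathbb{T})$ of functions whose Fourier coefficients of negative index all vanish; $\mathcal{B}(H^2(\mathbb{T}))$ is the space of bounded linear operators on it. $H^\infty(\mathbb{D})$ is the algebra of bounded analytic functions on $\mathbb{D}$, identified via radial limits with a subspace of $L^\infty(\mathbb{T})$; $\theta\in H^\infty(\mathbb{D})$ is inner if its radial limit function satisfies $|\theta(z)|=1$ for almost all $z\in\mathbb{T}$. For $\varphi\in L^\infty(\mathbb{T})$, the Toeplitz operator $T_\varphi$ on $H^2(\mathbb{T})$ is $T_\varphi f = P_{H^2(\mathbb{T})}(\varphi f)$; for $\varphi\in H^\infty(\mathbb{D})$ this is multiplication by $\varphi$, and $T_z$ is multiplication by $z$. $P_S$ denotes the orthogonal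 projection onto a closed subspace $S$ (here of $H^2(\mathbb{T})$). The model space of $\theta$ is $\mathcal{K}_\theta = H^2(\mathbb{T})\ominus\theta H^2(\mathbb{T})$, the orthogonal complement of $\theta H^2(\mathbb{T})$ in $H^2(\mathbb{T})$. The commutator is $[A,B]=AB-BA$. For $\varphi,\psi\in H^\infty(\mathbb{D})$, the $\theta$-paired operator with (ordered) symbols $\varphi,\psi$ is $S^\theta_{\varphi,\psi} = T_\varphi P_{\theta H^2(\mathbb{T})} + T_\psi P_{\mathcal{K}_\theta}$ on $H^2(\mathbb{T})$. An operator $X\in\mathcal{B}(H^2(\mathbb{T}))$ is said to be $\theta$-paired if $X = S^\theta_{\varphi,\psi}$ for some $\varphi,\psi\in H^\infty(\mathbb{D})$. *)

theory Defs
  imports "HOL-Analysis.Analysis"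
begin

section \<open>Complex inner product spaces\<close>

text \<open>The inner product is linear in its first argument; the real inner product of the
  library is its real part, so that both induce the same norm.\<close>

class complex_inner = real_inner +
  fixes scaleC :: "complex \<Rightarrow> 'a \<Rightarrow> 'a" (infixr \<open>*\<^sub>C\<close> 75)
    and cinner :: "'a \<Rightarrow> 'a \<Rightarrow> complex"
  assumes scaleC_add_right: "c *\<^sub>C (x + y) = c *\<^sub>C x + c *\<^sub>C y"
    and scaleC_add_left: "(c + d) *\<^sub>C x = c *\<^sub>C x + d *\<^sub>C x"
    and scaleC_scaleC: "c *\<^sub>C d *\<^sub>C x = (c * d) *\<^sub>C x"
    and scaleR_scaleC: "r *\<^sub>R x = complex_of_real r *\<^sub>C x"
    and cinner_commute: "cinner x y = cnj (cinner y x)"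
    and cinner_add_left: "cinner (x + y) z = cinner x z + cinner y z"
    and cinner_scaleC_left: "cinner (c *\<^sub>C x) y = c * cinner x y"
    and inner_eq_Re_cinner: "inner x y = Re (cinner x y)"

definition bounded_clinear :: "('a::complex_inner \<Rightarrow> 'b::complex_inner) \<Rightarrow> bool" where
  "bounded_clinear f \<longleftrightarrow> bounded_linear f \<and> (\<forall>c x. f (c *\<^sub>C x) = c *\<^sub>C f x)"

definition corth_comp :: "'a::complex_inner set \<Rightarrow> 'a set" where
  "corth_comp S = {x. \<forall>s\<in>S. cinner x s = 0}"

text \<open>Meaningful when every vector has an orthogonal projection onto \<^term>\<open>S\<close>, in particular when
  \<^term>\<open>S\<close> is a closed complex subspace of a Hilbert space.\<close>

definition orth_proj :: "'a::complex_inner set \<Rightarrow> 'a \<Rightarrow> 'a" where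
  "orth_proj S x = (THE p. p \<in> S \<and> x - p \<in> corth_comp S)"

definition commutator :: "('a::ab_group_add \<Rightarrow> 'a) \<Rightarrow> ('a \<Rightarrow> 'a) \<Rightarrow> 'a \<Rightarrow> 'a" where
  "commutator A B = (\<lambda>x. A (B x) - B (A x))"


section \<open>The space $L^2$ of the unit circle\<close>

text \<open>Normalised arc length. The underlying space is the circle, so the values of a function off
  the circle affect neither its measurability nor its class in $L^2$.\<close>

definition circle_measure :: "complex measure" where
  "circle_measure =
     distr (uniform_measure lborel {0..<2 * pi}) (restrict_space borel (sphere 0 1)) cis"

lemma cis_measurable_circle:
  "cis \<in> uniform_measure lborel {0..<2 * pi} \<rightarrow>\<^sub>M restrict_space borel (sphere 0 1)"
proof (rule measurable_restrict_space2)
  show "cis \<in> borel_measurable (uniform_measure lborel {0..<2 * pi})"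
    by (auto simp: uniform_measure_def intro!: borel_measurable_continuous_onI continuous_intros)
qed (auto simp: space_uniform_measure)

lemma space_circle_measure: "space circle_measure = sphere 0 1"
  by (simp add: circle_measure_def space_restrict_space)

lemma borel_measurable_circle_measure:
  "f \<in> borel_measurable borel \<Longrightarrow> f \<in> borel_measurable circle_measure"
  by (simp add: circle_measure_def measurable_restrict_space1)

definition square_integrable :: "(complex \<Rightarrow> complex) \<Rightarrow> bool" where
  "square_integrable f \<longleftrightarrow>
     f \<in> borel_measurable circle_measure \<and> integrable circle_measure (\<lambda>z. (norm (f z))\<^sup>2)"

lemma square_integrable_zero: "square_integrable (\<lambda>_. 0)"
  by (simp add: square_integrable_def)

lemma square_integrable_mult_bounded:
  assumes f: "square_integrable f" and m: "m \<in> borel_measurable circle_measure"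
    and B: "AE z in circle_measure. norm (m z) \<le> B"
  shows "square_integrable (\<lambda>z. m z * f z)"
proof -
  have [measurable]: "f \<in> borel_measurable circle_measure" "m \<in> borel_measurable circle_measure"
    using f m by (auto simp: square_integrable_def)
  have "integrable circle_measure (\<lambda>z. (norm (m z * f z))\<^sup>2)"
  proof (rule Bochner_Integration.integrable_bound)
    show "integrable circle_measure (\<lambda>z. B\<^sup>2 * (norm (f z))\<^sup>2)"
      using f by (auto simp: square_integrable_def)
    show "AE z in circle_measure. norm ((norm (m z * f z))\<^sup>2) \<le> norm (B\<^sup>2 * (norm (f z))\<^sup>2)"
      using B by eventually_elim
        (auto simp: norm_mult power_mult_distrib intro!: mult_right_mono power_mono)
  qed measurable
  then show ?thesis by (simp add: square_integrable_def)
qed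

lemma square_integrable_scaleC:
  "square_integrable f \<Longrightarrow> square_integrable (\<lambda>z. c * f z)"
  by (rule square_integrable_mult_bounded[where B = "norm c"]) auto

lemma square_integrable_add:
  assumes "square_integrable f" "square_integrable g"
  shows "square_integrable (\<lambda>z. f z + g z)"
proof -
  have [measurable]: "f \<in> borel_measurable circle_measure" "g \<in> borel_measurable circle_measure"
    using assms by (auto simp: square_integrable_def)
  have "integrable circle_measure (\<lambda>z. (norm (f z + g z))\<^sup>2)"
  proof (rule Bochner_Integration.integrable_bound)
    show "integrable circle_measure (\<lambda>z. 2 * (norm (f z))\<^sup>2 + 2 * (norm (g z))\<^sup>2)"
      using assms by (auto simp: square_integrable_def)
    have "(norm (f z + g z))\<^sup>2 \<le> 2 * (norm (f z))\<^sup>2 + 2 * (norm (g z))\<^sup>2" for z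
    proof -
      have "(norm (f z + g z))\<^sup>2 \<le> (norm (f z) + norm (g z))\<^sup>2"
        by (intro power_mono norm_triangle_ineq) auto
      also have "\<dots> \<le> 2 * (norm (f z))\<^sup>2 + 2 * (norm (g z))\<^sup>2"
        using sum_squares_bound[of "norm (f z)" "norm (g z)"] by (simp add: power2_sum)
      finally show ?thesis .
    qed
    then show "AE z in circle_measure. norm ((norm (f z + g z))\<^sup>2)
        \<le> norm (2 * (norm (f z))\<^sup>2 + 2 * (norm (g z))\<^sup>2)"
      by (auto intro!: AE_I2)
  qed measurable
  then show ?thesis by (simp add: square_integrable_def)
qed

lemma integrable_mult_cnj:
  assumes "square_integrable f" "square_integrable g"
  shows "integrable circle_measure (\<lambda>z. f z * cnj (g z))"
proof -
  have [measurable]: "f \<in> borel_measurable circle_measure" "g \<in> borel_measurable circle_measure"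
    using assms by (auto simp: square_integrable_def)
  have [measurable]: "(\<lambda>z. cnj (g z)) \<in> borel_measurable circle_measure"
    by (rule borel_measurable_continuous_on[OF _ \<open>g \<in> _\<close>]) (intro continuous_intros)
  show ?thesis
  proof (rule Bochner_Integration.integrable_bound)
    show "integrable circle_measure (\<lambda>z. (norm (f z))\<^sup>2 + (norm (g z))\<^sup>2)"
      using assms by (auto simp: square_integrable_def)
    have "norm (f z) * norm (g z) \<le> (norm (f z))\<^sup>2 + (norm (g z))\<^sup>2" for z
      using sum_squares_bound[of "norm (f z)" "norm (g z)"]
        mult_nonneg_nonneg[OF norm_ge_zero[of "f z"] norm_ge_zero[of "g z"]] by linarith
    then show "AE z in circle_measure. norm (f z * cnj (g z))
        \<le> norm ((norm (f z))\<^sup>2 + (norm (g z))\<^sup>2)"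
      by (auto intro!: AE_I2 simp: norm_mult)
  qed measurable
qed

definition L2_eq :: "(complex \<Rightarrow> complex) \<Rightarrow> (complex \<Rightarrow> complex) \<Rightarrow> bool" where
  "L2_eq f g \<longleftrightarrow> square_integrable f \<and> square_integrable g \<and> (AE z in circle_measure. f z = g z)"

quotient_type circle_L2 = "complex \<Rightarrow> complex" / partial: L2_eq
proof (rule part_equivpI)
  show "\<exists>f. L2_eq f f"
    using square_integrable_zero by (auto simp: L2_eq_def)
  show "symp L2_eq"
    by (auto simp: symp_def L2_eq_def)
  show "transp L2_eq"
    unfolding transp_def L2_eq_def by (auto elim: eventually_elim2)
qed

lemma L2_eq_integral_cong:
  assumes "L2_eq f f'" "L2_eq g g'"
  shows "(\<integral>z. f z * cnj (g z) \<partial>circle_measure) = (\<integral>z. f' z * cnj (g' z) \<partial>circle_measure)"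
proof (rule integral_cong_AE)
  show "(\<lambda>z. f z * cnj (g z)) \<in> borel_measurable circle_measure"
    "(\<lambda>z. f' z * cnj (g' z)) \<in> borel_measurable circle_measure"
    using assms by (auto simp: L2_eq_def intro!: borel_measurable_integrable integrable_mult_cnj)
  have "AE z in circle_measure. f z = f' z" "AE z in circle_measure. g z = g' z"
    using assms by (auto simp: L2_eq_def)
  then show "AE z in circle_measure. f z * cnj (g z) = f' z * cnj (g' z)"
    by eventually_elim simp
qed

instantiation circle_L2 :: complex_inner
begin

lift_definition zero_circle_L2 :: circle_L2 is "\<lambda>_. 0"
  by (simp add: L2_eq_def square_integrable_zero)

lift_definition plus_circle_L2 :: "circle_L2 \<Rightarrow> circle_L2 \<Rightarrow> circle_L2" is "\<lambda>f g z. f z + g z"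
  unfolding L2_eq_def by (auto intro: square_integrable_add elim: eventually_elim2)

lift_definition scaleC_circle_L2 :: "complex \<Rightarrow> circle_L2 \<Rightarrow> circle_L2" is "\<lambda>c f z. c * f z"
  unfolding L2_eq_def by (auto intro: square_integrable_scaleC)

lift_definition cinner_circle_L2 :: "circle_L2 \<Rightarrow> circle_L2 \<Rightarrow> complex"
  is "\<lambda>f g. \<integral>z. f z * cnj (g z) \<partial>circle_measure"
  by (rule L2_eq_integral_cong)

definition "scaleR r (x::circle_L2) = complex_of_real r *\<^sub>C x"
definition "- (x::circle_L2) = (-1) *\<^sub>C x"
definition "(x::circle_L2) - y = x + - y"
definition "inner (x::circle_L2) y = Re (cinner x y)"
definition "norm (x::circle_L2) = sqrt (inner x x)"
definition "sgn (x::circle_L2) = inverse (norm x) *\<^sub>R x"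
definition "dist (x::circle_L2) y = norm (x - y)"
definition "(uniformity :: (circle_L2 \<times> circle_L2) filter) =
  (INF e\<in>{0<..}. principal {(x, y). dist x y < e})"
definition "open (U :: circle_L2 set) \<longleftrightarrow>
  (\<forall>x\<in>U. eventually (\<lambda>(x', y). x' = x \<longrightarrow> y \<in> U) uniformity)"

instance
proof
  note basic = square_integrable_add square_integrable_scaleC square_integrable_zero
  fix x y z :: circle_L2 and r s :: real and c d :: complex
  show plus_assoc: "x + y + z = x + (y + z)"
    by transfer (auto simp: L2_eq_def add_ac intro!: basic)
  show plus_comm: "x + y = y + x"
    by transfer (auto simp: L2_eq_def add_ac intro!: basic)
  show "0 + x = x"
    by transfer (auto simp: L2_eq_def)
  show "- x + x = 0"
    unfolding uminus_circle_L2_def by transfer (auto simp: L2_eq_def intro!: basic)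
  show "x - y = x + - y"
    by (simp add: minus_circle_L2_def)
  show C1: "c *\<^sub>C (x + y) = c *\<^sub>C x + c *\<^sub>C y" for c :: complex and x y :: circle_L2
    by transfer (auto simp: L2_eq_def algebra_simps intro!: basic)
  show C2: "(c + d) *\<^sub>C x = c *\<^sub>C x + d *\<^sub>C x" for c d :: complex and x :: circle_L2
    by transfer (auto simp: L2_eq_def algebra_simps intro!: basic)
  show C3: "c *\<^sub>C d *\<^sub>C x = (c * d) *\<^sub>C x" for c d :: complex and x :: circle_L2
    by transfer (auto simp: L2_eq_def algebra_simps intro!: basic)
  show "r *\<^sub>R x = complex_of_real r *\<^sub>C x"
    by (simp add: scaleR_circle_L2_def)
  show "r *\<^sub>R (x + y) = r *\<^sub>R x + r *\<^sub>R y" "(r + s) *\<^sub>R x = r *\<^sub>R x + s *\<^sub>R x"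
    "r *\<^sub>R s *\<^sub>R x = (r * s) *\<^sub>R x"
    by (simp_all add: scaleR_circle_L2_def C1 C2 C3)
  show "1 *\<^sub>R x = x"
    unfolding scaleR_circle_L2_def by transfer (auto simp: L2_eq_def)
  show I1: "cinner x y = cnj (cinner y x)" for x y :: circle_L2
  proof transfer
    fix f g
    have "cnj (\<integral>z. g z * cnj (f z) \<partial>circle_measure) = (\<integral>z. cnj (g z * cnj (f z)) \<partial>circle_measure)"
      by (rule Bochner_Integration.integral_cnj[symmetric])
    also have "\<dots> = (\<integral>z. f z * cnj (g z) \<partial>circle_measure)"
      by (simp add: mult.commute)
    finally show "(\<integral>z. f z * cnj (g z) \<partial>circle_measure) = cnj (\<integral>z. g z * cnj (f z) \<partial>circle_measure)"
      by simp
  qed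
  show I2: "cinner (x + y) z = cinner x z + cinner y z"
    by transfer (auto simp: L2_eq_def distrib_right integrable_mult_cnj)
  show I3: "cinner (c *\<^sub>C x) y = c * cinner x y" for c :: complex and x y :: circle_L2
    by transfer (auto simp: L2_eq_def mult.assoc)
  show "inner x y = Re (cinner x y)"
    by (simp add: inner_circle_L2_def)
  show "inner x y = inner y x"
    unfolding inner_circle_L2_def by (subst I1) simp
  show "inner (x + y) z = inner x z + inner y z"
    by (simp add: inner_circle_L2_def I2)
  show "inner (r *\<^sub>R x) y = r * inner x y"
    by (simp add: inner_circle_L2_def scaleR_circle_L2_def I3)
  have self: "Re (\<integral>z. f z * cnj (f z) \<partial>circle_measure) = (\<integral>z. (norm (f z))\<^sup>2 \<partial>circle_measure)"
    for f :: "complex \<Rightarrow> complex"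
  proof -
    have "(\<integral>z. f z * cnj (f z) \<partial>circle_measure)
        = (\<integral>z. complex_of_real ((norm (f z))\<^sup>2) \<partial>circle_measure)"
      by (simp only: complex_norm_square)
    then show ?thesis by (simp only: integral_complex_of_real Re_complex_of_real)
  qed
  show "0 \<le> inner x x"
    unfolding inner_circle_L2_def by transfer (simp only: self, simp)
  show "inner x x = 0 \<longleftrightarrow> x = 0"
    unfolding inner_circle_L2_def
    by transfer (simp only: self, auto simp: L2_eq_def square_integrable_def
        integral_nonneg_eq_0_iff_AE)
  show "norm x = sqrt (inner x x)" by (simp add: norm_circle_L2_def)
  show "sgn x = inverse (norm x) *\<^sub>R x" by (simp add: sgn_circle_L2_def)
  show "dist x y = norm (x - y)" by (simp add: dist_circle_L2_def)
  show "(uniformity :: (circle_L2 \<times> circle_L2) filter) =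
      (INF e\<in>{0<..}. principal {(x, y). dist x y < e})"
    by (simp add: uniformity_circle_L2_def)
  show "open U \<longleftrightarrow> (\<forall>x\<in>U. eventually (\<lambda>(x', y). x' = x \<longrightarrow> y \<in> U) uniformity)"
    for U :: "circle_L2 set"
    by (simp add: open_circle_L2_def)
qed

end

lemma square_integrable_powi: "square_integrable (\<lambda>z. z powi n)"
proof -
  have m: "(\<lambda>z::complex. z powi n) \<in> borel_measurable circle_measure" for n
  proof (cases "n \<ge> 0")
    case True
    then have "(\<lambda>z::complex. z powi n) \<in> borel_measurable borel"
      by (intro borel_measurable_continuous_onI continuous_intros) auto
    then show ?thesis by (rule borel_measurable_circle_measure)
  next
    case False
    have "(\<lambda>z::complex. inverse z ^ nat (- n)) \<in> borel_measurable borel"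
      by measurable
    then show ?thesis
      using False by (intro borel_measurable_circle_measure) (simp add: power_int_def)
  qed
  have ae: "AE z in circle_measure. norm (z::complex) = 1"
    by (rule AE_I2) (simp add: space_circle_measure)
  have "emeasure (uniform_measure lborel {0..<2 * pi}) (UNIV :: real set) = 1"
    using emeasure_uniform_measure_1[of lborel "{0..<2 * pi}"] by simp
  then have "finite_measure (uniform_measure lborel {0..<2 * pi})"
    by (intro finite_measureI) simp
  then have "finite_measure circle_measure"
    unfolding circle_measure_def
    by (rule finite_measure.finite_measure_distr[OF _ cis_measurable_circle])
  then have "integrable circle_measure (\<lambda>_. 1::real)"
    by (intro finite_measure.integrable_const)
  moreover have "(\<lambda>z::complex. (norm (z powi n))\<^sup>2) \<in> borel_measurable circle_measure"
    using m[of n] by measurable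
  moreover have "AE z in circle_measure. (norm (z powi n))\<^sup>2 = 1"
    using ae by eventually_elim (simp add: norm_power_int)
  ultimately have "integrable circle_measure (\<lambda>z::complex. (norm (z powi n))\<^sup>2)"
    by (subst integrable_cong_AE[where g = "\<lambda>_. 1"]) auto
  with m show ?thesis by (simp add: square_integrable_def)
qed

lift_definition fourier_coeff :: "circle_L2 \<Rightarrow> int \<Rightarrow> complex"
  is "\<lambda>f n. \<integral>z. f z * cnj (z powi n) \<partial>circle_measure"
  by (intro ext L2_eq_integral_cong) (auto simp: L2_eq_def square_integrable_powi)

definition essentially_bounded :: "(complex \<Rightarrow> complex) \<Rightarrow> bool" where
  "essentially_bounded m \<longleftrightarrow>
     m \<in> borel_measurable circle_measure \<and> (\<exists>B. AE z in circle_measure. norm (m z) \<le> B)"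

text \<open>The value for symbols outside $L^\infty$ is a dummy that makes the function total.\<close>

lift_definition mult_op :: "(complex \<Rightarrow> complex) \<Rightarrow> circle_L2 \<Rightarrow> circle_L2"
  is "\<lambda>m f z. if essentially_bounded m then m z * f z else 0"
proof -
  fix m f g assume fg: "L2_eq f g"
  show "L2_eq (\<lambda>z. if essentially_bounded m then m z * f z else 0)
      (\<lambda>z. if essentially_bounded m then m z * g z else 0)"
  proof (cases "essentially_bounded m")
    case True
    with fg show ?thesis
      by (auto simp: L2_eq_def essentially_bounded_def intro: square_integrable_mult_bounded)
  qed (simp add: L2_eq_def square_integrable_zero)
qed


section \<open>The Hardy space $H^2$ of the unit circle\<close>

definition hardy_L2 :: "circle_L2 set" where
  "hardy_L2 = {f. \<forall>n<0. fourier_coeff f n = 0}"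

text \<open>Fourier coefficients are inner products with the functions $z^n$; this gives linearity.\<close>

lift_definition circle_power :: "int \<Rightarrow> circle_L2" is "\<lambda>n z. z powi n"
  by (auto simp: L2_eq_def square_integrable_powi)

lemma fourier_coeff_eq_cinner: "fourier_coeff f n = cinner f (circle_power n)"
  by transfer simp

lemma cinner_zero_left: "cinner (0::'a::complex_inner) y = 0"
  using cinner_add_left[of 0 0 y] by simp

typedef hardy = hardy_L2
  morphisms to_L2 of_L2
proof
  show "0 \<in> hardy_L2"
    by (simp add: hardy_L2_def fourier_coeff_eq_cinner cinner_zero_left)
qed

setup_lifting type_definition_hardy

lemma hardy_add: "f \<in> hardy_L2 \<Longrightarrow> g \<in> hardy_L2 \<Longrightarrow> f + g \<in> hardy_L2"
  by (simp add: hardy_L2_def fourier_coeff_eq_cinner cinner_add_left)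

lemma hardy_scaleC: "f \<in> hardy_L2 \<Longrightarrow> c *\<^sub>C f \<in> hardy_L2"
  by (simp add: hardy_L2_def fourier_coeff_eq_cinner cinner_scaleC_left)

lemma hardy_scaleR: "f \<in> hardy_L2 \<Longrightarrow> r *\<^sub>R f \<in> hardy_L2"
  by (simp add: scaleR_scaleC hardy_scaleC)

lemma hardy_uminus: "f \<in> hardy_L2 \<Longrightarrow> - f \<in> hardy_L2"
  using hardy_scaleR[of f "-1"] by simp

lemma hardy_diff: "f \<in> hardy_L2 \<Longrightarrow> g \<in> hardy_L2 \<Longrightarrow> f - g \<in> hardy_L2"
  using hardy_add[of f "- g"] hardy_uminus[of g] by simp

instantiation hardy :: complex_inner
begin

lift_definition zero_hardy :: hardy is 0
  by (simp add: hardy_L2_def fourier_coeff_eq_cinner cinner_zero_left)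
lift_definition plus_hardy :: "hardy \<Rightarrow> hardy \<Rightarrow> hardy" is "(+)" by (rule hardy_add)
lift_definition uminus_hardy :: "hardy \<Rightarrow> hardy" is uminus by (rule hardy_uminus)
lift_definition minus_hardy :: "hardy \<Rightarrow> hardy \<Rightarrow> hardy" is "(-)" by (rule hardy_diff)
lift_definition scaleC_hardy :: "complex \<Rightarrow> hardy \<Rightarrow> hardy" is scaleC by (rule hardy_scaleC)
lift_definition scaleR_hardy :: "real \<Rightarrow> hardy \<Rightarrow> hardy" is scaleR by (rule hardy_scaleR)
lift_definition cinner_hardy :: "hardy \<Rightarrow> hardy \<Rightarrow> complex" is cinner .
lift_definition inner_hardy :: "hardy \<Rightarrow> hardy \<Rightarrow> real" is inner .
lift_definition norm_hardy :: "hardy \<Rightarrow> real" is norm .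
definition "sgn (x::hardy) = inverse (norm x) *\<^sub>R x"
definition "dist (x::hardy) y = norm (x - y)"
definition "(uniformity :: (hardy \<times> hardy) filter) =
  (INF e\<in>{0<..}. principal {(x, y). dist x y < e})"
definition "open (U :: hardy set) \<longleftrightarrow>
  (\<forall>x\<in>U. eventually (\<lambda>(x', y). x' = x \<longrightarrow> y \<in> U) uniformity)"

instance
proof
  fix x y z :: hardy and r s :: real and c d :: complex
  show "x + y + z = x + (y + z)" "x + y = y + x" "0 + x = x" "- x + x = 0" "x - y = x + - y"
    by (transfer; simp)+
  show "r *\<^sub>R (x + y) = r *\<^sub>R x + r *\<^sub>R y" "(r + s) *\<^sub>R x = r *\<^sub>R x + s *\<^sub>R x"
    "r *\<^sub>R s *\<^sub>R x = (r * s) *\<^sub>R x" "1 *\<^sub>R x = x"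
    by (transfer; simp add: algebra_simps)+
  show "inner x y = inner y x" by transfer (rule inner_commute)
  show "inner (x + y) z = inner x z + inner y z" by transfer (rule inner_add_left)
  show "inner (r *\<^sub>R x) y = r * inner x y" "0 \<le> inner x x" "inner x x = 0 \<longleftrightarrow> x = 0"
    by (transfer; simp)+
  show "norm x = sqrt (inner x x)" by transfer (rule norm_eq_sqrt_inner)
  show "c *\<^sub>C (x + y) = c *\<^sub>C x + c *\<^sub>C y" by transfer (rule scaleC_add_right)
  show "(c + d) *\<^sub>C x = c *\<^sub>C x + d *\<^sub>C x" by transfer (rule scaleC_add_left)
  show "c *\<^sub>C d *\<^sub>C x = (c * d) *\<^sub>C x" by transfer (rule scaleC_scaleC)
  show "r *\<^sub>R x = complex_of_real r *\<^sub>C x" by transfer (rule scaleR_scaleC)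
  show "cinner x y = cnj (cinner y x)" by transfer (rule cinner_commute)
  show "cinner (x + y) z = cinner x z + cinner y z" by transfer (rule cinner_add_left)
  show "cinner (c *\<^sub>C x) y = c * cinner x y" by transfer (rule cinner_scaleC_left)
  show "inner x y = Re (cinner x y)" by transfer (rule inner_eq_Re_cinner)
  show "sgn x = inverse (norm x) *\<^sub>R x" by (rule sgn_hardy_def)
  show "dist x y = norm (x - y)" by (rule dist_hardy_def)
  show "(uniformity :: (hardy \<times> hardy) filter) =
      (INF e\<in>{0<..}. principal {(x, y). dist x y < e})"
    by (rule uniformity_hardy_def)
  show "open U \<longleftrightarrow> (\<forall>x\<in>U. eventually (\<lambda>(x', y). x' = x \<longrightarrow> y \<in> U) uniformity)"
    for U :: "hardy set"
    by (rule open_hardy_def)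
qed

end

definition toeplitz :: "(complex \<Rightarrow> complex) \<Rightarrow> hardy \<Rightarrow> hardy" where
  "toeplitz m f = of_L2 (orth_proj hardy_L2 (mult_op m (to_L2 f)))"

abbreviation shift :: "hardy \<Rightarrow> hardy" where
  "shift \<equiv> toeplitz (\<lambda>z. z)"


section \<open>Bounded analytic functions, inner functions and paired operators\<close>

text \<open>Values off the open unit disc are irrelevant: \<^term>\<open>Hinf\<close> represents $H^\infty$ up to equality on
  the disc.\<close>

definition Hinf :: "(complex \<Rightarrow> complex) set" where
  "Hinf = {\<phi>. \<phi> holomorphic_on ball 0 1 \<and> bounded (\<phi> ` ball 0 1)}"

text \<open>Radial limits exist at almost every point of the circle by Fatou's theorem; elsewhere the
  value is arbitrary.\<close>

definition radial_limit :: "(complex \<Rightarrow> complex) \<Rightarrow> complex \<Rightarrow> complex" where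
  "radial_limit \<phi> z = Lim (at_left 1) (\<lambda>r. \<phi> (complex_of_real r * z))"

definition inner_function :: "(complex \<Rightarrow> complex) \<Rightarrow> bool" where
  "inner_function \<theta> \<longleftrightarrow> \<theta> \<in> Hinf \<and> (AE z in circle_measure. norm (radial_limit \<theta> z) = 1)"

definition range_space :: "(complex \<Rightarrow> complex) \<Rightarrow> hardy set" where
  "range_space \<theta> = {f. \<exists>g. to_L2 f = mult_op (radial_limit \<theta>) (to_L2 g)}"

definition model_space :: "(complex \<Rightarrow> complex) \<Rightarrow> hardy set" where
  "model_space \<theta> = corth_comp (range_space \<theta>)"

definition paired_op ::
    "(complex \<Rightarrow> complex) \<Rightarrow> (complex \<Rightarrow> complex) \<Rightarrow> (complex \<Rightarrow> complex) \<Rightarrow> hardy \<Rightarrow> hardy" where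
  "paired_op \<theta> \<phi> \<psi> = (\<lambda>f. toeplitz (radial_limit \<phi>) (orth_proj (range_space \<theta>) f)
                         + toeplitz (radial_limit \<psi>) (orth_proj (model_space \<theta>) f))"

definition is_paired :: "(complex \<Rightarrow> complex) \<Rightarrow> (hardy \<Rightarrow> hardy) \<Rightarrow> bool" where
  "is_paired \<theta> X \<longleftrightarrow> (\<exists>\<phi>\<in>Hinf. \<exists>\<psi>\<in>Hinf. X = paired_op \<theta> \<phi> \<psi>)"

end

theory Submission
  imports Defs "HOL-Complex_Analysis.Complex_Analysis"
begin

text \<open>
  Let $S$ be the shift, $P$ the projection onto $\theta H^2$ and $Q = 1 - P$ the projection onto the model space
  $K_\theta$. The theorem rests on a classical fact (\<open>commutant_of_shift\<close>): a bounded operator on $H^2$ that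
  commutes with $S$ is multiplication by a function of $H^\infty$.

  If $X = T_\varphi P + T_\psi Q$, then $X$ is multiplication by $\varphi$ on $\theta H^2$ and by $\psi$ on $K_\theta$.
  Multiplications commute with $S$ and preserve $\theta H^2$, so $X$ fails to commute with $S$ only because $S$
  moves vectors from $K_\theta$ into $\theta H^2$; this gives $[X, S] = (T_\varphi - T_\psi) P S Q$, which is the second
  condition with $\nu = \psi$ and any nonzero $h_0 \in K_\theta$ (\<open>paired_op_commutator\<close>).

  Conversely, the commutator vanishes on $\theta H^2$, so by invariance $\theta^{-1} X \theta$ is a bounded operator on
  $H^2$ that commutes with $S$. Hence $X = T_\varphi$ on $\theta H^2$ for some $\varphi$. The commutator identity also
  shows that $D = (X - T_\nu) Q$ commutes with $S$ on all of $H^2$. Thus $D$ is a multiplication operator, and it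
  annihilates $\theta$; so $D = 0$ and $X = T_\nu$ on $K_\theta$ (\<open>paired_op_if_commutator\<close>).

  The symbols are unique because they can be read off from the values of $X$ at $\theta \in \theta H^2$ and at
  $1 - \overline{\theta(0)}\,\theta \in K_\theta$, two functions that vanish almost nowhere on the circle. For the second
  one this uses $|\theta(0)| < 1$, which is where $\theta$ has to be nonconstant (\<open>model_space_nonvanishing\<close>).

  The analytic foundation is Fatou's theorem on radial limits (\<open>hardy_eval_radial_limit\<close>). The analytic
  extension of $f \in H^2$ is its Poisson integral, and Poisson integrals converge radially at every point
  where the symmetric averages of $f$ converge, hence almost everywhere by Lebesgue's differentiation
  theorem. The theorem shows that $f \in H^2$ is determined by its Fourier coefficients, and with the completeness of
  $L^2$ it follows that $f$ is the sum of its Fourier series. This yields the Riesz projection $P_+$, the formula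
  $P f = \theta P_+(\bar\theta f)$, and the identification of a function of $H^\infty$ with its boundary values.
\<close>

section \<open>Complex inner product spaces\<close>

lemma cinner_add_right: "cinner x (y + z) = cinner x y + cinner (x::'a::complex_inner) z"
  by (metis cinner_add_left cinner_commute complex_cnj_add)

lemma cinner_scaleC_right: "cinner x (c *\<^sub>C y) = cnj c * cinner (x::'a::complex_inner) y"
  by (metis cinner_commute cinner_scaleC_left complex_cnj_mult)

lemma scaleC_diff_right: "c *\<^sub>C (x - y) = c *\<^sub>C x - c *\<^sub>C (y::'a::complex_inner)"
  using scaleC_add_right[of c "x - y" y] by simp

lemma cinner_diff_left: "cinner (x - y) z = cinner x z - cinner (y::'a::complex_inner) z"
  using cinner_add_left[of "x - y" y z] by simp

lemma cinner_self: "cinner x x = complex_of_real ((norm (x::'a::complex_inner))\<^sup>2)"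
proof (rule complex_eqI)
  show "Re (cinner x x) = Re (complex_of_real ((norm x)\<^sup>2))"
    by (simp add: inner_eq_Re_cinner[symmetric] power2_norm_eq_inner)
  show "Im (cinner x x) = Im (complex_of_real ((norm x)\<^sup>2))"
    using arg_cong[OF cinner_commute[of x x], of Im] by simp
qed

lemma cinner_self_eq_0_iff: "cinner x x = 0 \<longleftrightarrow> x = (0::'a::complex_inner)"
  by (simp add: cinner_self)

lemma norm_scaleC: "norm (c *\<^sub>C x) = cmod c * norm (x::'a::complex_inner)"
proof -
  have "complex_of_real ((norm (c *\<^sub>C x))\<^sup>2) = (c * cnj c) * complex_of_real ((norm x)\<^sup>2)"
    by (simp only: cinner_self[symmetric] cinner_scaleC_left cinner_scaleC_right ac_simps)
  also have "\<dots> = complex_of_real ((cmod c * norm x)\<^sup>2)"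
    by (simp add: complex_norm_square[symmetric] power_mult_distrib)
  finally have "(norm (c *\<^sub>C x))\<^sup>2 = (cmod c * norm x)\<^sup>2"
    using of_real_eq_iff by blast
  then show ?thesis by simp
qed

lemma norm_cinner_le: "cmod (cinner x y) \<le> norm x * norm (y::'a::complex_inner)"
proof (cases "cinner x y = 0")
  case False
  \<comment> \<open>A rotation that makes the inner product real and nonnegative.\<close>
  define c where "c = cnj (cinner x y) / complex_of_real (cmod (cinner x y))"
  have "cmod c = 1"
    using False by (simp add: c_def norm_divide)
  have "cinner (c *\<^sub>C x) y = complex_of_real (cmod (cinner x y))"
    using False complex_norm_square[of "cinner x y"]
    by (simp add: c_def cinner_scaleC_left field_simps power2_eq_square)
  then have "cmod (cinner x y) = inner (c *\<^sub>C x) y"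
    by (simp add: inner_eq_Re_cinner)
  also have "\<dots> \<le> norm (c *\<^sub>C x) * norm y"
    by (rule norm_cauchy_schwarz)
  finally show ?thesis by (simp add: norm_scaleC \<open>cmod c = 1\<close>)
qed simp

lemma bounded_linear_cinner_left: "bounded_linear (\<lambda>x. cinner x (y::'a::complex_inner))"
  by (rule bounded_linear_intro[where K = "norm y"])
    (auto simp: cinner_add_left scaleR_scaleC cinner_scaleC_left norm_cinner_le scaleR_conv_of_real)

lemma pythagoras_cinner:
  "cinner x y = 0 \<Longrightarrow> (norm (x + y))\<^sup>2 = (norm x)\<^sup>2 + (norm (y::'a::complex_inner))\<^sup>2"
  by (simp add: power2_norm_eq_inner inner_add_left inner_add_right inner_commute[of y x]
      inner_eq_Re_cinner[of x y])

text \<open>This is how every projection below is computed: a candidate is exhibited and its two defining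
  properties are checked. Two candidates differ by an element of $S$ that is orthogonal to $S$.\<close>

lemma orth_proj_eqI:
  fixes S :: "'a::complex_inner set"
  assumes diff: "\<And>x y. x \<in> S \<Longrightarrow> y \<in> S \<Longrightarrow> x - y \<in> S"
    and p: "p \<in> S" "x - p \<in> corth_comp S"
  shows "orth_proj S x = p"
  unfolding orth_proj_def
proof (rule the_equality)
  fix q assume q: "q \<in> S \<and> x - q \<in> corth_comp S"
  have "cinner ((x - p) - (x - q)) (q - p) = 0"
    using p q diff[of q p] by (simp add: corth_comp_def cinner_diff_left)
  then show "q = p" by (simp add: cinner_self_eq_0_iff)
qed (use p in blast)

section \<open>Functions representing the elements of $L^2$\<close>

text \<open>Identities between elements of $L^2$ are reduced to pointwise identities almost everywhere between
  representatives. The lemmas named \<open>rep\<dots>_AE\<close> evaluate the representative of each operation, and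
  \<open>circle_L2_eqI\<close> turns the pointwise identity back into an equation in $L^2$.\<close>

lemma sq_int_rep: "square_integrable (rep_circle_L2 x)"
  using Quotient3_rep_reflp[OF Quotient3_circle_L2, of x] by (simp add: L2_eq_def)

lemma rep_measurable[measurable]: "rep_circle_L2 x \<in> borel_measurable circle_measure"
  using sq_int_rep[of x] by (simp add: square_integrable_def)

lemma rep_abs_AE:
  "square_integrable f \<Longrightarrow> AE z in circle_measure. rep_circle_L2 (abs_circle_L2 f) z = f z"
  using Quotient3_rep_abs[OF Quotient3_circle_L2, of f] by (simp add: L2_eq_def)

lemma circle_L2_eqI:
  "AE z in circle_measure. rep_circle_L2 x z = rep_circle_L2 y z \<Longrightarrow> x = y"
  using Quotient3_rel_rep[OF Quotient3_circle_L2, of x y] sq_int_rep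
  by (simp add: L2_eq_def)

lemma rep_zero_AE: "AE z in circle_measure. rep_circle_L2 0 z = 0"
  unfolding zero_circle_L2_def by (rule rep_abs_AE) (rule square_integrable_zero)

lemma rep_add_AE:
  "AE z in circle_measure. rep_circle_L2 (x + y) z = rep_circle_L2 x z + rep_circle_L2 y z"
  unfolding plus_circle_L2_def map_fun_apply
  by (rule rep_abs_AE) (intro square_integrable_add sq_int_rep)

lemma rep_scaleC_AE:
  "AE z in circle_measure. rep_circle_L2 (c *\<^sub>C x) z = c * rep_circle_L2 x z"
  unfolding scaleC_circle_L2_def map_fun_apply id_apply
  by (rule rep_abs_AE) (intro square_integrable_scaleC sq_int_rep)

lemma rep_diff_AE:
  "AE z in circle_measure. rep_circle_L2 (x - y) z = rep_circle_L2 x z - rep_circle_L2 y z"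
  using rep_add_AE[of "x - y" y] by eventually_elim simp

lemma rep_circle_power_AE: "AE z in circle_measure. rep_circle_L2 (circle_power n) z = z powi n"
  unfolding circle_power_def map_fun_apply id_apply
  by (rule rep_abs_AE) (rule square_integrable_powi)

lemma rep_mult_op_AE:
  assumes "essentially_bounded m"
  shows "AE z in circle_measure. rep_circle_L2 (mult_op m x) z = m z * rep_circle_L2 x z"
proof -
  have "mult_op m x = abs_circle_L2 (\<lambda>z. m z * rep_circle_L2 x z)"
    using assms by (simp add: mult_op_def)
  moreover have "square_integrable (\<lambda>z. m z * rep_circle_L2 x z)"
    using assms by (auto simp: essentially_bounded_def intro: square_integrable_mult_bounded sq_int_rep)
  ultimately show ?thesis by (simp add: rep_abs_AE)
qed

lemma cinner_circle_eq:
  "cinner x y = (\<integral>z. rep_circle_L2 x z * cnj (rep_circle_L2 y z) \<partial>circle_measure)"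
  by (simp add: cinner_circle_L2_def)

lemma fourier_coeff_eq:
  "fourier_coeff x n = (\<integral>z. rep_circle_L2 x z * cnj (z powi n) \<partial>circle_measure)"
  by (simp add: fourier_coeff_def)

lemma norm_circle_sq:
  "(norm x)\<^sup>2 = (\<integral>z. (cmod (rep_circle_L2 x z))\<^sup>2 \<partial>circle_measure)"
proof -
  have "complex_of_real ((norm x)\<^sup>2)
      = (\<integral>z. complex_of_real ((cmod (rep_circle_L2 x z))\<^sup>2) \<partial>circle_measure)"
    by (simp only: cinner_self[symmetric] cinner_circle_eq complex_norm_square)
  then show ?thesis
    by (simp only: integral_complex_of_real of_real_eq_iff)
qed

lemma integrable_rep_sq:
  "integrable circle_measure (\<lambda>z. (cmod (rep_circle_L2 x z))\<^sup>2)"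
  using sq_int_rep by (simp add: square_integrable_def)

section \<open>Integration over the circle\<close>

lemma emeasure_circle_measure: "emeasure circle_measure (space circle_measure) = 1"
proof -
  let ?U = "uniform_measure lborel {0..<2 * pi} :: real measure"
  have "space circle_measure \<in> sets (restrict_space borel (sphere 0 1))"
    using sets.top[of circle_measure] by (simp add: circle_measure_def)
  then have "emeasure circle_measure (space circle_measure)
      = emeasure ?U (cis -` space circle_measure \<inter> space ?U)"
    unfolding circle_measure_def by (rule emeasure_distr[OF cis_measurable_circle])
  also have "cis -` space circle_measure \<inter> space ?U = UNIV"
    by (auto simp: space_circle_measure)
  finally show ?thesis
    using emeasure_uniform_measure_1[of lborel "{0..<2 * pi}"] by simp
qed

interpretation circle: finite_measure circle_measure
  by (rule finite_measureI) (simp add: emeasure_circle_measure)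

lemma measure_circle_measure: "measure circle_measure (space circle_measure) = 1"
  by (simp add: measure_def emeasure_circle_measure)

lemma AE_circle_norm: "AE z in circle_measure. cmod z = 1"
  by (rule AE_I2) (simp add: space_circle_measure)

lemma measurable_cnj_circle[measurable (raw)]:
  "f \<in> borel_measurable M \<Longrightarrow> (\<lambda>z. cnj (f z)) \<in> borel_measurable M"
  by (rule borel_measurable_continuous_on[of cnj]) (intro continuous_intros)

lemma circle_measure_density:
  "circle_measure = distr (density lborel (\<lambda>t. ennreal (indicator {0..<2*pi} t / (2*pi))))
     (restrict_space borel (sphere 0 1)) cis"
proof -
  have "indicator {0..<2*pi} t / emeasure lborel {0..<2*pi}
      = ennreal (indicator {0..<2*pi} t / (2*pi))" for t :: real
    by (cases "t \<in> {0..<2*pi}") (auto simp: divide_ennreal[symmetric] simp flip: ennreal_1)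
  then show ?thesis by (simp add: circle_measure_def uniform_measure_def)
qed

lemma cis_measurable_sphere: "cis \<in> borel \<rightarrow>\<^sub>M restrict_space borel (sphere 0 1)"
  using cis_measurable_circle
  by (simp add: measurable_cong_sets[OF sets_uniform_measure refl] cong: measurable_cong_sets)

lemma measurable_comp_cis:
  assumes "f \<in> borel_measurable circle_measure"
  shows "(\<lambda>t. f (cis t)) \<in> borel_measurable borel"
  using measurable_comp[OF cis_measurable_sphere, of f borel] assms
  by (simp add: circle_measure_def comp_def)

lemma
  fixes f :: "complex \<Rightarrow> 'b::{banach, second_countable_topology}"
  assumes f: "f \<in> borel_measurable circle_measure"
  shows integrable_circle_iff: "integrable circle_measure f
      \<longleftrightarrow> integrable lborel (\<lambda>t. (indicator {0..<2*pi} t / (2*pi)) *\<^sub>R f (cis t))"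
    and integral_circle:
      "(\<integral>z. f z \<partial>circle_measure) = (\<integral>t. (indicator {0..<2*pi} t / (2*pi)) *\<^sub>R f (cis t) \<partial>lborel)"
proof -
  have m: "(\<lambda>t. f (cis t)) \<in> borel_measurable lborel"
    using measurable_comp_cis[OF f] by simp
  have f': "f \<in> borel_measurable (restrict_space borel (sphere 0 1))"
    using f by (simp add: circle_measure_def)
  have c: "cis \<in> density lborel (\<lambda>t. ennreal (indicator {0..<2*pi} t / (2*pi)))
      \<rightarrow>\<^sub>M restrict_space borel (sphere 0 1)"
    using cis_measurable_sphere by (simp cong: measurable_cong_sets)
  show "integrable circle_measure f
      \<longleftrightarrow> integrable lborel (\<lambda>t. (indicator {0..<2*pi} t / (2*pi)) *\<^sub>R f (cis t))"
    unfolding circle_measure_density integrable_distr_eq[OF c f']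
    by (rule integrable_density[OF m]) auto
  show "(\<integral>z. f z \<partial>circle_measure) = (\<integral>t. (indicator {0..<2*pi} t / (2*pi)) *\<^sub>R f (cis t) \<partial>lborel)"
    unfolding circle_measure_density integral_distr[OF c f']
    by (rule integral_density[OF m]) auto
qed

text \<open>Null sets of the circle are defined through their preimages under \<^const>\<open>cis\<close>, and the image of a null set
  of angles need not be measurable a priori; hence the measurability condition on $P$.\<close>

lemma AE_circle_measure_if_AE_lborel:
  assumes "AE t in lborel. P (cis t)" and "{z \<in> sphere 0 1. P z} \<in> sets circle_measure"
  shows "AE z in circle_measure. P z"
proof -
  have "AE t in uniform_measure lborel {0..<2*pi}. P (cis t)"
    by (rule AE_uniform_measureI) (use assms(1) in auto)
  moreover have "{z \<in> space (restrict_space borel (sphere 0 1)). P z}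
      \<in> sets (restrict_space borel (sphere 0 1))"
    using assms(2) by (simp add: circle_measure_def space_restrict_space)
  ultimately show ?thesis
    unfolding circle_measure_def by (subst AE_distr_iff[OF cis_measurable_circle])
qed

lemma powi_measurable_circle[measurable]: "(\<lambda>z. z powi n) \<in> borel_measurable circle_measure"
  using square_integrable_powi by (auto simp: square_integrable_def)

lemma integral_powi: "(\<integral>z. z powi n \<partial>circle_measure) = (if n = 0 then 1 else 0)"
proof (cases "n = 0")
  case True
  then show ?thesis by (simp add: measure_circle_measure)
next
  case False
  define F where "F = (\<lambda>t. cis (of_int n * t) / (2 * pi * \<i> * of_int n))"
  have "(\<integral>z. z powi n \<partial>circle_measure)
      = (\<integral>t. (indicator {0..<2*pi} t / (2*pi)) *\<^sub>R cis (of_int n * t) \<partial>lborel)"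
    by (simp add: integral_circle cis_power_int)
  also have "\<dots> = (\<integral>t. indicator {0..2*pi} t *\<^sub>R (cis (of_int n * t) / (2*pi)) \<partial>lborel)"
  proof (rule integral_cong_AE)
    have "AE t in lborel. t \<noteq> 2*pi" by (rule AE_lborel_singleton)
    then show "AE t in lborel. (indicator {0..<2*pi} t / (2*pi)) *\<^sub>R cis (of_int n * t)
        = indicator {0..2*pi} t *\<^sub>R (cis (of_int n * t) / (2*pi))"
      by eventually_elim (auto simp: indicator_def scaleR_conv_of_real)
    have [measurable]: "(\<lambda>t. cis (of_int n * t)) \<in> borel_measurable lborel"
      by (simp, intro borel_measurable_continuous_onI continuous_intros)
    show "(\<lambda>t. (indicator {0..<2*pi} t / (2*pi)) *\<^sub>R cis (of_int n * t)) \<in> borel_measurable lborel"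
      "(\<lambda>t. indicator {0..2*pi} t *\<^sub>R (cis (of_int n * t) / (2*pi))) \<in> borel_measurable lborel"
      by measurable
  qed
  also have "\<dots> = F (2*pi) - F 0"
  proof (rule integral_FTC_Icc)
    fix t :: real
    show "(F has_vector_derivative cis (of_int n * t) / (2*pi)) (at t within {0..2*pi})"
    proof -
      have "((\<lambda>w. exp (\<i> * (of_int n * w)) / (2 * pi * \<i> * of_int n))
          has_field_derivative exp (\<i> * (of_int n * of_real t)) / (2 * pi)) (at (of_real t))"
        using False by (auto intro!: derivative_eq_intros simp: field_simps)
      from has_vector_derivative_real_field[OF this]
      show ?thesis by (simp add: F_def cis_conv_exp)
    qed
  qed (auto intro!: continuous_intros)
  also have "F (2*pi) = F 0"
    by (simp add: F_def cis_conv_exp exp_eq_1 mult.commute[of _ pi] flip: cis_power_int)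
  finally show ?thesis using False by simp
qed

lemma cinner_circle_power:
  "cinner (circle_power m) (circle_power n) = (if m = n then 1 else 0)"
proof -
  have "cinner (circle_power m) (circle_power n)
      = (\<integral>z. z powi (m - n) \<partial>circle_measure)"
    unfolding cinner_circle_eq
  proof (rule integral_cong_AE)
    show "AE z in circle_measure. rep_circle_L2 (circle_power m) z
        * cnj (rep_circle_L2 (circle_power n) z) = z powi (m - n)"
      using rep_circle_power_AE[of m] rep_circle_power_AE[of n] AE_circle_norm
    proof eventually_elim
      case (elim z)
      have "z \<noteq> 0" using elim by auto
      moreover have "z * cnj z = 1"
        using elim by (simp flip: complex_norm_square)
      ultimately have "cnj z = inverse z"
        by (metis inverse_unique)
      with elim \<open>z \<noteq> 0\<close> show ?case
        by (simp add: power_int_diff divide_inverse power_int_inverse)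
    qed
  qed measurable
  then show ?thesis by (simp add: integral_powi)
qed

lemma norm_circle_power: "norm (circle_power n) = 1"
proof -
  have "complex_of_real ((norm (circle_power n))\<^sup>2) = 1"
    using cinner_self[of "circle_power n"] by (simp add: cinner_circle_power)
  then have "(norm (circle_power n))\<^sup>2 = 1\<^sup>2"
    by (metis of_real_eq_1_iff one_power2)
  then show ?thesis by (rule power2_eq_imp_eq) auto
qed

text \<open>Cauchy--Schwarz for $|x|$ and the constant $1$, which has norm $1$.\<close>

lemma integral_norm_rep_le: "(\<integral>z. cmod (rep_circle_L2 x z) \<partial>circle_measure) \<le> norm x"
proof -
  define y where "y = abs_circle_L2 (\<lambda>z. complex_of_real (cmod (rep_circle_L2 x z)))"
  have y: "AE z in circle_measure. rep_circle_L2 y z = complex_of_real (cmod (rep_circle_L2 x z))"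
    unfolding y_def using sq_int_rep[of x]
    by (intro rep_abs_AE) (auto simp: square_integrable_def)
  have "(norm y)\<^sup>2 = (norm x)\<^sup>2"
    unfolding norm_circle_sq by (rule integral_cong_AE) (use y in auto)
  moreover have "fourier_coeff y 0
      = (\<integral>z. complex_of_real (cmod (rep_circle_L2 x z)) \<partial>circle_measure)"
    unfolding fourier_coeff_eq by (rule integral_cong_AE) (use y in auto)
  moreover have "cmod (fourier_coeff y 0) \<le> norm y * norm (circle_power 0)"
    by (simp add: fourier_coeff_eq_cinner norm_cinner_le)
  moreover have "norm (circle_power 0) = 1" by (rule norm_circle_power)
  ultimately show ?thesis by (simp add: abs_of_nonneg)
qed

lemma integrable_rep: "integrable circle_measure (rep_circle_L2 x)"
proof (rule Bochner_Integration.integrable_bound)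
  show "integrable circle_measure (\<lambda>z. 1 + (cmod (rep_circle_L2 x z))\<^sup>2)"
    by (intro Bochner_Integration.integrable_add integrable_rep_sq) auto
  have "t \<le> 1 + t\<^sup>2" for t :: real
    using sum_squares_bound[of t 1] zero_le_power2[of t] by (simp, linarith)
  then show "AE z in circle_measure. cmod (rep_circle_L2 x z)
      \<le> norm (1 + (cmod (rep_circle_L2 x z))\<^sup>2)"
    by (intro AE_I2) (simp add: abs_of_nonneg)
qed simp

section \<open>Completeness of $L^2$\<close>

text \<open>The Riesz--Fischer argument. The increments have summable $L^1$ norms, so their absolute values have a
  finite sum almost everywhere and the sequence converges pointwise. Fatou's lemma bounds the $L^2$
  distance of the limit from each member, which gives both square integrability and convergence in norm.\<close>

lemma circle_L2_convergent_if_fast: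
  assumes fast: "\<And>k. norm (X (Suc k) - X k) \<le> (1/2)^k"
  shows "convergent (X :: nat \<Rightarrow> circle_L2)"
proof -
  define f where "f = (\<lambda>k. rep_circle_L2 (X k))"
  have [measurable]: "f k \<in> borel_measurable circle_measure" for k
    by (simp add: f_def)
  have diff: "AE z in circle_measure. \<forall>k l. rep_circle_L2 (X k - X l) z = f k z - f l z"
    unfolding AE_all_countable f_def by (intro allI rep_diff_AE)
  have nn_norm: "(\<integral>\<^sup>+z. ennreal (cmod (rep_circle_L2 x z)) \<partial>circle_measure) \<le> ennreal (norm x)" for x
    using integral_norm_rep_le[of x] integrable_norm[OF integrable_rep[of x]]
    by (subst nn_integral_eq_integral) (auto intro!: ennreal_leI)
  have "(\<integral>\<^sup>+z. (\<Sum>k. ennreal (cmod (f (Suc k) z - f k z))) \<partial>circle_measure)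
      = (\<Sum>k. \<integral>\<^sup>+z. ennreal (cmod (f (Suc k) z - f k z)) \<partial>circle_measure)"
    by (rule nn_integral_suminf) measurable
  also have "\<dots> = (\<Sum>k. \<integral>\<^sup>+z. ennreal (cmod (rep_circle_L2 (X (Suc k) - X k) z)) \<partial>circle_measure)"
    by (intro suminf_cong nn_integral_cong_AE, use diff in eventually_elim) simp
  also have "\<dots> \<le> (\<Sum>k. ennreal ((1/2)^k))"
    by (intro suminf_le summableI order_trans[OF nn_norm] ennreal_leI fast)
  also have "\<dots> < \<infinity>"
    by (subst suminf_ennreal2) (auto intro!: summable_geometric)
  finally have "AE z in circle_measure. (\<Sum>k. ennreal (cmod (f (Suc k) z - f k z))) \<noteq> \<infinity>"
    by (intro nn_integral_PInf_AE) auto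
  then have conv: "AE z in circle_measure. convergent (\<lambda>k. f k z)"
  proof eventually_elim
    case (elim z)
    then have "summable (\<lambda>k. cmod (f (Suc k) z - f k z))"
      by (intro summable_suminf_not_top) auto
    then have "summable (\<lambda>k. f (Suc k) z - f k z)"
      by (rule summable_norm_cancel)
    then have "convergent (\<lambda>n. (\<Sum>k<n. f (Suc k) z - f k z) + f 0 z)"
      by (intro convergent_add) (auto simp: summable_iff_convergent convergent_const)
    moreover have "(\<Sum>k<n. f (Suc k) z - f k z) + f 0 z = f n z" for n
      using sum_lessThan_telescope[of "\<lambda>k. f k z" n] by simp
    ultimately show ?case by simp
  qed
  define g where "g = (\<lambda>z. lim (\<lambda>k. f k z))"
  have [measurable]: "g \<in> borel_measurable circle_measure"
    unfolding g_def by measurable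
  have near: "norm (X m - X n) \<le> 2 * (1/2)^n" if "n \<le> m" for m n
  proof -
    have "norm (X m - X n) \<le> 2 * (1/2)^n - 2 * (1/2)^m"
      using that
    proof (induction m rule: dec_induct)
      case (step m)
      have "norm (X (Suc m) - X n) \<le> norm (X (Suc m) - X m) + norm (X m - X n)"
        using norm_triangle_ineq[of "X (Suc m) - X m" "X m - X n"] by simp
      with step.IH fast[of m] show ?case unfolding power_Suc by linarith
    qed simp
    then show ?thesis by (smt (verit) zero_le_power divide_nonneg_nonneg)
  qed
  have nn_sq: "(\<integral>\<^sup>+z. ennreal ((cmod (rep_circle_L2 x z))\<^sup>2) \<partial>circle_measure) = ennreal ((norm x)\<^sup>2)" for x
    unfolding norm_circle_sq by (rule nn_integral_eq_integral[OF integrable_rep_sq]) auto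
  have bound: "(\<integral>\<^sup>+z. ennreal ((cmod (g z - f n z))\<^sup>2) \<partial>circle_measure) \<le> ennreal ((2 * (1/2)^n)\<^sup>2)" for n
  proof -
    have "(\<integral>\<^sup>+z. ennreal ((cmod (g z - f n z))\<^sup>2) \<partial>circle_measure)
        = (\<integral>\<^sup>+z. liminf (\<lambda>m. ennreal ((cmod (f m z - f n z))\<^sup>2)) \<partial>circle_measure)"
    proof (intro nn_integral_cong_AE, use conv in eventually_elim)
      case (elim z)
      then have "(\<lambda>m. f m z) \<longlonglongrightarrow> g z" by (simp add: g_def convergent_LIMSEQ_iff)
      then have "(\<lambda>m. ennreal ((cmod (f m z - f n z))\<^sup>2)) \<longlonglongrightarrow> ennreal ((cmod (g z - f n z))\<^sup>2)"
        by (intro tendsto_intros)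
      then show ?case by (rule lim_imp_Liminf[OF trivial_limit_sequentially, symmetric])
    qed
    also have "\<dots> \<le> liminf (\<lambda>m. \<integral>\<^sup>+z. ennreal ((cmod (f m z - f n z))\<^sup>2) \<partial>circle_measure)"
      by (rule nn_integral_liminf) measurable
    also have "\<dots> \<le> ennreal ((2 * (1/2)^n)\<^sup>2)"
    proof (rule Liminf_le)
      show "\<forall>\<^sub>F m in sequentially. (\<integral>\<^sup>+z. ennreal ((cmod (f m z - f n z))\<^sup>2) \<partial>circle_measure)
          \<le> ennreal ((2 * (1/2)^n)\<^sup>2)"
        using eventually_ge_at_top[of n]
      proof eventually_elim
        case (elim m)
        have "(\<integral>\<^sup>+z. ennreal ((cmod (f m z - f n z))\<^sup>2) \<partial>circle_measure)
            = (\<integral>\<^sup>+z. ennreal ((cmod (rep_circle_L2 (X m - X n) z))\<^sup>2) \<partial>circle_measure)"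
          by (intro nn_integral_cong_AE, use diff in eventually_elim) simp
        also have "\<dots> \<le> ennreal ((2 * (1/2)^n)\<^sup>2)"
          unfolding nn_sq by (intro ennreal_leI power_mono near elim) auto
        finally show ?case .
      qed
    qed simp
    finally show ?thesis .
  qed
  have "square_integrable (\<lambda>z. g z - f 0 z)"
    using bound[of 0] unfolding square_integrable_def
    by (intro conjI integrableI_bounded)
      (auto intro: order_le_less_trans[OF _ ennreal_less_top[of "4"]])
  then have "square_integrable (\<lambda>z. (g z - f 0 z) + f 0 z)"
    by (rule square_integrable_add) (simp add: f_def sq_int_rep)
  then have "square_integrable g" by simp
  define x where "x = abs_circle_L2 g"
  have x: "AE z in circle_measure. rep_circle_L2 x z = g z"
    unfolding x_def by (rule rep_abs_AE) fact
  have "norm (X n - x) \<le> 2 * (1/2)^n" for n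
  proof -
    have "ennreal ((norm (x - X n))\<^sup>2) = (\<integral>\<^sup>+z. ennreal ((cmod (g z - f n z))\<^sup>2) \<partial>circle_measure)"
      unfolding nn_sq[symmetric] using x rep_diff_AE[of x "X n"]
      by (intro nn_integral_cong_AE, eventually_elim) (simp add: f_def)
    then have "ennreal ((norm (x - X n))\<^sup>2) \<le> ennreal ((2 * (1/2)^n)\<^sup>2)"
      using bound[of n] by (simp only:)
    then have "(norm (x - X n))\<^sup>2 \<le> (2 * (1/2)^n)\<^sup>2"
      by (subst (asm) ennreal_le_iff) auto
    then have "norm (x - X n) \<le> 2 * (1/2)^n"
      by (rule power2_le_imp_le) simp
    then show ?thesis by (simp add: norm_minus_commute)
  qed
  then have "(\<lambda>n. X n - x) \<longlonglongrightarrow> 0"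
    by (rule Lim_null_comparison[OF always_eventually[OF allI]]) (auto intro!: tendsto_mult_right_zero LIMSEQ_power_zero)
  then show ?thesis
    by (auto simp: convergent_def dest: LIM_zero_cancel)
qed

lemma circle_L2_Cauchy_convergent:
  assumes "Cauchy (X :: nat \<Rightarrow> circle_L2)"
  shows "convergent X"
proof -
  have "\<exists>N. \<forall>m\<ge>N. \<forall>n\<ge>N. dist (X m) (X n) < (1/2)^k" for k :: nat
    using assms unfolding Cauchy_def by simp
  then obtain N where N: "\<And>k m n. m \<ge> N k \<Longrightarrow> n \<ge> N k \<Longrightarrow> dist (X m) (X n) < (1/2)^k"
    by metis
  \<comment> \<open>Indices that are strictly increasing and far enough out for the increments to decay geometrically.\<close>
  define M where "M = rec_nat (N 0) (\<lambda>k m. max (Suc m) (N (Suc k)))"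
  have M_Suc: "M (Suc k) = max (Suc (M k)) (N (Suc k))" for k
    by (simp add: M_def)
  have "N k \<le> M k" for k
    by (cases k) (auto simp: M_def)
  moreover have sm: "strict_mono M"
    by (simp add: strict_mono_Suc_iff M_Suc less_max_iff_disj)
  moreover have "M k \<le> M (Suc k)" for k
    by (simp add: M_Suc)
  ultimately have "norm (X (M (Suc k)) - X (M k)) \<le> (1/2)^k" for k
    using N[of k "M (Suc k)" "M k"] by (metis dist_norm less_imp_le order_trans)
  then have "convergent (\<lambda>k. X (M k))"
    by (intro circle_L2_convergent_if_fast) auto
  then obtain x where "(X \<circ> M) \<longlonglongrightarrow> x"
    by (auto simp: convergent_def comp_def)
  then show ?thesis
    using Cauchy_converges_subseq[OF assms sm] by (auto simp: convergent_def)
qed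

instance circle_L2 :: complete_space
  by standard (rule circle_L2_Cauchy_convergent)

instance circle_L2 :: banach ..

section \<open>Radial limits of Poisson integrals\<close>

lemma eventually_radius: "\<forall>\<^sub>F r in at_left (1::real). 0 < r \<and> r < 1"
  unfolding eventually_at_left_field by (intro exI[of _ 0]) auto

text \<open>A layer cake formula that replaces integration by parts. Writing an even kernel as
  $k(s) = k(a) - \int_{|s|}^a k'(v)\,dv$ and exchanging the integrals brings in only the integrals of $h$ over
  the symmetric intervals $[-v, v]$. It holds for merely integrable $h$, whose primitive need not be
  differentiable everywhere.\<close>

lemma even_kernel_integral_layers:
  fixes k k' :: "real \<Rightarrow> real" and h :: "real \<Rightarrow> complex"
  assumes [measurable]: "h \<in> borel_measurable borel"
    and h: "integrable lborel (\<lambda>s. indicator {-a..a} s *\<^sub>R h s)"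
    and k: "\<And>s. (k has_real_derivative k' s) (at s)" "\<And>s. isCont k' s" "\<And>s. k (-s) = k s"
    and a: "0 \<le> a"
  shows "(\<integral>s. indicator {-a..a} s *\<^sub>R (k s *\<^sub>R h s) \<partial>lborel)
     = k a *\<^sub>R (\<integral>s. indicator {-a..a} s *\<^sub>R h s \<partial>lborel)
       - (\<integral>v. indicator {0..a} v *\<^sub>R (k' v *\<^sub>R (\<integral>s. indicator {-v..v} s *\<^sub>R h s \<partial>lborel)) \<partial>lborel)"
proof -
  define f where "f s v = (if \<bar>s\<bar> \<le> v \<and> v \<le> a then k' v *\<^sub>R h s else 0)" for s v
  have [measurable]: "k' \<in> borel_measurable borel" "k \<in> borel_measurable borel"
    by (intro borel_measurable_continuous_onI continuous_at_imp_continuous_on ballI k(2)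
        DERIV_isCont[OF k(1)])+
  have k': "integrable lborel (\<lambda>v. indicator {0..a} v *\<^sub>R k' v)"
    using borel_integrable_atLeastAtMost'[of 0 a k'] k(2)
    by (auto simp: set_integrable_def intro: continuous_at_imp_continuous_on)
  have prod: "integrable (lborel \<Otimes>\<^sub>M lborel)
      (\<lambda>(s, v). (indicator {0..a} v *\<^sub>R k' v) *\<^sub>R (indicator {-a..a} s *\<^sub>R h s))"
  proof (rule lborel_pair.Fubini_integrable)
    show "integrable lborel (\<lambda>s. \<integral>v. norm (case (s, v) of (s, v) \<Rightarrow>
        (indicator {0..a} v *\<^sub>R k' v) *\<^sub>R (indicator {-a..a} s *\<^sub>R h s)) \<partial>lborel)"
      using integrable_norm[OF h]
      by (simp only: prod.case norm_scaleR integral_mult_left_zero integrable_mult_right)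
    show "AE s in lborel. integrable lborel (\<lambda>v. case (s, v) of (s, v) \<Rightarrow>
        (indicator {0..a} v *\<^sub>R k' v) *\<^sub>R (indicator {-a..a} s *\<^sub>R h s))"
      using k' by (intro AE_I2) simp
  qed measurable
  have int_f: "integrable (lborel \<Otimes>\<^sub>M lborel) (\<lambda>(s, v). f s v)"
  proof (rule Bochner_Integration.integrable_bound[OF prod])
    show "(\<lambda>(s, v). f s v) \<in> borel_measurable (lborel \<Otimes>\<^sub>M lborel)"
    proof -
      have [measurable]: "Measurable.pred (lborel \<Otimes>\<^sub>M lborel) (\<lambda>p. \<bar>fst p\<bar> \<le> snd p \<and> snd p \<le> a)"
        by measurable
      have [measurable]: "(\<lambda>p. k' (snd p) *\<^sub>R h (fst p)) \<in> borel_measurable (lborel \<Otimes>\<^sub>M lborel)"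
        by measurable
      show ?thesis
        unfolding f_def case_prod_beta by measurable
    qed
    have "norm (f s v) \<le> norm ((indicator {0..a} v *\<^sub>R k' v) *\<^sub>R (indicator {-a..a} s *\<^sub>R h s))" for s v
    proof (cases "\<bar>s\<bar> \<le> v \<and> v \<le> a")
      case True
      then have "s \<in> {-a..a}" "v \<in> {0..a}" by (auto simp: abs_le_iff)
      with True show ?thesis by (simp only: f_def indicator_simps) simp
    next
      case False
      then show ?thesis by (simp only: f_def if_False norm_zero norm_ge_zero)
    qed
    then show "AE p in lborel \<Otimes>\<^sub>M lborel. norm (case p of (s, v) \<Rightarrow> f s v)
        \<le> norm (case p of (s, v) \<Rightarrow> (indicator {0..a} v *\<^sub>R k' v) *\<^sub>R (indicator {-a..a} s *\<^sub>R h s))"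
      by (intro AE_I2) (simp only: case_prod_beta)
  qed
  have inner_v: "(\<integral>v. f s v \<partial>lborel) = indicator {-a..a} s *\<^sub>R ((k a - k s) *\<^sub>R h s)" for s
  proof (cases "\<bar>s\<bar> \<le> a")
    case True
    have "has_bochner_integral lborel (\<lambda>v. k' v * indicator {\<bar>s\<bar>..a} v) (k a - k \<bar>s\<bar>)"
      by (rule has_bochner_integral_FTC_Icc_real) (use True k in auto)
    then have "has_bochner_integral lborel (\<lambda>v. (k' v * indicator {\<bar>s\<bar>..a} v) *\<^sub>R h s) ((k a - k \<bar>s\<bar>) *\<^sub>R h s)"
      by (rule has_bochner_integral_scaleR_left)
    moreover have "(k' v * indicator {\<bar>s\<bar>..a} v) *\<^sub>R h s = f s v" for v
      by (simp add: f_def indicator_def)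
    ultimately have "(\<integral>v. f s v \<partial>lborel) = (k a - k \<bar>s\<bar>) *\<^sub>R h s"
      by (simp add: has_bochner_integral_integral_eq)
    also have "k \<bar>s\<bar> = k s"
      using k(3)[of s] by (simp add: abs_if)
    finally show ?thesis using True by (simp add: abs_le_iff)
  next
    case False
    then have "f s v = 0" for v by (auto simp: f_def)
    with False show ?thesis by (auto simp: indicator_def abs_le_iff)
  qed
  have inner_s: "(\<integral>s. f s v \<partial>lborel)
      = indicator {0..a} v *\<^sub>R (k' v *\<^sub>R (\<integral>s. indicator {-v..v} s *\<^sub>R h s \<partial>lborel))" for v
  proof -
    have "f s v = (indicator {0..a} v * k' v) *\<^sub>R (indicator {-v..v} s *\<^sub>R h s)" for s
      by (auto simp: f_def indicator_def)
    then have "(\<integral>s. f s v \<partial>lborel)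
        = (indicator {0..a} v * k' v) *\<^sub>R (\<integral>s. indicator {-v..v} s *\<^sub>R h s \<partial>lborel)"
      by (simp only: integral_scaleR_right)
    then show ?thesis by (simp only: scaleR_scaleR)
  qed
  have int_k: "integrable lborel (\<lambda>s. indicator {-a..a} s *\<^sub>R ((k a - k s) *\<^sub>R h s))"
    using lborel_pair.integrable_fst[OF int_f] by (simp add: inner_v)
  have "(\<integral>s. indicator {-a..a} s *\<^sub>R ((k a - k s) *\<^sub>R h s) \<partial>lborel)
      = (\<integral>v. indicator {0..a} v *\<^sub>R (k' v *\<^sub>R (\<integral>s. indicator {-v..v} s *\<^sub>R h s \<partial>lborel)) \<partial>lborel)"
    using lborel_pair.Fubini_integral[OF int_f] by (simp add: inner_v inner_s)
  moreover have "(\<integral>s. indicator {-a..a} s *\<^sub>R (k s *\<^sub>R h s) \<partial>lborel)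
      = (\<integral>s. k a *\<^sub>R (indicator {-a..a} s *\<^sub>R h s)
          - indicator {-a..a} s *\<^sub>R ((k a - k s) *\<^sub>R h s) \<partial>lborel)"
    by (intro Bochner_Integration.integral_cong) (auto simp: algebra_simps)
  moreover have "\<dots> = (\<integral>s. k a *\<^sub>R (indicator {-a..a} s *\<^sub>R h s) \<partial>lborel)
      - (\<integral>s. indicator {-a..a} s *\<^sub>R ((k a - k s) *\<^sub>R h s) \<partial>lborel)"
    by (intro Bochner_Integration.integral_diff integrable_scaleR_right h int_k)
  ultimately show ?thesis by (simp only: integral_scaleR_right)
qed

definition poisson_kernel :: "real \<Rightarrow> real \<Rightarrow> real" where
  "poisson_kernel r s = (1 - r\<^sup>2) / (1 - 2 * r * cos s + r\<^sup>2)"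

definition poisson_kernel_deriv :: "real \<Rightarrow> real \<Rightarrow> real" where
  "poisson_kernel_deriv r s = - ((1 - r\<^sup>2) * (2 * r * sin s)) / (1 - 2 * r * cos s + r\<^sup>2)\<^sup>2"

lemma poisson_denominator_pos:
  fixes r s :: real
  assumes "0 \<le> r" "r < 1"
  shows "0 < 1 - 2 * r * cos s + r\<^sup>2"
proof -
  have "1 - 2 * r * cos s + r\<^sup>2 = (1 - r)\<^sup>2 + 2 * (r * (1 - cos s))"
    by (simp add: power2_eq_square algebra_simps)
  also have "\<dots> > 0"
    using assms by (intro add_pos_nonneg mult_nonneg_nonneg) auto
  finally show ?thesis .
qed

lemma poisson_kernel_derivative:
  assumes "0 \<le> r" "r < 1"
  shows "(poisson_kernel r has_real_derivative poisson_kernel_deriv r s) (at s)"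
  unfolding poisson_kernel_def poisson_kernel_deriv_def
  using poisson_denominator_pos[OF assms, of s]
  by (auto intro!: derivative_eq_intros simp: power2_eq_square field_simps)

lemma isCont_poisson_kernel_deriv:
  assumes "0 \<le> r" "r < 1"
  shows "isCont (poisson_kernel_deriv r) s"
proof -
  have "1 - 2 * r * cos s + r\<^sup>2 \<noteq> 0" for s
    using poisson_denominator_pos[OF assms, of s] by simp
  then have "continuous_on UNIV (poisson_kernel_deriv r)"
    unfolding poisson_kernel_deriv_def[abs_def] by (intro continuous_intros) auto
  then show ?thesis by (simp add: continuous_on_eq_continuous_at)
qed

lemma tendsto_poisson_kernel_0:
  assumes "cos s \<noteq> 1"
  shows "((\<lambda>r. poisson_kernel r s) \<longlongrightarrow> 0) (at_left 1)"
proof -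
  have "((\<lambda>r. poisson_kernel r s) \<longlongrightarrow> (1 - 1\<^sup>2) / (1 - 2 * 1 * cos s + 1\<^sup>2)) (at_left 1)"
    unfolding poisson_kernel_def using assms by (intro tendsto_intros) auto
  then show ?thesis by simp
qed

text \<open>The Poisson integral of $h$ at a fixed boundary point tends to $0$ as soon as the averages of $h$ over
  small symmetric intervals do. By the layer formula the integral is $\int_0^\pi (-k'(v)) H(v)\,dv$ up to a
  boundary term that vanishes with $k(\pi)$. Since $-k' \ge 0$ on $[0, \pi]$, the part where
  $|H(v)| \le \varepsilon v$ costs at most $\varepsilon \int_0^\pi (-k'(v)) v\,dv$, which is at most
  $\varepsilon\pi$ by the same formula applied to $h = 1$; the rest is at most a constant times $k(d)$, which
  tends to $0$ as $r$ tends to $1$.\<close>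

lemma poisson_integral_tendsto_0:
  fixes h :: "real \<Rightarrow> complex"
  defines "H \<equiv> \<lambda>v. \<integral>s. indicator {-v..v} s *\<^sub>R h s \<partial>lborel"
  assumes [measurable]: "h \<in> borel_measurable borel"
    and h: "integrable lborel (\<lambda>s. indicator {-pi..pi} s *\<^sub>R h s)"
    and mass: "\<And>r. 0 < r \<Longrightarrow> r < 1 \<Longrightarrow>
      (\<integral>s. indicator {-pi..pi} s *\<^sub>R complex_of_real (poisson_kernel r s) \<partial>lborel) = 2 * pi"
    and small: "\<And>e. e > 0 \<Longrightarrow> \<exists>d>0. \<forall>v. 0 < v \<and> v < d \<longrightarrow> norm (H v) \<le> e * v"
  shows "((\<lambda>r. \<integral>s. indicator {-pi..pi} s *\<^sub>R (poisson_kernel r s *\<^sub>R h s) \<partial>lborel) \<longlongrightarrow> 0) (at_left 1)"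
proof (rule tendstoI)
  fix e :: real assume "e > 0"
  define e' where "e' = e / (2 * pi)"
  have "e' > 0" using \<open>e > 0\<close> by (simp add: e'_def)
  obtain d0 where d0: "d0 > 0" "\<And>v. 0 < v \<Longrightarrow> v < d0 \<Longrightarrow> norm (H v) \<le> e' * v"
    using small[OF \<open>e' > 0\<close>] by auto
  define d where "d = min d0 pi / 2"
  have d: "0 < d" "d < pi" "d < d0"
    using d0(1) by (auto simp: d_def min_def)
  define C where "C = (\<integral>s. norm (indicator {-pi..pi} s *\<^sub>R h s) \<partial>lborel)"
  have "0 \<le> C" by (simp add: C_def)
  have HC: "norm (H v) \<le> C" if "v \<le> pi" for v
  proof -
    have "norm (H v) \<le> (\<integral>s. norm (indicator {-v..v} s *\<^sub>R h s) \<partial>lborel)"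
      unfolding H_def by (rule integral_norm_bound)
    also have "\<dots> \<le> C"
      unfolding C_def
    proof (rule integral_mono')
      show "integrable lborel (\<lambda>s. norm (indicator {-pi..pi} s *\<^sub>R h s))"
        using h by (rule integrable_norm)
    qed (use that in \<open>auto simp: indicator_def\<close>)
    finally show ?thesis .
  qed
  have Hb: "norm (H v) \<le> e' * v + C * indicator {d..pi} v" if "0 \<le> v" "v \<le> pi" for v
  proof (cases "v < d")
    case True
    have "H 0 = 0"
    proof -
      have "H 0 = (\<integral>s. 0 \<partial>(lborel :: real measure))"
        unfolding H_def
      proof (rule integral_cong_AE)
        show "AE s in lborel. indicator {- 0..0::real} s *\<^sub>R h s = 0"
          using AE_lborel_singleton[of "0::real"] by eventually_elim (simp add: indicator_def)
      qed measurable
      then show ?thesis by simp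
    qed
    then show ?thesis using True that d0(2)[of v] d by (cases "v = 0") (auto simp: indicator_def)
  next
    case False
    then show ?thesis using HC[OF that(2)] that \<open>e' > 0\<close>
      by (auto simp: indicator_def intro: order_trans[OF _ le_add_same_cancel2[THEN iffD2]])
  qed
  have main: "norm (\<integral>s. indicator {-pi..pi} s *\<^sub>R (poisson_kernel r s *\<^sub>R h s) \<partial>lborel)
      \<le> poisson_kernel r pi * C + e' * pi + C * poisson_kernel r d"
    if r: "0 < r" "r < 1" for r
  proof -
    let ?k = "poisson_kernel r" and ?k' = "poisson_kernel_deriv r"
    note kd = poisson_kernel_derivative[OF less_imp_le[OF r(1)] r(2)]
    note kc = isCont_poisson_kernel_deriv[OF less_imp_le[OF r(1)] r(2)]
    have even: "?k (- s) = ?k s" for s by (simp add: poisson_kernel_def)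
    have r2: "r\<^sup>2 \<le> 1" using r by (simp add: power_le_one)
    have kpos: "0 \<le> ?k s" for s
      using r2 poisson_denominator_pos[OF less_imp_le[OF r(1)] r(2), of s]
      by (simp add: poisson_kernel_def)
    have kneg: "?k' s \<le> 0" if "0 \<le> s" "s \<le> pi" for s
      using r2 r that unfolding poisson_kernel_deriv_def
      by (auto intro!: divide_nonneg_nonneg mult_nonneg_nonneg sin_ge_zero)
    have contk': "continuous_on A ?k'" for A
      using kc by (blast intro: continuous_at_imp_continuous_on)
    have int1: "integrable lborel (\<lambda>v. indicator {0..pi} v *\<^sub>R (- ?k' v * v))"
    proof -
      have "continuous_on {0..pi} (\<lambda>v. - ?k' v * v)"
        by (intro continuous_intros contk')
      from borel_integrable_atLeastAtMost'[OF this] show ?thesis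
        by (simp only: set_integrable_def)
    qed
    have int2: "integrable lborel (\<lambda>v. indicator {d..pi} v *\<^sub>R (- ?k' v))"
    proof -
      have "continuous_on {d..pi} (\<lambda>v. - ?k' v)"
        by (intro continuous_intros contk')
      from borel_integrable_atLeastAtMost'[OF this] show ?thesis
        by (simp only: set_integrable_def)
    qed
    have len: "(\<integral>s. indicator {-v..v} s *\<^sub>R (1::complex) \<partial>lborel) = 2 * v" if "0 \<le> v" for v :: real
    proof -
      have "has_bochner_integral lborel (\<lambda>s. indicator {-v..v} s *\<^sub>R (1::complex))
          (measure lborel {-v..v} *\<^sub>R 1)"
        by (rule has_bochner_integral_indicator) (use that in simp_all)
      then have "(\<integral>s. indicator {-v..v} s *\<^sub>R (1::complex) \<partial>lborel) = measure lborel {-v..v} *\<^sub>R 1"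
        by (rule has_bochner_integral_integral_eq)
      also have "measure lborel {-v..v} = 2 * v"
        using that by simp
      finally show ?thesis by (simp only: scaleR_conv_of_real mult_1_right)
    qed
    \<comment> \<open>The layer formula for the constant function evaluates the first moment of the derivative.\<close>
    have layers: "complex_of_real (2 * pi) = ?k pi *\<^sub>R complex_of_real (2 * pi)
        - (\<integral>v. indicator {0..pi} v *\<^sub>R (?k' v *\<^sub>R (\<integral>s. indicator {-v..v} s *\<^sub>R (1::complex) \<partial>lborel)) \<partial>lborel)"
      using even_kernel_integral_layers[of "\<lambda>_. 1" pi ?k ?k', OF _ _ kd kc even] mass[OF r]
      by (simp add: len scaleR_conv_of_real)
    have inner: "(\<integral>v. indicator {0..pi} v *\<^sub>R (?k' v *\<^sub>R (\<integral>s. indicator {-v..v} s *\<^sub>R (1::complex) \<partial>lborel)) \<partial>lborel)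
        = (\<integral>v. complex_of_real (-2 * (indicator {0..pi} v *\<^sub>R (- ?k' v * v))) \<partial>lborel)"
    proof (rule Bochner_Integration.integral_cong[OF refl])
      fix v :: real
      show "indicator {0..pi} v *\<^sub>R (?k' v *\<^sub>R (\<integral>s. indicator {-v..v} s *\<^sub>R (1::complex) \<partial>lborel))
          = complex_of_real (-2 * (indicator {0..pi} v *\<^sub>R (- ?k' v * v)))"
      proof (cases "0 \<le> v \<and> v \<le> pi")
        case True
        then show ?thesis unfolding len[OF True[THEN conjunct1]]
          by (simp add: scaleR_conv_of_real)
      next
        case False
        then have "indicator {0..pi} v = (0::real)" by auto
        then show ?thesis by (simp only: scaleR_zero_left mult_zero_right of_real_0)
      qed
    qed
    have gen: "(\<integral>v. complex_of_real (-2 * F v) \<partial>lborel) = complex_of_real (-2 * (\<integral>v. F v \<partial>lborel))"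
      for F :: "real \<Rightarrow> real"
      by (simp only: integral_complex_of_real integral_mult_right_zero)
    have "complex_of_real (2 * pi) = ?k pi *\<^sub>R complex_of_real (2 * pi)
        - complex_of_real (-2 * (\<integral>v. indicator {0..pi} v *\<^sub>R (- ?k' v * v) \<partial>lborel))"
      using layers unfolding trans[OF inner gen] .
    also have "\<dots> = complex_of_real (?k pi * (2 * pi)
        + 2 * (\<integral>v. indicator {0..pi} v *\<^sub>R (- ?k' v * v) \<partial>lborel))"
      by (simp only: scaleR_conv_of_real of_real_mult of_real_add of_real_minus of_real_numeral
          mult_minus_left diff_minus_eq_add)
    finally have "2 * pi = ?k pi * (2 * pi) + 2 * (\<integral>v. indicator {0..pi} v *\<^sub>R (- ?k' v * v) \<partial>lborel)"
      using of_real_eq_iff by blast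
    moreover have "0 \<le> ?k pi * (2 * pi)" using kpos by simp
    ultimately have first: "(\<integral>v. indicator {0..pi} v *\<^sub>R (- ?k' v * v) \<partial>lborel) \<le> pi"
      by linarith
    have second: "(\<integral>v. indicator {d..pi} v *\<^sub>R (- ?k' v) \<partial>lborel) \<le> ?k d"
    proof -
      have "(\<integral>v. (- ?k' v) * indicator {d..pi} v \<partial>lborel) = - ?k pi - (- ?k d)"
        by (rule integral_FTC_Icc_real)
          (use d in \<open>auto intro: DERIV_minus[OF kd] continuous_minus[OF kc]\<close>)
      then show ?thesis using kpos[of pi] by (simp add: mult.commute)
    qed
    have bnd: "norm (indicator {0..pi} v *\<^sub>R (?k' v *\<^sub>R H v)) \<le>
          e' * (indicator {0..pi} v *\<^sub>R (- ?k' v * v)) + C * (indicator {d..pi} v *\<^sub>R (- ?k' v))" for v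
    proof (cases "0 \<le> v \<and> v \<le> pi")
      case True
      then have "(- ?k' v) * norm (H v) \<le> (- ?k' v) * (e' * v + C * indicator {d..pi} v)"
        using kneg by (intro mult_left_mono Hb) auto
      then show ?thesis
        using True kneg[of v] by (simp add: algebra_simps)
    qed (use d in \<open>auto simp: indicator_def\<close>)
    have "norm (\<integral>v. indicator {0..pi} v *\<^sub>R (?k' v *\<^sub>R H v) \<partial>lborel)
        \<le> (\<integral>v. norm (indicator {0..pi} v *\<^sub>R (?k' v *\<^sub>R H v)) \<partial>lborel)"
      by (rule integral_norm_bound)
    also have "\<dots> \<le> (\<integral>v. e' * (indicator {0..pi} v *\<^sub>R (- ?k' v * v))
        + C * (indicator {d..pi} v *\<^sub>R (- ?k' v)) \<partial>lborel)"
      by (rule integral_mono'[OF _ bnd order_trans[OF norm_ge_zero bnd]])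
        (intro Bochner_Integration.integrable_add integrable_mult_right int1 int2)
    also have "\<dots> = e' * (\<integral>v. indicator {0..pi} v *\<^sub>R (- ?k' v * v) \<partial>lborel)
        + C * (\<integral>v. indicator {d..pi} v *\<^sub>R (- ?k' v) \<partial>lborel)"
      by (simp only: integral_mult_right_zero Bochner_Integration.integral_add[OF
            integrable_mult_right[OF int1] integrable_mult_right[OF int2]])
    also have "\<dots> \<le> e' * pi + C * ?k d"
      using first second \<open>e' > 0\<close> \<open>0 \<le> C\<close> by (intro add_mono mult_left_mono) auto
    finally have *: "norm (\<integral>v. indicator {0..pi} v *\<^sub>R (?k' v *\<^sub>R H v) \<partial>lborel) \<le> e' * pi + C * ?k d" .
    have "(\<integral>s. indicator {-pi..pi} s *\<^sub>R (?k s *\<^sub>R h s) \<partial>lborel)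
        = ?k pi *\<^sub>R H pi - (\<integral>v. indicator {0..pi} v *\<^sub>R (?k' v *\<^sub>R H v) \<partial>lborel)"
      unfolding H_def by (rule even_kernel_integral_layers[OF assms(2) h kd kc even]) auto
    also have "norm \<dots> \<le> norm (?k pi *\<^sub>R H pi) + norm (\<integral>v. indicator {0..pi} v *\<^sub>R (?k' v *\<^sub>R H v) \<partial>lborel)"
      by (rule norm_triangle_ineq4)
    also have "norm (?k pi *\<^sub>R H pi) \<le> ?k pi * C"
      using kpos[of pi] HC[of pi] by (simp add: mult_left_mono)
    finally show ?thesis using * by linarith
  qed
  have "cos d \<noteq> 1"
    using cos_monotone_0_pi[of 0 d] d by auto
  then have "((\<lambda>r. poisson_kernel r pi * C + e' * pi + C * poisson_kernel r d)
      \<longlongrightarrow> 0 * C + e' * pi + C * 0) (at_left 1)"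
    by (intro tendsto_intros tendsto_poisson_kernel_0) auto
  moreover have "0 * C + e' * pi + C * 0 < e"
    using \<open>e > 0\<close> by (simp add: e'_def)
  ultimately have "\<forall>\<^sub>F r in at_left 1. poisson_kernel r pi * C + e' * pi + C * poisson_kernel r d < e"
    by (rule order_tendstoD(2))
  moreover note eventually_radius
  ultimately show "\<forall>\<^sub>F r in at_left 1.
      dist (\<integral>s. indicator {-pi..pi} s *\<^sub>R (poisson_kernel r s *\<^sub>R h s) \<partial>lborel) 0 < e"
  proof eventually_elim
    case (elim r)
    then show ?case using main[of r] unfolding dist_norm diff_0_right by linarith
  qed
qed



section \<open>Lebesgue points and periodic integrals\<close>

text \<open>Lebesgue's differentiation theorem for one-sided averages, applied to $g$ and to its
  reflection: the averages over $[x, x + v]$ and over $[x - v, x]$ both converge to $g(x)$ for almost all $x$.\<close>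

lemma AE_symmetric_derivative_integral:
  fixes g :: "real \<Rightarrow> complex"
  assumes g: "\<And>a b. set_integrable lborel {a..b} g"
  shows "AE x in lborel. \<forall>e>0. \<exists>d>0. \<forall>v. 0 < v \<and> v < d \<longrightarrow>
    norm (\<integral>s. indicator {-v..v} s *\<^sub>R (g (x + s) - g x) \<partial>lborel) \<le> e * v"
proof -
  have HK: "g integrable_on {a..b}" for a b
    using set_borel_integral_eq_integral(1)[OF g] .
  then have HK': "(\<lambda>t. g (- t)) integrable_on {a..b}" for a b
  proof -
    obtain i where "(g has_integral i) {-b..-a}"
      using HK by (auto simp: integrable_on_def)
    then have "((\<lambda>t. g (- t)) has_integral i) {- (- a)..- (- b)}"
      by (simp only: has_integral_reflect_real)
    then show ?thesis by (auto simp: integrable_on_def)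
  qed
  obtain N1 where N1: "negligible N1"
    "\<And>x e. x \<notin> N1 \<Longrightarrow> 0 < e \<Longrightarrow> \<exists>d>0. \<forall>h. 0 < h \<and> h < d \<longrightarrow>
      norm (integral (cbox x (x + h *\<^sub>R One)) g /\<^sub>R h ^ DIM(real) - g x) < e"
    using integrable_ccontinuous_explicit[of g] HK by (metis box_real(2))
  obtain N2 where N2: "negligible N2"
    "\<And>x e. x \<notin> N2 \<Longrightarrow> 0 < e \<Longrightarrow> \<exists>d>0. \<forall>h. 0 < h \<and> h < d \<longrightarrow>
      norm (integral (cbox x (x + h *\<^sub>R One)) (\<lambda>t. g (- t)) /\<^sub>R h ^ DIM(real) - g (- x)) < e"
    using integrable_ccontinuous_explicit[of "\<lambda>t. g (- t)"] HK' by (metis box_real(2))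
  have AE_neg: "AE x in lborel. x \<notin> N" if "negligible N" for N :: "real set"
    using that by (auto simp: negligible_iff_null_sets null_sets_completion_iff2 intro: AE_I')
  have "AE x in lborel. x \<notin> N1"
    by (rule AE_neg[OF N1(1)])
  moreover have "AE x in lborel. - x \<notin> N2"
  proof -
    have "AE x in distr lborel borel uminus. x \<notin> N2"
      unfolding lborel_distr_uminus by (rule AE_neg[OF N2(1)])
    then show ?thesis by (rule AE_distrD[rotated]) auto
  qed
  ultimately show ?thesis
  proof eventually_elim
    case (elim x)
    show ?case
    proof (intro allI impI)
      fix e :: real assume "e > 0"
      obtain d1 where d1: "d1 > 0" "\<And>h. 0 < h \<Longrightarrow> h < d1 \<Longrightarrow>
          norm (integral {x..x + h} g /\<^sub>R h - g x) < e / 2"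
        using N1(2)[OF elim(1), of "e / 2"] \<open>e > 0\<close> by auto
      obtain d2 where d2: "d2 > 0" "\<And>h. 0 < h \<Longrightarrow> h < d2 \<Longrightarrow>
          norm (integral {-x..-x + h} (\<lambda>t. g (- t)) /\<^sub>R h - g x) < e / 2"
        using N2(2)[OF elim(2), of "e / 2"] \<open>e > 0\<close> by auto
      have "norm (\<integral>s. indicator {-v..v} s *\<^sub>R (g (x + s) - g x) \<partial>lborel) \<le> e * v"
        if v: "0 < v" "v < min d1 d2" for v
      proof -
        have split: "A + B - (2 * v) *\<^sub>R c = v *\<^sub>R (A /\<^sub>R v - c) + v *\<^sub>R (B /\<^sub>R v - c)"
          for A B c :: complex
          using v by (simp add: scaleR_conv_of_real field_simps)
        have si: "set_integrable lborel {x - v..x + v} (\<lambda>t. g t - g x)"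
          by (intro set_integral_diff g borel_integrable_atLeastAtMost' continuous_on_const)
        have "(\<integral>s. indicator {-v..v} s *\<^sub>R (g (x + s) - g x) \<partial>lborel)
            = (\<integral>s. indicator {x-v..x+v} (x + 1 * s) *\<^sub>R (g (x + 1 * s) - g x) \<partial>lborel)"
          by (intro Bochner_Integration.integral_cong) (auto simp: indicator_def)
        also have "\<dots> = (LINT t:{x-v..x+v}|lborel. g t - g x)"
          unfolding set_lebesgue_integral_def by (subst (2) lborel_integral_real_affine[of 1 _ x]) auto
        also have "\<dots> = integral {x-v..x+v} (\<lambda>t. g t - g x)"
          by (rule set_borel_integral_eq_integral(2)[OF si])
        also have "\<dots> = integral {x-v..x+v} g - (2 * v) *\<^sub>R g x"
          using v by (subst Henstock_Kurzweil_Integration.integral_diff) (auto intro: HK)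
        also have "integral {x-v..x+v} g = integral {x-v..x} g + integral {x..x+v} g"
          using v by (intro Henstock_Kurzweil_Integration.integral_combine[symmetric] HK) auto
        also have "integral {x-v..x} g = integral {-x..-x+v} (\<lambda>t. g (- t))"
          using Henstock_Kurzweil_Integration.integral_reflect_real[of x "x - v" g] by simp
        also have "integral {-x..-x+v} (\<lambda>t. g (- t)) + integral {x..x+v} g - (2 * v) *\<^sub>R g x
            = v *\<^sub>R (integral {-x..-x+v} (\<lambda>t. g (- t)) /\<^sub>R v - g x)
              + v *\<^sub>R (integral {x..x+v} g /\<^sub>R v - g x)"
          by (rule split)
        also have "norm \<dots> \<le> v * (e / 2) + v * (e / 2)"
          using d1(2)[of v] d2(2)[of v] v
          by (intro norm_triangle_mono) (auto intro: mult_left_mono)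
        finally show ?thesis by (simp add: algebra_simps)
      qed
      then show "\<exists>d>0. \<forall>v. 0 < v \<and> v < d \<longrightarrow>
          norm (\<integral>s. indicator {-v..v} s *\<^sub>R (g (x + s) - g x) \<partial>lborel) \<le> e * v"
        using d1(1) d2(1) by (intro exI[of _ "min d1 d2"]) auto
    qed
  qed
qed

lemma has_bochner_integral_shift_period:
  fixes f :: "complex \<Rightarrow> complex" and n :: int
  assumes "has_bochner_integral lborel (\<lambda>t. indicator {a..<b} t *\<^sub>R f (cis t)) I"
  shows "has_bochner_integral lborel
    (\<lambda>t. indicator {a + 2 * pi * n..<b + 2 * pi * n} t *\<^sub>R f (cis t)) I"
proof -
  have c: "cis (t - 2 * pi * n) = cis t" for t
    using cis_multiple_2pi[of "of_int n"] by (simp add: cis_divide[symmetric] mult.commute)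
  have "has_bochner_integral lborel (\<lambda>t. indicator {a..<b} (- (2 * pi * n) + 1 * t)
      *\<^sub>R f (cis (- (2 * pi * n) + 1 * t))) (I /\<^sub>R \<bar>1\<bar>)"
    using assms by (subst lborel_has_bochner_integral_real_affine_iff[symmetric]) auto
  moreover have "indicator {a..<b} (- (2 * pi * n) + 1 * t) *\<^sub>R f (cis (- (2 * pi * n) + 1 * t))
      = indicator {a + 2 * pi * n..<b + 2 * pi * n} t *\<^sub>R f (cis t)" for t
    using c[of t] by (simp add: indicator_def algebra_simps)
  ultimately show ?thesis by simp
qed

text \<open>After a shift by a multiple of the period the interval starts at some $b \in [0, 2\pi)$, and
  $[b, b + 2\pi)$ arises from $[0, 2\pi)$ by moving $[0, b)$ one period to the right.\<close>

lemma has_bochner_integral_full_period: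
  fixes f :: "complex \<Rightarrow> complex"
  assumes f: "has_bochner_integral lborel (\<lambda>t. indicator {0..<2*pi} t *\<^sub>R f (cis t)) I"
  shows "has_bochner_integral lborel (\<lambda>t. indicator {a..<a + 2*pi} t *\<^sub>R f (cis t)) I"
proof -
  define n where "n = \<lfloor>a / (2*pi)\<rfloor>"
  define b where "b = a - 2 * pi * n"
  have "of_int n \<le> a / (2*pi)" "a / (2*pi) < of_int n + 1"
    by (auto simp: n_def)
  then have b: "0 \<le> b" "b < 2 * pi"
    by (auto simp: b_def field_simps)
  let ?H = "\<lambda>a b. has_bochner_integral lborel (\<lambda>t. indicator {a..<b} t *\<^sub>R f (cis t))"
  define J where "J u v = (\<integral>t. indicator {u..<v} t *\<^sub>R f (cis t) \<partial>lborel)" for u v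
  have sub: "?H u v (J u v)" if "0 \<le> u" "v \<le> 2 * pi" for u v
  proof -
    have "integrable lborel (\<lambda>t. indicator {u..<v} t *\<^sub>R (indicator {0..<2*pi} t *\<^sub>R f (cis t)))"
      by (rule integrable_mult_indicator[OF _ integrable.intros[OF f]]) simp
    moreover have "indicator {u..<v} t *\<^sub>R (indicator {0..<2*pi} t *\<^sub>R f (cis t))
        = indicator {u..<v} t *\<^sub>R f (cis t)" for t
      using that by (auto simp: indicator_def)
    ultimately show ?thesis
      by (simp only: has_bochner_integral_iff J_def simp_thms)
  qed
  have join: "?H u w (x + y)" if "?H u v x" "?H v w y" "u \<le> v" "v \<le> w" for u v w x y
  proof -
    have "indicator {u..<w} t *\<^sub>R f (cis t)
        = indicator {u..<v} t *\<^sub>R f (cis t) + indicator {v..<w} t *\<^sub>R f (cis t)" for t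
      using that(3,4) by (auto simp: indicator_def)
    then show ?thesis
      using has_bochner_integral_add[OF that(1,2)] by simp
  qed
  have "?H (0 + 2 * pi * of_int 1) (b + 2 * pi * of_int 1) (J 0 b)"
    using b by (intro has_bochner_integral_shift_period sub) auto
  then have "?H (2 * pi) (b + 2 * pi) (J 0 b)"
    by (simp only: add_0 of_int_1 mult_1_right)
  then have "?H b (b + 2 * pi) (J b (2 * pi) + J 0 b)"
    by (intro join[OF sub]) (use b in auto)
  moreover have "?H 0 (2 * pi) (J 0 b + J b (2 * pi))"
    by (intro join[OF sub sub]) (use b in auto)
  then have "J 0 b + J b (2 * pi) = I"
    by (rule has_bochner_integral_eq[OF _ f])
  then have "J b (2 * pi) + J 0 b = I"
    by (simp only: add.commute)
  ultimately have "?H b (b + 2 * pi) I"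
    by (simp only:)
  then have "?H (b + 2 * pi * n) (b + 2 * pi + 2 * pi * n) I"
    by (rule has_bochner_integral_shift_period)
  moreover have "b + 2 * pi * n = a" "b + 2 * pi + 2 * pi * n = a + 2 * pi"
    by (simp_all add: b_def)
  ultimately show ?thesis by (simp only:)
qed

lemma has_bochner_integral_half_open_iff:
  fixes f :: "real \<Rightarrow> complex"
  assumes [measurable]: "f \<in> borel_measurable borel"
  shows "has_bochner_integral lborel (\<lambda>t. indicator {a..<b} t *\<^sub>R f t) I
     \<longleftrightarrow> has_bochner_integral lborel (\<lambda>t. indicator {a..b} t *\<^sub>R f t) I"
proof (rule has_bochner_integral_cong_AE)
  show "AE t in lborel. indicator {a..<b} t *\<^sub>R f t = indicator {a..b} t *\<^sub>R f t"
    using AE_lborel_singleton[of b] by eventually_elim (auto simp: indicator_def)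
qed measurable

lemma circle_integral_on_period:
  fixes f :: "complex \<Rightarrow> complex"
  assumes f: "integrable circle_measure f"
  shows "has_bochner_integral lborel (\<lambda>s. indicator {-pi..pi} s *\<^sub>R f (cis (x + s)))
    (2 * pi * (\<integral>z. f z \<partial>circle_measure))"
proof -
  have m: "f \<in> borel_measurable circle_measure" using f by auto
  note [measurable] = measurable_comp_cis[OF m]
  have "has_bochner_integral lborel (\<lambda>t. (indicator {0..<2*pi} t / (2*pi)) *\<^sub>R f (cis t))
      (\<integral>z. f z \<partial>circle_measure)"
    using f by (simp only: has_bochner_integral_iff integrable_circle_iff[OF m] integral_circle[OF m])
  then have "has_bochner_integral lborel
      (\<lambda>t. (2*pi) *\<^sub>R ((indicator {0..<2*pi} t / (2*pi)) *\<^sub>R f (cis t)))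
      ((2*pi) *\<^sub>R (\<integral>z. f z \<partial>circle_measure))"
    by (rule has_bochner_integral_scaleR_right)
  moreover have "(2*pi) *\<^sub>R ((indicator {0..<2*pi} t / (2*pi)) *\<^sub>R f (cis t))
      = indicator {0..<2*pi} t *\<^sub>R f (cis t)" for t
    by simp
  ultimately have "has_bochner_integral lborel (\<lambda>t. indicator {0..<2*pi} t *\<^sub>R f (cis t))
      (2 * pi * (\<integral>z. f z \<partial>circle_measure))"
    by (simp only: scaleR_conv_of_real[of "2*pi" "integral\<^sup>L circle_measure f"])
  from has_bochner_integral_full_period[OF this, of "x - pi"]
  have "has_bochner_integral lborel (\<lambda>t. indicator {x-pi..<x-pi+2*pi} t *\<^sub>R f (cis t))
      (2 * pi * (\<integral>z. f z \<partial>circle_measure))" .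
  moreover have "x - pi + 2 * pi = x + pi" by simp
  ultimately have half: "has_bochner_integral lborel (\<lambda>t. indicator {x-pi..<x+pi} t *\<^sub>R f (cis t))
      (2 * pi * (\<integral>z. f z \<partial>circle_measure))"
    by (simp only:)
  then have "has_bochner_integral lborel (\<lambda>t. indicator {x-pi..x+pi} t *\<^sub>R f (cis t))
      (2 * pi * (\<integral>z. f z \<partial>circle_measure))"
    using half by (subst has_bochner_integral_half_open_iff[symmetric]) simp_all
  then have "has_bochner_integral lborel (\<lambda>s. indicator {x-pi..x+pi} (x + 1 * s) *\<^sub>R f (cis (x + 1 * s)))
      (2 * pi * (\<integral>z. f z \<partial>circle_measure) /\<^sub>R \<bar>1\<bar>)"
    by (subst lborel_has_bochner_integral_real_affine_iff[symmetric]) auto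
  moreover have "indicator {x-pi..x+pi} (x + 1 * s) = (indicator {-pi..pi} s :: real)" for s
    by (auto simp: indicator_def)
  ultimately show ?thesis by (simp only: mult_1 abs_one inverse_1 scaleR_one)
qed

text \<open>An arbitrary bounded interval is covered by finitely many periods $[2\pi m - \pi, 2\pi m + \pi]$.\<close>

lemma set_integrable_comp_cis:
  fixes f :: "complex \<Rightarrow> complex"
  assumes f: "integrable circle_measure f"
  shows "set_integrable lborel {a..b} (\<lambda>t. f (cis t))"
proof -
  have si: "set_integrable lborel {c-pi..c+pi} (\<lambda>t. f (cis t))" for c
  proof -
    have "integrable lborel (\<lambda>t. indicator {-pi..pi} (- c + 1 * t) *\<^sub>R f (cis (c + (- c + 1 * t))))"
      by (rule lborel_integrable_real_affine[OF integrable.intros[OF circle_integral_on_period[OF f, of c]]]) simp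
    moreover have "indicator {-pi..pi} (- c + 1 * t) *\<^sub>R f (cis (c + (- c + 1 * t)))
        = indicator {c-pi..c+pi} t *\<^sub>R f (cis t)" for t
      by (auto simp: indicator_def)
    ultimately show ?thesis by (simp only: set_integrable_def)
  qed
  have "set_integrable lborel {-(2 * real n + 1) * pi..(2 * real n + 1) * pi} (\<lambda>t. f (cis t))" for n
  proof (induction n)
    case 0 then show ?case using si[of 0] by simp
  next
    case (Suc n)
    have "set_integrable lborel ({2*pi*(-real (Suc n))-pi..2*pi*(-real (Suc n))+pi}
        \<union> {-(2 * real n + 1) * pi..(2 * real n + 1) * pi} \<union> {2*pi*real (Suc n)-pi..2*pi*real (Suc n)+pi})
        (\<lambda>t. f (cis t))"
      by (intro set_integrable_Un si Suc) auto
    then show ?case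
      by (rule set_integrable_subset) (auto simp: algebra_simps)
  qed
  note big = this
  obtain n :: nat where "max \<bar>a\<bar> \<bar>b\<bar> / pi < real n"
    using reals_Archimedean2 by blast
  then have "{a..b} \<subseteq> {-(2 * real n + 1) * pi..(2 * real n + 1) * pi}"
  proof -
    assume "max \<bar>a\<bar> \<bar>b\<bar> / pi < real n"
    then have "max \<bar>a\<bar> \<bar>b\<bar> < real n * pi" by (simp add: field_simps)
    moreover have "real n * pi \<le> (2 * real n + 1) * pi" by (intro mult_right_mono) auto
    ultimately show ?thesis
      unfolding mult_minus_left atLeastatMost_subset_iff by linarith
  qed
  then show ?thesis
    by (rule set_integrable_subset[OF big[of n], rotated]) simp
qed

section \<open>Radial limits of functions in $H^2$\<close>

text \<open>For $u = w \bar z$ with $|z| = 1$ the powers $u^n$ carry the Fourier coefficients of index $n \ge 0$ and the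
  conjugate powers those of negative index.\<close>

lemma poisson_kernel_sums:
  assumes "cmod u < 1"
  shows "(\<lambda>n. u ^ n + cnj u ^ Suc n) sums complex_of_real ((1 - (cmod u)\<^sup>2) / (cmod (1 - u))\<^sup>2)"
proof -
  have u: "1 - u \<noteq> 0" using assms by auto
  then have cu: "1 - cnj u \<noteq> 0" by (metis complex_cnj_cancel_iff complex_cnj_diff complex_cnj_one complex_cnj_zero)
  have "(\<lambda>n. u ^ n + cnj u * cnj u ^ n) sums (1 / (1 - u) + cnj u * (1 / (1 - cnj u)))"
    using assms by (intro sums_add sums_mult geometric_sums) auto
  also have "1 / (1 - u) + cnj u * (1 / (1 - cnj u)) = (1 - u * cnj u) / ((1 - u) * cnj (1 - u))"
    using u cu by (simp add: field_simps)
  also have "\<dots> = complex_of_real ((1 - (cmod u)\<^sup>2) / (cmod (1 - u))\<^sup>2)"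
    unfolding complex_norm_square[symmetric] by simp
  finally show ?thesis by simp
qed

lemma poisson_kernel_eq:
  "(1 - (cmod (complex_of_real r * cis (- s)))\<^sup>2) / (cmod (1 - complex_of_real r * cis (- s)))\<^sup>2
     = poisson_kernel r s"
proof -
  have "(cmod (1 - complex_of_real r * cis (- s)))\<^sup>2 = (1 - r * cos s)\<^sup>2 + (r * sin s)\<^sup>2"
    by (simp add: cmod_power2)
  also have "\<dots> = 1 - 2 * r * cos s + r\<^sup>2 * ((cos s)\<^sup>2 + (sin s)\<^sup>2)"
    by algebra
  also have "\<dots> = 1 - 2 * r * cos s + r\<^sup>2"
    by (simp only: sin_cos_squared_add2 mult_1_right)
  finally show ?thesis
    by (simp add: poisson_kernel_def norm_mult)
qed

text \<open>Integrating the expansion of the Poisson kernel term by term: the terms of negative index vanish by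
  assumption, and what remains is the power series of $f$ inside the disc.\<close>

lemma poisson_integral_analytic:
  fixes f :: "complex \<Rightarrow> complex"
  assumes f: "integrable circle_measure f"
    and neg: "\<And>n. (\<integral>z. f z * z ^ Suc n \<partial>circle_measure) = 0"
    and r: "0 \<le> r" "r < 1"
  shows "(\<lambda>n. 2 * pi * ((\<integral>z. f z * cnj z ^ n \<partial>circle_measure) * (complex_of_real r * cis t) ^ n))
    sums (\<integral>s. indicator {-pi..pi} s *\<^sub>R (poisson_kernel r s *\<^sub>R f (cis (t + s))) \<partial>lborel)"
proof -
  define w where "w = complex_of_real r * cis t"
  have w: "cmod w = r" using r by (simp add: w_def norm_mult)
  define g where "g n z = f z * ((w * cnj z) ^ n + cnj (w * cnj z) ^ Suc n)" for n z
  have f_meas[measurable]: "f \<in> borel_measurable circle_measure" using f by auto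
  have [measurable]: "(\<lambda>z::complex. z) \<in> borel_measurable circle_measure"
    by (rule borel_measurable_circle_measure) simp
  have int_pow: "integrable circle_measure (\<lambda>z. f z * p z)"
    if "p \<in> borel_measurable circle_measure" "\<And>z. cmod z = 1 \<Longrightarrow> cmod (p z) = 1" for p
    by (rule Bochner_Integration.integrable_bound[OF f])
      (use that f_meas in \<open>auto simp: norm_mult space_circle_measure intro!: AE_I2\<close>)
  have ip1: "integrable circle_measure (\<lambda>z. f z * cnj z ^ n)" for n
    by (rule int_pow) (auto simp: norm_power)
  have ip2: "integrable circle_measure (\<lambda>z. f z * z ^ n)" for n
    by (rule int_pow) (auto simp: norm_power)
  have g_eq: "g n z = w ^ n * (f z * cnj z ^ n) + cnj w ^ Suc n * (f z * z ^ Suc n)" for n z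
    unfolding g_def complex_cnj_mult complex_cnj_cnj power_mult_distrib by (simp only: algebra_simps)
  have g_int: "integrable circle_measure (g n)" for n
    unfolding g_eq[abs_def] by (intro Bochner_Integration.integrable_add integrable_mult_right ip1 ip2)
  have g_integral: "(\<integral>z. g n z \<partial>circle_measure) = (\<integral>z. f z * cnj z ^ n \<partial>circle_measure) * w ^ n" for n
    unfolding g_eq
    by (simp only: Bochner_Integration.integral_add[OF integrable_mult_right[OF ip1] integrable_mult_right[OF ip2]]
        integral_mult_right_zero neg mult_zero_right mult_zero_left add_0_right mult.commute)
  have g_bound: "cmod (g n z) \<le> cmod (f z) * (2 * r ^ n)" if "cmod z = 1" for n z
  proof -
    have "cmod ((w * cnj z) ^ n + cnj (w * cnj z) ^ Suc n) \<le> r ^ n + r ^ Suc n"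
      using w that by (intro norm_triangle_mono) (simp_all add: norm_power norm_mult)
    also have "r ^ Suc n \<le> r ^ n"
      using r by (intro power_decreasing) auto
    finally show ?thesis
      unfolding g_def norm_mult by (intro mult_left_mono) auto
  qed
  have sum_r: "summable (\<lambda>n. c * (2 * r ^ n))" for c :: real
    using r by (intro summable_mult summable_geometric) auto
  have AE_sum: "AE z in circle_measure. summable (\<lambda>n. cmod (g n z))"
    using AE_circle_norm
  proof eventually_elim
    case (elim z)
    show ?case
      by (rule summable_comparison_test'[OF sum_r, of 0]) (use g_bound[OF elim] in auto)
  qed
  have sum_int: "summable (\<lambda>n. \<integral>z. cmod (g n z) \<partial>circle_measure)"
  proof (rule summable_comparison_test'[OF sum_r[of "\<integral>z. cmod (f z) \<partial>circle_measure"], of 0])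
    fix n :: nat
    have "(\<integral>z. cmod (g n z) \<partial>circle_measure) \<le> (\<integral>z. cmod (f z) * (2 * r ^ n) \<partial>circle_measure)"
      using g_bound by (intro integral_mono integrable_norm g_int f integrable_mult_left)
        (auto simp: space_circle_measure)
    then show "norm (\<integral>z. cmod (g n z) \<partial>circle_measure) \<le> (\<integral>z. cmod (f z) \<partial>circle_measure) * (2 * r ^ n)"
      by (simp only: integral_mult_left_zero real_norm_def abs_of_nonneg[OF Bochner_Integration.integral_nonneg] norm_ge_zero)
  qed
  note series = sums_integral[OF g_int AE_sum sum_int] integrable_suminf[OF g_int AE_sum sum_int]
  have sum_g: "(\<Sum>n. g n (cis (t + s))) = poisson_kernel r s *\<^sub>R f (cis (t + s))" for s
  proof -
    have u: "w * cnj (cis (t + s)) = complex_of_real r * cis (- s)"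
      by (simp add: w_def cis_cnj cis_mult)
    have "cmod (complex_of_real r * cis (- s)) < 1"
      using r by (simp add: norm_mult)
    from sums_mult[OF poisson_kernel_sums[OF this], of "f (cis (t + s))"]
    have "(\<lambda>n. g n (cis (t + s))) sums (f (cis (t + s)) * complex_of_real (poisson_kernel r s))"
      unfolding g_def u poisson_kernel_eq .
    then show ?thesis by (simp add: sums_unique[symmetric] scaleR_conv_of_real mult.commute)
  qed
  have "has_bochner_integral lborel (\<lambda>s. indicator {-pi..pi} s *\<^sub>R (poisson_kernel r s *\<^sub>R f (cis (t + s))))
      (2 * pi * (\<integral>z. (\<Sum>n. g n z) \<partial>circle_measure))"
    using circle_integral_on_period[OF series(2), of t] unfolding sum_g .
  then have "(\<integral>s. indicator {-pi..pi} s *\<^sub>R (poisson_kernel r s *\<^sub>R f (cis (t + s))) \<partial>lborel)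
      = 2 * pi * (\<integral>z. (\<Sum>n. g n z) \<partial>circle_measure)"
    by (rule has_bochner_integral_integral_eq)
  then show ?thesis
    using sums_mult[OF series(1), of "2 * pi"] by (simp only: g_integral w_def)
qed

text \<open>The Poisson integral of the constant function $1$.\<close>

lemma poisson_kernel_mass:
  assumes "0 < r" "r < 1"
  shows "(\<integral>s. indicator {-pi..pi} s *\<^sub>R complex_of_real (poisson_kernel r s) \<partial>lborel) = 2 * pi"
proof -
  have coeff: "(\<integral>z. 1 * cnj z ^ n \<partial>circle_measure) = (if n = 0 then 1 else 0)" for n
  proof -
    have "(\<integral>z. 1 * cnj z ^ n \<partial>circle_measure) = cnj (\<integral>z. z powi int n \<partial>circle_measure)"
      by (simp flip: Bochner_Integration.integral_cnj)
    then show ?thesis unfolding integral_powi by simp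
  qed
  have neg: "(\<integral>z. 1 * z ^ Suc n \<partial>circle_measure) = 0" for n
    using integral_powi[of "int (Suc n)"] by (simp del: of_nat_Suc power_Suc)
  have "(\<lambda>n. 2 * pi * ((\<integral>z. 1 * cnj z ^ n \<partial>circle_measure) * (complex_of_real r * cis 0) ^ n))
      sums (\<integral>s. indicator {-pi..pi} s *\<^sub>R (poisson_kernel r s *\<^sub>R 1) \<partial>lborel)"
    by (rule poisson_integral_analytic[OF _ neg]) (use assms in auto)
  moreover have "(\<lambda>n. 2 * pi * ((\<integral>z. 1 * cnj z ^ n \<partial>circle_measure) * (complex_of_real r * cis 0) ^ n))
      = (\<lambda>n. if n = 0 then complex_of_real (2 * pi) else 0)"
    unfolding coeff by auto
  ultimately have "(\<integral>s. indicator {-pi..pi} s *\<^sub>R (poisson_kernel r s *\<^sub>R (1::complex)) \<partial>lborel) = 2 * pi"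
    using sums_single[of 0 "\<lambda>_. complex_of_real (2 * pi)"] by (metis (no_types, lifting) sums_unique2)
  then show ?thesis by (simp only: scaleR_conv_of_real mult_1_right)
qed

text \<open>The analytic function on the disc whose Taylor coefficients are the Fourier coefficients of
  nonnegative index.\<close>

definition hardy_eval :: "circle_L2 \<Rightarrow> complex \<Rightarrow> complex" where
  "hardy_eval x w = (\<Sum>n. fourier_coeff x (int n) * w ^ n)"

lemma norm_fourier_coeff_le: "cmod (fourier_coeff x n) \<le> norm x"
  using norm_cinner_le[of x "circle_power n"] by (simp add: fourier_coeff_eq_cinner norm_circle_power)

lemma hardy_eval_sums:
  assumes "cmod w < 1"
  shows "(\<lambda>n. fourier_coeff x (int n) * w ^ n) sums hardy_eval x w"
  unfolding hardy_eval_def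
proof (rule summable_sums, rule summable_norm_cancel, rule summable_comparison_test')
  show "summable (\<lambda>n. norm x * cmod w ^ n)"
    using assms by (intro summable_mult summable_geometric) auto
  show "norm (cmod (fourier_coeff x (int n) * w ^ n)) \<le> norm x * cmod w ^ n" for n
    using norm_fourier_coeff_le[of x "int n"] by (simp add: norm_mult norm_power mult_right_mono)
qed

lemma hardy_eval_holomorphic: "hardy_eval x holomorphic_on ball 0 1"
  by (rule power_series_holomorphic[where a = "\<lambda>n. fourier_coeff x (int n)"])
    (use hardy_eval_sums in auto)

lemma hardy_eval_poisson:
  assumes x: "x \<in> hardy_L2" and r: "0 < r" "r < 1"
  shows "(\<integral>s. indicator {-pi..pi} s *\<^sub>R (poisson_kernel r s *\<^sub>R rep_circle_L2 x (cis (t + s))) \<partial>lborel)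
     = 2 * pi * hardy_eval x (complex_of_real r * cis t)"
proof -
  have neg: "(\<integral>z. rep_circle_L2 x z * z ^ Suc n \<partial>circle_measure) = 0" for n
  proof -
    have "(\<integral>z. rep_circle_L2 x z * z ^ Suc n \<partial>circle_measure) = fourier_coeff x (- int (Suc n))"
      unfolding fourier_coeff_eq
    proof (rule Bochner_Integration.integral_cong[OF refl])
      fix z assume "z \<in> space circle_measure"
      then have "z * cnj z = 1"
        by (simp add: space_circle_measure flip: complex_norm_square)
      then have "cnj (z powi - int (Suc n)) = z ^ Suc n"
        by (simp add: power_int_minus inverse_unique mult.commute flip: power_inverse del: power_Suc of_nat_Suc)
      then show "rep_circle_L2 x z * z ^ Suc n = rep_circle_L2 x z * cnj (z powi - int (Suc n))"
        by (simp only:)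
    qed
    then show ?thesis using x by (simp add: hardy_L2_def)
  qed
  have "(\<lambda>n. 2 * pi * ((\<integral>z. rep_circle_L2 x z * cnj z ^ n \<partial>circle_measure) * (complex_of_real r * cis t) ^ n))
      sums (\<integral>s. indicator {-pi..pi} s *\<^sub>R (poisson_kernel r s *\<^sub>R rep_circle_L2 x (cis (t + s))) \<partial>lborel)"
    by (rule poisson_integral_analytic[OF integrable_rep neg]) (use r in auto)
  moreover have "(\<integral>z. rep_circle_L2 x z * cnj z ^ n \<partial>circle_measure) = fourier_coeff x (int n)" for n
    by (simp add: fourier_coeff_eq)
  moreover have "(\<lambda>n. 2 * pi * (fourier_coeff x (int n) * (complex_of_real r * cis t) ^ n))
      sums (2 * pi * hardy_eval x (complex_of_real r * cis t))"
    using r by (intro sums_mult hardy_eval_sums) (simp add: norm_mult)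
  ultimately show ?thesis by (simp only: sums_unique2)
qed

lemma closed_in_sets_circle: "closed A \<Longrightarrow> A \<subseteq> sphere 0 1 \<Longrightarrow> A \<in> sets circle_measure"
  unfolding circle_measure_def sets_distr by (subst sets_restrict_space_iff) auto

text \<open>A sequence of radii with limit $1$. It makes radial limits accessible to measurability
  results about sequences.\<close>

definition radii :: "nat \<Rightarrow> real" where "radii n = 1 - 1 / real (n + 2)"

lemma radii: "0 < radii n" "radii n < 1" "filterlim radii (at_left 1) sequentially"
proof -
  show "0 < radii n" "radii n < 1" for n by (auto simp: radii_def field_simps)
  then have "\<forall>n. radii n < 1 \<and> radii n \<noteq> 1" by (metis less_irrefl)
  moreover have "radii \<longlonglongrightarrow> 1" unfolding radii_def by real_asymp
  ultimately show "filterlim radii (at_left 1) sequentially"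
    by (auto simp: filterlim_at)
qed

lemma eventually_at_left_1_iff:
  "eventually P (at_left (1::real)) \<longleftrightarrow> (\<exists>m. \<forall>p\<in>{radii m<..<1}. P p)"
proof
  assume "eventually P (at_left 1)"
  then obtain b where b: "b < 1" "\<And>y. b < y \<Longrightarrow> y < 1 \<Longrightarrow> P y"
    by (auto simp: eventually_at_left_field)
  obtain m :: nat where "1 / (1 - b) < real m" using reals_Archimedean2 by blast
  with b(1) have "b < radii m" by (simp add: radii_def field_simps)
  with b(2) show "\<exists>m. \<forall>p\<in>{radii m<..<1}. P p" by (intro exI[of _ m]) auto
next
  assume "\<exists>m. \<forall>p\<in>{radii m<..<1}. P p"
  then obtain m where "\<forall>p\<in>{radii m<..<1}. P p" by blast
  then show "eventually P (at_left 1)"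
    using radii(2)[of m] unfolding eventually_at_left_field by (intro exI[of _ "radii m"]) auto
qed

text \<open>The Cauchy criterion, written with countable quantifiers outside. The inner quantifiers may stay
  uncountable because they become intersections of closed sets.\<close>

lemma convergent_at_left_1_iff:
  fixes f :: "real \<Rightarrow> complex"
  shows "(\<exists>l. (f \<longlongrightarrow> l) (at_left 1))
    \<longleftrightarrow> (\<forall>k. \<exists>m. \<forall>p\<in>{radii m<..<1}. \<forall>q\<in>{radii m<..<1}. dist (f p) (f q) \<le> 1 / real (Suc k))"
  (is "?L \<longleftrightarrow> ?R")
proof
  assume ?L
  then obtain l where l: "(f \<longlongrightarrow> l) (at_left 1)" by blast
  show ?R
  proof
    fix k
    have "\<forall>\<^sub>F p in at_left 1. dist (f p) l < 1 / real (Suc k) / 2"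
      by (rule tendstoD[OF l]) simp
    then obtain m where m: "\<And>p. p \<in> {radii m<..<1} \<Longrightarrow> dist (f p) l < 1 / real (Suc k) / 2"
      unfolding eventually_at_left_1_iff by blast
    have "dist (f p) (f q) \<le> 1 / real (Suc k)" if "p \<in> {radii m<..<1}" "q \<in> {radii m<..<1}" for p q
      using dist_triangle2[of "f p" "f q" l] m[OF that(1)] m[OF that(2)] by linarith
    then show "\<exists>m. \<forall>p\<in>{radii m<..<1}. \<forall>q\<in>{radii m<..<1}. dist (f p) (f q) \<le> 1 / real (Suc k)"
      by blast
  qed
next
  assume R: ?R
  have near: "\<exists>m. \<forall>p\<in>{radii m<..<1}. \<forall>q\<in>{radii m<..<1}. dist (f p) (f q) < e" if e: "e > 0" for e
  proof -
    obtain k where "1 / real (Suc k) < e" using e by (rule nat_approx_posE)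
    with R show ?thesis by (meson le_less_trans)
  qed
  have "Cauchy (\<lambda>n. f (radii n))"
  proof (rule metric_CauchyI)
    fix e :: real assume "e > 0"
    then obtain m where m: "\<And>p q. p \<in> {radii m<..<1} \<Longrightarrow> q \<in> {radii m<..<1} \<Longrightarrow> dist (f p) (f q) < e"
      using near by blast
    have "radii n \<in> {radii m<..<1}" if "Suc m \<le> n" for n
      using that radii(2) by (auto simp: radii_def field_simps)
    with m show "\<exists>M. \<forall>i\<ge>M. \<forall>j\<ge>M. dist (f (radii i)) (f (radii j)) < e"
      by (intro exI[of _ "Suc m"]) blast
  qed
  then obtain l where l: "(\<lambda>n. f (radii n)) \<longlonglongrightarrow> l"
    using Cauchy_convergent_iff convergent_def by blast
  have "(f \<longlongrightarrow> l) (at_left 1)"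
  proof (rule tendstoI)
    fix e :: real assume "e > 0"
    then obtain m where m: "\<And>p q. p \<in> {radii m<..<1} \<Longrightarrow> q \<in> {radii m<..<1} \<Longrightarrow> dist (f p) (f q) < e / 2"
      using near[OF half_gt_zero[OF \<open>e > 0\<close>]] by blast
    have "dist (f p) l < e" if p: "p \<in> {radii m<..<1}" for p
    proof -
      have "\<forall>\<^sub>F n in sequentially. radii n \<in> {radii m<..<1}"
        using eventually_gt_at_top[of m]
        by eventually_elim (use radii(2) in \<open>auto simp: radii_def field_simps\<close>)
      then have "\<forall>\<^sub>F n in sequentially. dist (f p) (f (radii n)) \<le> e / 2"
        by eventually_elim (use m[OF p] in \<open>auto intro: less_imp_le\<close>)
      moreover have "(\<lambda>n. dist (f p) (f (radii n))) \<longlonglongrightarrow> dist (f p) l"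
        by (intro tendsto_intros l)
      ultimately have "dist (f p) l \<le> e / 2"
        by (intro tendsto_upperbound) auto
      with \<open>e > 0\<close> show ?thesis by simp
    qed
    then show "\<forall>\<^sub>F p in at_left 1. dist (f p) l < e"
      unfolding eventually_at_left_1_iff by blast
  qed
  then show ?L by blast
qed

lemma radial_convergence_measurable:
  fixes F :: "complex \<Rightarrow> complex"
  assumes F: "continuous_on (ball 0 1) F"
  shows "{z \<in> sphere 0 1. \<exists>l. ((\<lambda>r. F (complex_of_real r * z)) \<longlongrightarrow> l) (at_left 1)} \<in> sets circle_measure"
proof -
  define C where "C k m = (\<Inter>p\<in>{radii m<..<1}. \<Inter>q\<in>{radii m<..<1}.
    {z \<in> sphere 0 1. dist (F (complex_of_real p * z)) (F (complex_of_real q * z)) \<le> 1 / real (Suc k)})" for k m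
  have ne: "{radii m<..<1} \<noteq> {}" for m using radii(2)[of m] by auto
  have cont: "continuous_on (sphere 0 1) (\<lambda>z. F (complex_of_real p * z))" if "p \<in> {radii m<..<1}" for p m
    using that radii(1)[of m]
    by (intro continuous_on_compose2[OF F] continuous_intros) (auto simp: norm_mult)
  have "closed (C k m)" for k m
    unfolding C_def
    by (intro closed_INT ballI continuous_on_closed_Collect_le continuous_on_dist cont continuous_on_const) auto
  moreover have C_iff: "z \<in> C k m \<longleftrightarrow> z \<in> sphere 0 1 \<and> (\<forall>p\<in>{radii m<..<1}. \<forall>q\<in>{radii m<..<1}.
      dist (F (complex_of_real p * z)) (F (complex_of_real q * z)) \<le> 1 / real (Suc k))" for z k m
    unfolding C_def using ne[of m] by blast
  then have "C k m \<subseteq> sphere 0 1" for k m by blast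
  ultimately have "C k m \<in> sets circle_measure" for k m
    by (rule closed_in_sets_circle)
  then have "(\<Inter>k. \<Union>m. C k m) \<in> sets circle_measure"
    by (intro sets.countable_INT) (auto intro!: sets.countable_UN)
  also have "(\<Inter>k. \<Union>m. C k m)
      = {z \<in> sphere 0 1. \<exists>l. ((\<lambda>r. F (complex_of_real r * z)) \<longlongrightarrow> l) (at_left 1)}"
    unfolding convergent_at_left_1_iff
    by (rule set_eqI) (simp only: INT_iff UN_iff C_iff mem_Collect_eq, blast)
  finally show ?thesis .
qed

lemma radial_sequence_measurable:
  fixes F :: "complex \<Rightarrow> complex"
  assumes F: "continuous_on (ball 0 1) F"
  shows "(\<lambda>z. F (complex_of_real (radii n) * z)) \<in> borel_measurable circle_measure"
proof -
  have "continuous_on (sphere 0 1) (\<lambda>z. F (complex_of_real (radii n) * z))"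
    using radii(1,2)[of n] by (intro continuous_on_compose2[OF F] continuous_intros) (auto simp: norm_mult)
  then have "(\<lambda>z. F (complex_of_real (radii n) * z)) \<in> borel_measurable (restrict_space borel (sphere 0 1))"
    by (rule borel_measurable_continuous_on_restrict)
  then show ?thesis by (simp add: circle_measure_def)
qed

text \<open>Where the radial limit exists, it is the limit along \<^const>\<open>radii\<close>, which depends measurably on the point.\<close>

lemma radial_limit_set_measurable:
  fixes F L :: "complex \<Rightarrow> complex"
  assumes F: "continuous_on (ball 0 1) F" and [measurable]: "L \<in> borel_measurable circle_measure"
  shows "{z \<in> sphere 0 1. ((\<lambda>r. F (complex_of_real r * z)) \<longlongrightarrow> L z) (at_left 1)} \<in> sets circle_measure"
proof -
  let ?S = "{z \<in> sphere 0 1. \<exists>l. ((\<lambda>r. F (complex_of_real r * z)) \<longlongrightarrow> l) (at_left 1)}"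
  let ?g = "\<lambda>z. lim (\<lambda>n. F (complex_of_real (radii n) * z))"
  have [measurable]: "?g \<in> borel_measurable circle_measure"
    by (intro borel_measurable_lim_metric radial_sequence_measurable F)
  have "{z \<in> space circle_measure. ?g z = L z} \<in> sets circle_measure"
    by measurable
  then have "?S \<inter> {z \<in> space circle_measure. ?g z = L z} \<in> sets circle_measure"
    by (intro sets.Int radial_convergence_measurable F)
  also have "?S \<inter> {z \<in> space circle_measure. ?g z = L z}
      = {z \<in> sphere 0 1. ((\<lambda>r. F (complex_of_real r * z)) \<longlongrightarrow> L z) (at_left 1)}"
  proof -
    have "?g z = l" if "((\<lambda>r. F (complex_of_real r * z)) \<longlongrightarrow> l) (at_left 1)" for z l
      using filterlim_compose[OF that radii(3)] by (rule limI)
    then show ?thesis by (auto simp: space_circle_measure)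
  qed
  finally show ?thesis .
qed

text \<open>Fatou's theorem for $H^2$: a function of $H^2$ is almost everywhere the radial limit of its analytic
  extension. The extension is the Poisson integral of the boundary function, and
  \<open>poisson_integral_tendsto_0\<close> applies to $h(s) = g(t + s) - g(t)$ for almost every angle $t$.\<close>

theorem hardy_eval_radial_limit:
  assumes x: "x \<in> hardy_L2"
  shows "AE z in circle_measure.
    ((\<lambda>r. hardy_eval x (complex_of_real r * z)) \<longlongrightarrow> rep_circle_L2 x z) (at_left 1)"
proof (rule AE_circle_measure_if_AE_lborel)
  show "{z \<in> sphere 0 1. ((\<lambda>r. hardy_eval x (complex_of_real r * z)) \<longlongrightarrow> rep_circle_L2 x z) (at_left 1)}
      \<in> sets circle_measure"
    by (intro radial_limit_set_measurable holomorphic_on_imp_continuous_on hardy_eval_holomorphic rep_measurable)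
  define g where "g t = rep_circle_L2 x (cis t)" for t
  have g: "set_integrable lborel {a..b} g" for a b
    unfolding g_def by (rule set_integrable_comp_cis[OF integrable_rep])
  have [measurable]: "g \<in> borel_measurable borel"
    unfolding g_def by (rule measurable_comp_cis) simp
  show "AE t in lborel. ((\<lambda>r. hardy_eval x (complex_of_real r * cis t)) \<longlongrightarrow> rep_circle_L2 x (cis t)) (at_left 1)"
    using AE_symmetric_derivative_integral[OF g]
  proof eventually_elim
    case (elim t)
    have gs: "integrable lborel (\<lambda>s. indicator {-pi..pi} s *\<^sub>R g (t + s))"
      using integrable.intros[OF circle_integral_on_period[OF integrable_rep[of x], of t]]
      by (simp only: g_def)
    have const: "integrable lborel (\<lambda>s. indicator {-pi..pi} s *\<^sub>R c)" for c :: complex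
      using borel_integrable_atLeastAtMost'[OF continuous_on_const, of "-pi" pi c]
      by (simp only: set_integrable_def)
    have h: "integrable lborel (\<lambda>s. indicator {-pi..pi} s *\<^sub>R (g (t + s) - g t))"
      unfolding scaleR_diff_right by (intro Bochner_Integration.integrable_diff gs const)
    have lim: "((\<lambda>r. \<integral>s. indicator {-pi..pi} s *\<^sub>R (poisson_kernel r s *\<^sub>R (g (t + s) - g t)) \<partial>lborel)
        \<longlongrightarrow> 0) (at_left 1)"
      by (rule poisson_integral_tendsto_0[OF _ h poisson_kernel_mass]) (use elim in auto)
    have eq: "(\<integral>s. indicator {-pi..pi} s *\<^sub>R (poisson_kernel r s *\<^sub>R (g (t + s) - g t)) \<partial>lborel)
        = 2 * pi * (hardy_eval x (complex_of_real r * cis t) - g t)" if r: "0 < r" "r < 1" for r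
    proof -
      have contk: "continuous_on A (poisson_kernel r)" for A
        using r by (intro continuous_at_imp_continuous_on ballI DERIV_isCont[OF poisson_kernel_derivative]) auto
      have [measurable]: "poisson_kernel r \<in> borel_measurable borel"
        by (rule borel_measurable_continuous_onI[OF contk])
      obtain B where B: "\<And>s. s \<in> {-pi..pi} \<Longrightarrow> norm (poisson_kernel r s) \<le> B"
        using compact_imp_bounded[OF compact_continuous_image[OF contk compact_Icc, of "-pi" pi]]
        unfolding bounded_iff by blast
      have mult: "integrable lborel (\<lambda>s. indicator {-pi..pi} s *\<^sub>R (poisson_kernel r s *\<^sub>R u s))"
        if u: "integrable lborel (\<lambda>s. indicator {-pi..pi} s *\<^sub>R u s)"
          and [measurable]: "u \<in> borel_measurable borel" for u :: "real \<Rightarrow> complex"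
      proof (rule Bochner_Integration.integrable_bound[OF integrable_mult_right[OF integrable_norm[OF u], of B]])
        show "AE s in lborel. norm (indicator {-pi..pi} s *\<^sub>R (poisson_kernel r s *\<^sub>R u s))
            \<le> norm (B * norm (indicator {-pi..pi} s *\<^sub>R u s))"
        proof (intro AE_I2)
          fix s
          show "norm (indicator {-pi..pi} s *\<^sub>R (poisson_kernel r s *\<^sub>R u s))
              \<le> norm (B * norm (indicator {-pi..pi} s *\<^sub>R u s))"
          proof (cases "s \<in> {-pi..pi}")
            case True
            have "norm (poisson_kernel r s) * norm (u s) \<le> \<bar>B\<bar> * norm (u s)"
              using B[OF True] by (intro mult_right_mono) auto
            with True show ?thesis by (simp add: norm_mult abs_mult)
          qed simp
        qed
      qed measurable
      have "(\<integral>s. indicator {-pi..pi} s *\<^sub>R (poisson_kernel r s *\<^sub>R (g (t + s) - g t)) \<partial>lborel)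
          = (\<integral>s. indicator {-pi..pi} s *\<^sub>R (poisson_kernel r s *\<^sub>R g (t + s)) \<partial>lborel)
            - (\<integral>s. indicator {-pi..pi} s *\<^sub>R (poisson_kernel r s *\<^sub>R g t) \<partial>lborel)"
        unfolding scaleR_diff_right
        by (intro Bochner_Integration.integral_diff mult gs const) measurable
      also have "(\<integral>s. indicator {-pi..pi} s *\<^sub>R (poisson_kernel r s *\<^sub>R g (t + s)) \<partial>lborel)
          = 2 * pi * hardy_eval x (complex_of_real r * cis t)"
        unfolding g_def by (rule hardy_eval_poisson[OF x r])
      also have "(\<integral>s. indicator {-pi..pi} s *\<^sub>R (poisson_kernel r s *\<^sub>R g t) \<partial>lborel)
          = (\<integral>s. (indicator {-pi..pi} s *\<^sub>R complex_of_real (poisson_kernel r s)) * g t \<partial>lborel)"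
        by (simp only: scaleR_conv_of_real mult.assoc)
      also have "\<dots> = 2 * pi * g t"
        unfolding integral_mult_left_zero poisson_kernel_mass[OF r] ..
      finally show ?thesis by (simp only: right_diff_distrib)
    qed
    from eventually_radius have "\<forall>\<^sub>F r in at_left 1.
        (\<integral>s. indicator {-pi..pi} s *\<^sub>R (poisson_kernel r s *\<^sub>R (g (t + s) - g t)) \<partial>lborel)
        = 2 * pi * (hardy_eval x (complex_of_real r * cis t) - g t)"
      by eventually_elim (use eq in blast)
    with lim have "((\<lambda>r. 2 * pi * (hardy_eval x (complex_of_real r * cis t) - g t)) \<longlongrightarrow> 0) (at_left 1)"
      by (rule Lim_transform_eventually)
    then have "((\<lambda>r. (2 * pi * (hardy_eval x (complex_of_real r * cis t) - g t)) / (2 * pi)) \<longlongrightarrow> 0 / complex_of_real (2 * pi)) (at_left 1)"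
      by (intro tendsto_divide tendsto_const) auto
    then have "((\<lambda>r. hardy_eval x (complex_of_real r * cis t) - g t) \<longlongrightarrow> 0) (at_left 1)"
      by simp
    then show ?case unfolding g_def by (rule LIM_zero_cancel)
  qed
qed

section \<open>Fourier series in $H^2$\<close>

text \<open>Radial limits recover the boundary function, so the analytic extension determines it. Together with
  \<open>hardy_L2_eqI_coeff\<close> this is the completeness of the powers $z^n$, $n \ge 0$, in $H^2$.\<close>

lemma hardy_L2_eqI:
  assumes x: "x \<in> hardy_L2" "y \<in> hardy_L2"
    and eq: "\<And>w. w \<in> ball 0 1 \<Longrightarrow> hardy_eval x w = hardy_eval y w"
  shows "x = y"
proof (rule circle_L2_eqI)
  show "AE z in circle_measure. rep_circle_L2 x z = rep_circle_L2 y z"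
    using hardy_eval_radial_limit[OF x(1)] hardy_eval_radial_limit[OF x(2)] AE_circle_norm
  proof eventually_elim
    case (elim z)
    have "\<forall>\<^sub>F r in at_left 1. hardy_eval x (complex_of_real r * z) = hardy_eval y (complex_of_real r * z)"
      using eventually_radius
      by eventually_elim (use elim(3) in \<open>auto intro!: eq simp: norm_mult\<close>)
    then have "((\<lambda>r. hardy_eval y (complex_of_real r * z)) \<longlongrightarrow> rep_circle_L2 x z) (at_left 1)"
      by (rule Lim_transform_eventually[OF elim(1)])
    then show ?case
      by (rule tendsto_unique[OF trivial_limit_at_left_real _ elim(2)])
  qed
qed

lemma hardy_L2_eqI_coeff:
  assumes "x \<in> hardy_L2" "y \<in> hardy_L2" "\<And>n. fourier_coeff x (int n) = fourier_coeff y (int n)"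
  shows "x = y"
  by (rule hardy_L2_eqI[OF assms(1,2)]) (simp add: hardy_eval_def assms(3))

lemma bounded_linear_fourier_coeff: "bounded_linear (\<lambda>x. fourier_coeff x n)"
  unfolding fourier_coeff_eq_cinner by (rule bounded_linear_cinner_left)

lemma fourier_coeff_circle_power: "fourier_coeff (circle_power m) n = (if m = n then 1 else 0)"
  by (simp add: fourier_coeff_eq_cinner cinner_circle_power)

lemma fourier_coeff_scaleC: "fourier_coeff (c *\<^sub>C x) n = c * fourier_coeff x n"
  by (simp add: fourier_coeff_eq_cinner cinner_scaleC_left)

lemma fourier_coeff_sums:
  assumes "(\<lambda>n. c n *\<^sub>C circle_power (int n)) sums x"
  shows "fourier_coeff x k = (if k < 0 then 0 else c (nat k))"
proof -
  have "(\<lambda>n. fourier_coeff (c n *\<^sub>C circle_power (int n)) k) sums fourier_coeff x k"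
    by (rule bounded_linear.sums[OF bounded_linear_fourier_coeff assms])
  moreover have "fourier_coeff (c n *\<^sub>C circle_power (int n)) k
      = (if n = nat k then if k < 0 then 0 else c n else 0)" for n
    by (auto simp: fourier_coeff_scaleC fourier_coeff_circle_power)
  ultimately have "(\<lambda>n. if n = nat k then if k < 0 then 0 else c n else 0) sums fourier_coeff x k"
    by simp
  then show ?thesis
    using sums_single[of "nat k" "\<lambda>n. if k < 0 then 0 else c n"] by (simp add: sums_unique2)
qed

lemma hardy_L2_sums: "(\<lambda>n. c n *\<^sub>C circle_power (int n)) sums x \<Longrightarrow> x \<in> hardy_L2"
  by (simp add: hardy_L2_def fourier_coeff_sums)

lemma norm_sum_circle_power:
  assumes "finite A"
  shows "(norm (\<Sum>n\<in>A. c n *\<^sub>C circle_power (int n)))\<^sup>2 = (\<Sum>n\<in>A. (cmod (c n))\<^sup>2)"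
  using assms
proof (induction A)
  case (insert m A)
  interpret bounded_linear "\<lambda>x. cinner x (circle_power (int m))" by (rule bounded_linear_cinner_left)
  have "cinner (\<Sum>n\<in>A. c n *\<^sub>C circle_power (int n)) (c m *\<^sub>C circle_power (int m)) = 0"
    using insert(2)
    by (auto simp: cinner_scaleC_right sum cinner_scaleC_left cinner_circle_power intro!: sum.neutral)
  from pythagoras_cinner[OF this] insert show ?case
    by (simp add: add.commute norm_scaleC norm_circle_power)
qed simp

lemma summable_circle_power:
  assumes "summable (\<lambda>n. (cmod (c n))\<^sup>2)"
  shows "summable (\<lambda>n. c n *\<^sub>C circle_power (int n))"
  unfolding summable_Cauchy
proof (intro allI impI)
  fix e :: real assume "e > 0"
  then obtain N where N: "\<And>m n. m \<ge> N \<Longrightarrow> norm (\<Sum>k = m..<n. (cmod (c k))\<^sup>2) < e\<^sup>2"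
    using assms unfolding summable_Cauchy by (meson zero_less_power)
  have "norm (\<Sum>k = m..<n. c k *\<^sub>C circle_power (int k)) < e" if "m \<ge> N" for m n
  proof (rule power2_less_imp_less)
    show "(norm (\<Sum>k = m..<n. c k *\<^sub>C circle_power (int k)))\<^sup>2 < e\<^sup>2"
      using N[OF that, of n] by (simp add: norm_sum_circle_power sum_nonneg)
  qed (use \<open>e > 0\<close> in simp)
  then show "\<exists>N. \<forall>m\<ge>N. \<forall>n. norm (\<Sum>k = m..<n. c k *\<^sub>C circle_power (int k)) < e"
    by blast
qed

lemma bessel_inequality: "(\<Sum>n<N. (cmod (fourier_coeff x (int n)))\<^sup>2) \<le> (norm x)\<^sup>2"
proof -
  define y where "y = (\<Sum>n<N. fourier_coeff x (int n) *\<^sub>C circle_power (int n))"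
  have y: "fourier_coeff y (int m) = fourier_coeff x (int m)" if "m < N" for m
  proof -
    interpret bounded_linear "\<lambda>x. fourier_coeff x (int m)" by (rule bounded_linear_fourier_coeff)
    show ?thesis using that
      by (simp add: y_def sum fourier_coeff_scaleC fourier_coeff_circle_power if_distrib[where f = "\<lambda>u. _ * u"]
          cong: if_cong)
  qed
  have "cinner y (x - y) = 0"
  proof -
    interpret bounded_linear "\<lambda>u. cinner u (x - y)" by (rule bounded_linear_cinner_left)
    have "cinner (circle_power (int n)) (x - y) = 0" if "n < N" for n
      using y[OF that] cinner_commute[of "circle_power (int n)" "x - y"]
      by (simp add: cinner_diff_left fourier_coeff_eq_cinner)
    then show ?thesis
      by (subst y_def) (simp add: sum cinner_scaleC_left)
  qed
  from pythagoras_cinner[OF this] have "(norm y)\<^sup>2 \<le> (norm x)\<^sup>2" by simp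
  then show ?thesis by (simp add: y_def norm_sum_circle_power)
qed

text \<open>The Riesz projection of $L^2$ onto $H^2$, which cuts off the Fourier coefficients of negative index.\<close>

definition hardy_part :: "circle_L2 \<Rightarrow> circle_L2" where
  "hardy_part x = (\<Sum>n. fourier_coeff x (int n) *\<^sub>C circle_power (int n))"

lemma hardy_part_sums:
  "(\<lambda>n. fourier_coeff x (int n) *\<^sub>C circle_power (int n)) sums hardy_part x"
  unfolding hardy_part_def
  by (intro summable_sums summable_circle_power bounded_imp_summable[of _ "(norm x)\<^sup>2"])
    (auto intro: bessel_inequality simp: lessThan_Suc_atMost[symmetric] simp del: sum.lessThan_Suc)

lemma hardy_part_in_hardy_L2: "hardy_part x \<in> hardy_L2"
  by (rule hardy_L2_sums[OF hardy_part_sums])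

lemma fourier_coeff_hardy_part: "fourier_coeff (hardy_part x) (int n) = fourier_coeff x (int n)"
  using fourier_coeff_sums[OF hardy_part_sums] by simp

lemma hardy_part_id: "x \<in> hardy_L2 \<Longrightarrow> hardy_part x = x"
  by (rule hardy_L2_eqI_coeff) (simp_all add: hardy_part_in_hardy_L2 fourier_coeff_hardy_part)

lemma hardy_L2_fourier_sums:
  "x \<in> hardy_L2 \<Longrightarrow> (\<lambda>n. fourier_coeff x (int n) *\<^sub>C circle_power (int n)) sums x"
  using hardy_part_sums[of x] by (simp add: hardy_part_id)

text \<open>The difference has no Fourier coefficients of nonnegative index, and elements of $H^2$ are norm
  limits of sums of nonnegative powers.\<close>

lemma hardy_part_orthogonal:
  assumes "y \<in> hardy_L2"
  shows "cinner (x - hardy_part x) y = 0"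
proof -
  let ?z = "x - hardy_part x"
  have "(\<lambda>n. cinner (fourier_coeff y (int n) *\<^sub>C circle_power (int n)) ?z) sums cinner y ?z"
    by (rule bounded_linear.sums[OF bounded_linear_cinner_left hardy_L2_fourier_sums[OF assms]])
  moreover have "cinner (circle_power (int n)) ?z = 0" for n
    using cinner_commute[of "circle_power (int n)" ?z] fourier_coeff_hardy_part[of x n]
    by (simp add: fourier_coeff_eq_cinner cinner_diff_left)
  ultimately have "(\<lambda>n. 0) sums cinner y ?z"
    by (simp add: cinner_scaleC_left)
  then have "cinner y ?z = 0" by (rule sums_unique2[OF _ sums_zero])
  then show ?thesis using cinner_commute[of ?z y] by simp
qed

section \<open>Boundary values of bounded analytic functions\<close>

lemma Hinf_bounded:
  assumes "\<phi> \<in> Hinf"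
  obtains B where "0 \<le> B" "\<And>w. w \<in> ball 0 1 \<Longrightarrow> cmod (\<phi> w) \<le> B"
proof -
  obtain B where "\<forall>w\<in>ball 0 1. cmod (\<phi> w) \<le> B"
    using assms by (auto simp: Hinf_def bounded_iff)
  then show ?thesis by (intro that[of "\<bar>B\<bar>"]) force+
qed

text \<open>The Taylor coefficients $a_n$ of $\varphi$ are square summable: the dilation $z \mapsto \varphi(rz)$ has
  coefficients $a_n r^n$ and is bounded by $B$ on the circle, so Bessel's inequality gives
  $\sum_{n<N} |a_n|^2 r^{2n} \le B^2$, and $r$ may tend to $1$.\<close>

lemma Hinf_boundary_function:
  assumes "\<phi> \<in> Hinf"
  obtains x where "x \<in> hardy_L2" "\<forall>w\<in>ball 0 1. hardy_eval x w = \<phi> w"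
proof -
  have hol: "\<phi> holomorphic_on ball 0 1" using assms by (simp add: Hinf_def)
  obtain B where B: "0 \<le> B" "\<And>w. w \<in> ball 0 1 \<Longrightarrow> cmod (\<phi> w) \<le> B"
    using Hinf_bounded[OF assms] by blast
  define a where "a n = (deriv ^^ n) \<phi> 0 / fact n" for n
  have a: "(\<lambda>n. a n * w ^ n) sums \<phi> w" if "w \<in> ball 0 1" for w
    using holomorphic_power_series[OF hol that] by (simp add: a_def)
  have dil: "(\<Sum>n<N. (cmod (a n * complex_of_real r ^ n))\<^sup>2) \<le> B\<^sup>2" if r: "0 < r" "r < 1" for r N
  proof -
    \<comment> \<open>Convergence at the larger radius $(1 + r)/2$ makes the series at $r$ absolutely convergent.\<close>
    have "summable (\<lambda>n. a n * complex_of_real ((1 + r) / 2) ^ n)"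
      using r by (intro sums_summable[OF a]) (simp add: norm_divide flip: of_real_add)
    then have "summable (\<lambda>n. norm (a n * complex_of_real r ^ n))"
      by (rule powser_insidea) (use r in \<open>simp flip: of_real_add\<close>)
    then have "summable (\<lambda>n. norm ((a n * complex_of_real r ^ n) *\<^sub>C circle_power (int n)))"
      by (simp only: norm_scaleC norm_circle_power mult_1_right)
    then have "summable (\<lambda>n. (a n * complex_of_real r ^ n) *\<^sub>C circle_power (int n))"
      by (rule summable_norm_cancel)
    then obtain y where y: "(\<lambda>n. (a n * complex_of_real r ^ n) *\<^sub>C circle_power (int n)) sums y"
      by (auto simp: summable_def)
    have yc: "fourier_coeff y (int n) = a n * complex_of_real r ^ n" for n
      using fourier_coeff_sums[OF y] by simp
    have ye: "hardy_eval y w = \<phi> (complex_of_real r * w)" if "w \<in> ball 0 1" for w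
    proof -
      have "complex_of_real r * w \<in> ball 0 1"
        using that r mult_strict_mono'[of r 1 "cmod w" 1] by (simp add: norm_mult)
      from a[OF this] have "(\<lambda>n. fourier_coeff y (int n) * w ^ n) sums \<phi> (complex_of_real r * w)"
        by (simp add: yc power_mult_distrib mult.assoc)
      then show ?thesis by (simp add: hardy_eval_def sums_iff)
    qed
    have "AE z in circle_measure. cmod (rep_circle_L2 y z) \<le> B"
      using hardy_eval_radial_limit[OF hardy_L2_sums[OF y]] AE_circle_norm
    proof eventually_elim
      case (elim z)
      have "\<forall>\<^sub>F s in at_left 1. cmod (hardy_eval y (complex_of_real s * z)) \<le> B"
        using eventually_radius
      proof eventually_elim
        case (elim s)
        then have "complex_of_real s * z \<in> ball 0 1" using \<open>cmod z = 1\<close> by (simp add: norm_mult)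
        moreover have "complex_of_real r * (complex_of_real s * z) \<in> ball 0 1"
          using elim r \<open>cmod z = 1\<close> by (simp add: norm_mult mult_strict_mono' [of r 1 s 1, simplified])
        ultimately show ?case using ye B(2) by simp
      qed
      then show ?case
        by (rule tendsto_upperbound[OF tendsto_norm[OF elim(1)]]) simp
    qed
    then have "AE z in circle_measure. (cmod (rep_circle_L2 y z))\<^sup>2 \<le> B\<^sup>2"
      by eventually_elim (intro power_mono, auto)
    then have "(\<integral>z. (cmod (rep_circle_L2 y z))\<^sup>2 \<partial>circle_measure) \<le> (\<integral>z. B\<^sup>2 \<partial>circle_measure)"
      by (intro integral_mono_AE integrable_rep_sq) auto
    then have "(norm y)\<^sup>2 \<le> B\<^sup>2"
      by (simp add: norm_circle_sq measure_circle_measure)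
    then show ?thesis
      using bessel_inequality[where x = y and N = N] by (simp only: yc)
  qed
  have "(\<Sum>n<N. (cmod (a n))\<^sup>2) \<le> B\<^sup>2" for N
  proof (rule tendsto_upperbound)
    show "((\<lambda>r. \<Sum>n<N. (cmod (a n * complex_of_real r ^ n))\<^sup>2) \<longlongrightarrow> (\<Sum>n<N. (cmod (a n))\<^sup>2)) (at_left 1)"
      by (rule tendsto_eq_intros refl | simp)+
    show "\<forall>\<^sub>F r in at_left 1. (\<Sum>n<N. (cmod (a n * complex_of_real r ^ n))\<^sup>2) \<le> B\<^sup>2"
      using eventually_radius by eventually_elim (use dil in auto)
  qed simp
  then have "summable (\<lambda>n. a n *\<^sub>C circle_power (int n))"
    by (intro summable_circle_power bounded_imp_summable[of _ "B\<^sup>2"])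
      (auto simp: lessThan_Suc_atMost[symmetric] simp del: sum.lessThan_Suc)
  then obtain x where x: "(\<lambda>n. a n *\<^sub>C circle_power (int n)) sums x"
    by (auto simp: summable_def)
  show thesis
  proof (rule that[OF hardy_L2_sums[OF x]], rule ballI)
    fix w :: complex assume "w \<in> ball 0 1"
    then show "hardy_eval x w = \<phi> w"
      using a[of w] fourier_coeff_sums[OF x] by (simp add: hardy_eval_def sums_iff)
  qed
qed

lemma radial_limit_eqI:
  "((\<lambda>r. \<phi> (complex_of_real r * z)) \<longlongrightarrow> l) (at_left 1) \<Longrightarrow> radial_limit \<phi> z = l"
  unfolding radial_limit_def by (rule tendsto_Lim) auto

lemma radial_limit_boundary_function:
  assumes x: "x \<in> hardy_L2" and eq: "\<forall>w\<in>ball 0 1. hardy_eval x w = \<phi> w"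
  shows "AE z in circle_measure. rep_circle_L2 x z = radial_limit \<phi> z"
    and "AE z in circle_measure. ((\<lambda>r. \<phi> (complex_of_real r * z)) \<longlongrightarrow> radial_limit \<phi> z) (at_left 1)"
proof -
  have "AE z in circle_measure. ((\<lambda>r. \<phi> (complex_of_real r * z)) \<longlongrightarrow> rep_circle_L2 x z) (at_left 1)"
    using hardy_eval_radial_limit[OF x] AE_circle_norm
  proof eventually_elim
    case (elim z)
    have "\<forall>\<^sub>F r in at_left 1. hardy_eval x (complex_of_real r * z) = \<phi> (complex_of_real r * z)"
      using eventually_radius by eventually_elim (use elim(2) eq in \<open>auto simp: norm_mult\<close>)
    then show ?case by (rule Lim_transform_eventually[OF elim(1)])
  qed
  then have *: "AE z in circle_measure. ((\<lambda>r. \<phi> (complex_of_real r * z)) \<longlongrightarrow> rep_circle_L2 x z) (at_left 1)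
      \<and> rep_circle_L2 x z = radial_limit \<phi> z"
    by eventually_elim (simp add: radial_limit_eqI)
  then show "AE z in circle_measure. rep_circle_L2 x z = radial_limit \<phi> z"
    by eventually_elim simp
  from * show "AE z in circle_measure. ((\<lambda>r. \<phi> (complex_of_real r * z)) \<longlongrightarrow> radial_limit \<phi> z) (at_left 1)"
    by eventually_elim metis
qed

text \<open>At the points without a radial limit \<^const>\<open>radial_limit\<close> takes the unspecified but constant value
  \<open>THE l. False\<close>, which does not harm measurability.\<close>

lemma radial_limit_measurable:
  assumes "\<phi> holomorphic_on ball 0 1"
  shows "radial_limit \<phi> \<in> borel_measurable circle_measure"
proof -
  note c = holomorphic_on_imp_continuous_on[OF assms]
  let ?S = "{z \<in> sphere 0 1. \<exists>l. ((\<lambda>r. \<phi> (complex_of_real r * z)) \<longlongrightarrow> l) (at_left 1)}"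
  let ?g = "\<lambda>z. lim (\<lambda>n. \<phi> (complex_of_real (radii n) * z))"
  have S[measurable]: "?S \<in> sets circle_measure" by (rule radial_convergence_measurable[OF c])
  have [measurable]: "?g \<in> borel_measurable circle_measure"
    by (intro borel_measurable_lim_metric radial_sequence_measurable c)
  have "(\<lambda>z. if z \<in> ?S then ?g z else (THE l. False)) \<in> borel_measurable circle_measure"
    by measurable
  moreover have "radial_limit \<phi> z = (if z \<in> ?S then ?g z else (THE l. False))" if "z \<in> space circle_measure" for z
  proof (cases "z \<in> ?S")
    case True
    then obtain l where l: "((\<lambda>r. \<phi> (complex_of_real r * z)) \<longlongrightarrow> l) (at_left 1)" by blast
    have "?g z = l" using filterlim_compose[OF l radii(3)] by (rule limI)
    with True radial_limit_eqI[of \<phi>, OF l] show ?thesis by simp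
  next
    case False
    then have "\<not> ((\<lambda>r. \<phi> (complex_of_real r * z)) \<longlongrightarrow> l) (at_left 1)" for l
      using that by (auto simp: space_circle_measure)
    with False show ?thesis by (simp add: radial_limit_def Topological_Spaces.Lim_def del: mem_Collect_eq)
  qed
  ultimately show ?thesis by (subst measurable_cong) auto
qed

lemma Hinf_radial_limit_bounded:
  assumes "\<phi> \<in> Hinf"
  shows "essentially_bounded (radial_limit \<phi>)"
proof -
  obtain B where B: "0 \<le> B" "\<And>w. w \<in> ball 0 1 \<Longrightarrow> cmod (\<phi> w) \<le> B"
    using Hinf_bounded[OF assms] by blast
  obtain x where x: "x \<in> hardy_L2" "\<forall>w\<in>ball 0 1. hardy_eval x w = \<phi> w"
    using Hinf_boundary_function[OF assms] by blast
  have "AE z in circle_measure. cmod (radial_limit \<phi> z) \<le> B"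
    using radial_limit_boundary_function(2)[OF x] AE_circle_norm
  proof eventually_elim
    case (elim z)
    have "\<forall>\<^sub>F r in at_left 1. cmod (\<phi> (complex_of_real r * z)) \<le> B"
      using eventually_radius by eventually_elim (use elim(2) in \<open>auto intro!: B(2) simp: norm_mult\<close>)
    then show ?case by (rule tendsto_upperbound[OF tendsto_norm[OF elim(1)]]) simp
  qed
  moreover have "radial_limit \<phi> \<in> borel_measurable circle_measure"
    using assms by (intro radial_limit_measurable) (simp add: Hinf_def)
  ultimately show ?thesis by (auto simp: essentially_bounded_def)
qed

section \<open>Multiplication operators\<close>

lemma mult_op_add:
  assumes "essentially_bounded m"
  shows "mult_op m (x + y) = mult_op m x + mult_op m y"
proof (rule circle_L2_eqI)
  show "AE z in circle_measure. rep_circle_L2 (mult_op m (x + y)) z = rep_circle_L2 (mult_op m x + mult_op m y) z"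
    using rep_mult_op_AE[OF assms, of x] rep_mult_op_AE[OF assms, of y] rep_mult_op_AE[OF assms, of "x + y"]
      rep_add_AE[of x y] rep_add_AE[of "mult_op m x" "mult_op m y"]
    by eventually_elim (simp add: distrib_left)
qed

lemma mult_op_scaleC:
  assumes "essentially_bounded m"
  shows "mult_op m (c *\<^sub>C x) = c *\<^sub>C mult_op m x"
proof (rule circle_L2_eqI)
  show "AE z in circle_measure. rep_circle_L2 (mult_op m (c *\<^sub>C x)) z = rep_circle_L2 (c *\<^sub>C mult_op m x) z"
    using rep_mult_op_AE[OF assms, of x] rep_mult_op_AE[OF assms, of "c *\<^sub>C x"]
      rep_scaleC_AE[of c x] rep_scaleC_AE[of c "mult_op m x"]
    by eventually_elim simp
qed

lemma norm_mult_op_le: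
  assumes m: "essentially_bounded m" and B: "0 \<le> B" "AE z in circle_measure. cmod (m z) \<le> B"
  shows "norm (mult_op m x) \<le> B * norm x"
proof (rule power2_le_imp_le)
  have "(norm (mult_op m x))\<^sup>2 \<le> (\<integral>z. B\<^sup>2 * (cmod (rep_circle_L2 x z))\<^sup>2 \<partial>circle_measure)"
    unfolding norm_circle_sq
  proof (rule integral_mono_AE[OF integrable_rep_sq integrable_mult_right[OF integrable_rep_sq]])
    show "AE z in circle_measure. (cmod (rep_circle_L2 (mult_op m x) z))\<^sup>2 \<le> B\<^sup>2 * (cmod (rep_circle_L2 x z))\<^sup>2"
      using rep_mult_op_AE[OF m, of x] B(2)
      by eventually_elim (auto simp: norm_mult power_mult_distrib intro!: mult_right_mono power_mono)
  qed
  then show "(norm (mult_op m x))\<^sup>2 \<le> (B * norm x)\<^sup>2"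
    by (simp add: norm_circle_sq[of x] power_mult_distrib)
qed (use B in simp)

lemma bounded_linear_mult_op:
  assumes "essentially_bounded m"
  shows "bounded_linear (mult_op m)"
proof -
  obtain B where "AE z in circle_measure. cmod (m z) \<le> B"
    using assms by (auto simp: essentially_bounded_def)
  then have "AE z in circle_measure. cmod (m z) \<le> \<bar>B\<bar>"
    by eventually_elim simp
  then show ?thesis
    by (intro bounded_linear_intro[where K = "\<bar>B\<bar>"])
      (auto simp: mult_op_add scaleR_scaleC mult_op_scaleC mult.commute assms dest: norm_mult_op_le[OF assms abs_ge_zero])
qed

lemma essentially_bounded_cnj:
  "essentially_bounded m \<Longrightarrow> essentially_bounded (\<lambda>z. cnj (m z))"
  by (auto simp: essentially_bounded_def intro: measurable_cnj_circle)

lemma cinner_mult_op: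
  assumes m: "essentially_bounded m"
  shows "cinner (mult_op m x) y = cinner x (mult_op (\<lambda>z. cnj (m z)) y)"
  unfolding cinner_circle_eq
proof (rule integral_cong_AE)
  show "AE z in circle_measure. rep_circle_L2 (mult_op m x) z * cnj (rep_circle_L2 y z)
      = rep_circle_L2 x z * cnj (rep_circle_L2 (mult_op (\<lambda>z. cnj (m z)) y) z)"
    using rep_mult_op_AE[OF m, of x] rep_mult_op_AE[OF essentially_bounded_cnj[OF m], of y]
    by eventually_elim simp
qed measurable

text \<open>Multiplication by $\varphi$ maps $z^n$ to $z^n \varphi$, which has no Fourier coefficient of negative index;
  boundedness extends this to sums of powers.\<close>

lemma mult_op_hardy:
  assumes "\<phi> \<in> Hinf" "f \<in> hardy_L2"
  shows "mult_op (radial_limit \<phi>) f \<in> hardy_L2"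
proof -
  note m = Hinf_radial_limit_bounded[OF assms(1)]
  obtain x where x: "x \<in> hardy_L2" "\<forall>w\<in>ball 0 1. hardy_eval x w = \<phi> w"
    using Hinf_boundary_function[OF assms(1)] by blast
  have mono: "fourier_coeff (mult_op (radial_limit \<phi>) (circle_power (int n))) k = fourier_coeff x (k - int n)" for n k
    unfolding fourier_coeff_eq
  proof (rule integral_cong_AE)
    show "AE z in circle_measure. rep_circle_L2 (mult_op (radial_limit \<phi>) (circle_power (int n))) z * cnj (z powi k)
        = rep_circle_L2 x z * cnj (z powi (k - int n))"
      using rep_mult_op_AE[OF m, of "circle_power (int n)"] rep_circle_power_AE[of "int n"]
        radial_limit_boundary_function(1)[OF x] AE_circle_norm
    proof eventually_elim
      case (elim z)
      have z: "z \<noteq> 0" "z * cnj z = 1"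
        using elim(4) by (auto simp flip: complex_norm_square)
      have "cnj (z powi (k - int n)) = cnj (z powi k) * z powi int n"
        using z(1) inverse_unique[OF z(2)]
        by (simp add: power_int_diff power_int_inverse[symmetric] divide_inverse flip: power_inverse)
      then show ?case using elim by simp
    qed
  qed measurable
  have "fourier_coeff (mult_op (radial_limit \<phi>) f) k = 0" if "k < 0" for k
  proof -
    have "(\<lambda>n. fourier_coeff (mult_op (radial_limit \<phi>) (fourier_coeff f (int n) *\<^sub>C circle_power (int n))) k)
        sums fourier_coeff (mult_op (radial_limit \<phi>) f) k"
      by (rule bounded_linear.sums[OF bounded_linear_fourier_coeff
            bounded_linear.sums[OF bounded_linear_mult_op[OF m] hardy_L2_fourier_sums[OF assms(2)]]])
    moreover have "fourier_coeff (mult_op (radial_limit \<phi>) (fourier_coeff f (int n) *\<^sub>C circle_power (int n))) k = 0" for n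
      using x(1) that by (simp add: mult_op_scaleC[OF m] fourier_coeff_scaleC mono hardy_L2_def)
    ultimately show ?thesis by (simp add: sums_iff)
  qed
  then show ?thesis by (simp add: hardy_L2_def)
qed

section \<open>Analytic Toeplitz operators\<close>

abbreviation T_op :: "(complex \<Rightarrow> complex) \<Rightarrow> hardy \<Rightarrow> hardy" where
  "T_op \<phi> \<equiv> toeplitz (radial_limit \<phi>)"

abbreviation boundary :: "hardy \<Rightarrow> complex \<Rightarrow> complex" where
  "boundary f \<equiv> rep_circle_L2 (to_L2 f)"

text \<open>Equations between operators on $H^2$ are checked on boundary functions almost everywhere, where an
  analytic Toeplitz operator is plain multiplication.\<close>

lemma hardy_eqI:
  "AE z in circle_measure. boundary f z = boundary g z \<Longrightarrow> f = g"
  using circle_L2_eqI hardy.to_L2_inject by blast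

lemma orth_proj_hardy_id: "x \<in> hardy_L2 \<Longrightarrow> orth_proj hardy_L2 x = x"
  by (rule orth_proj_eqI) (auto simp: hardy_diff corth_comp_def cinner_zero_left)

lemma to_L2_T_op: "\<phi> \<in> Hinf \<Longrightarrow> to_L2 (T_op \<phi> f) = mult_op (radial_limit \<phi>) (to_L2 f)"
  unfolding toeplitz_def
  by (simp add: orth_proj_hardy_id mult_op_hardy hardy.to_L2 of_L2_inverse)

lemma boundary_T_op_AE:
  "\<phi> \<in> Hinf \<Longrightarrow> AE z in circle_measure. boundary (T_op \<phi> f) z = radial_limit \<phi> z * boundary f z"
  by (simp add: to_L2_T_op rep_mult_op_AE Hinf_radial_limit_bounded)

lemma bounded_clinear_T_op:
  assumes "\<phi> \<in> Hinf"
  shows "bounded_clinear (T_op \<phi>)"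
proof -
  note m = Hinf_radial_limit_bounded[OF assms]
  have add: "T_op \<phi> (f + g) = T_op \<phi> f + T_op \<phi> g" for f g
    by (rule hardy.to_L2_inject[THEN iffD1]) (simp add: to_L2_T_op assms plus_hardy.rep_eq mult_op_add[OF m])
  have scale: "T_op \<phi> (c *\<^sub>C f) = c *\<^sub>C T_op \<phi> f" for c f
    by (rule hardy.to_L2_inject[THEN iffD1]) (simp add: to_L2_T_op assms scaleC_hardy.rep_eq mult_op_scaleC[OF m])
  obtain K where K: "\<And>x. norm (mult_op (radial_limit \<phi>) x) \<le> norm x * K"
    using bounded_linear.bounded[OF bounded_linear_mult_op[OF m]] by blast
  have "bounded_linear (T_op \<phi>)"
    by (rule bounded_linear_intro[where K = K])
      (use K in \<open>auto simp: add scale scaleR_scaleC norm_hardy.rep_eq to_L2_T_op assms\<close>)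
  with scale show ?thesis by (simp add: bounded_clinear_def)
qed

lemma bounded_clinear_linear:
  assumes "bounded_clinear A"
  shows "A (x + y) = A x + A y" "A (x - y) = A x - A y" "A (c *\<^sub>C x) = c *\<^sub>C A x" "A 0 = 0"
proof -
  interpret A: bounded_linear A using assms by (simp add: bounded_clinear_def)
  show "A (x + y) = A x + A y" "A (x - y) = A x - A y" "A 0 = 0"
    by (rule A.add A.diff A.zero)+
  show "A (c *\<^sub>C x) = c *\<^sub>C A x" using assms by (simp add: bounded_clinear_def)
qed

lemmas T_op_linear = bounded_clinear_linear[OF bounded_clinear_T_op]

lemma T_op_commute:
  assumes "\<phi> \<in> Hinf" "\<psi> \<in> Hinf"
  shows "T_op \<phi> (T_op \<psi> f) = T_op \<psi> (T_op \<phi> f)"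
proof (rule hardy_eqI)
  show "AE z in circle_measure. boundary (T_op \<phi> (T_op \<psi> f)) z = boundary (T_op \<psi> (T_op \<phi> f)) z"
    using boundary_T_op_AE[OF assms(1), of "T_op \<psi> f"] boundary_T_op_AE[OF assms(2), of "T_op \<phi> f"]
      boundary_T_op_AE[OF assms(1), of f] boundary_T_op_AE[OF assms(2), of f]
    by eventually_elim simp
qed

lemma identity_in_Hinf: "(\<lambda>z. z) \<in> Hinf"
  by (auto simp: Hinf_def bounded_iff intro!: exI[of _ 1] less_imp_le)

text \<open>The shift is the analytic Toeplitz operator with symbol $z$, so that it inherits linearity and
  commutation from the general case.\<close>

lemma radial_limit_identity: "radial_limit (\<lambda>z. z) = (\<lambda>z. z)"
proof
  fix z :: complex
  have "((\<lambda>r. complex_of_real r * z) \<longlongrightarrow> complex_of_real 1 * z) (at_left 1)"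
    by (intro tendsto_intros)
  then show "radial_limit (\<lambda>z. z) z = z"
    by (intro radial_limit_eqI) simp
qed

lemma shift_eq_T_op: "shift = T_op (\<lambda>z. z)"
  by (simp add: radial_limit_identity)

lemma shift_T_op_commute: "\<phi> \<in> Hinf \<Longrightarrow> shift (T_op \<phi> f) = T_op \<phi> (shift f)"
  unfolding shift_eq_T_op by (rule T_op_commute[OF identity_in_Hinf])

lemmas shift_linear = T_op_linear[OF identity_in_Hinf, folded shift_eq_T_op]

lemma boundary_shift_AE: "AE z in circle_measure. boundary (shift f) z = z * boundary f z"
  using boundary_T_op_AE[OF identity_in_Hinf, of f] by (simp add: radial_limit_identity)

lemma fourier_coeff_shift:
  "fourier_coeff (to_L2 (shift f)) k = fourier_coeff (to_L2 f) (k - 1)"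
  unfolding fourier_coeff_eq
proof (rule integral_cong_AE)
  show "AE z in circle_measure. boundary (shift f) z * cnj (z powi k) = boundary f z * cnj (z powi (k - 1))"
    using boundary_shift_AE[of f] AE_circle_norm
  proof eventually_elim
    case (elim z)
    have z: "z \<noteq> 0" "z * cnj z = 1"
      using elim(2) by (auto simp flip: complex_norm_square)
    have "cnj (z powi k) = cnj (z powi (k - 1)) * cnj z"
      using z(1) by (simp add: power_int_diff)
    then show ?case using elim z(2) by (simp add: ac_simps)
  qed
qed measurable

lemma hardy_eval_shift:
  assumes "cmod w < 1"
  shows "hardy_eval (to_L2 (shift f)) w = w * hardy_eval (to_L2 f) w"
proof -
  have neg: "fourier_coeff (to_L2 f) (- 1) = 0"
    using hardy.to_L2[of f] by (simp add: hardy_L2_def)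
  have "(\<lambda>n. fourier_coeff (to_L2 (shift f)) (int (Suc n)) * w ^ Suc n) sums (w * hardy_eval (to_L2 f) w)"
    using sums_mult[OF hardy_eval_sums[OF assms, of "to_L2 f"], of w]
    by (simp add: fourier_coeff_shift ac_simps)
  then have "(\<lambda>n. fourier_coeff (to_L2 (shift f)) (int n) * w ^ n) sums (w * hardy_eval (to_L2 f) w)"
    by (subst (asm) sums_Suc_iff) (simp add: fourier_coeff_shift neg)
  with hardy_eval_sums[OF assms] show ?thesis by (rule sums_unique2)
qed

lemma tendsto_to_L2_iff: "((\<lambda>n. to_L2 (X n)) \<longlongrightarrow> to_L2 x) F \<longleftrightarrow> (X \<longlongrightarrow> x) F"
  by (simp add: tendsto_iff dist_norm norm_hardy.rep_eq minus_hardy.rep_eq)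

lemma to_L2_sum: "to_L2 (\<Sum>n\<in>A. f n) = (\<Sum>n\<in>A. to_L2 (f n))"
  by (induction A rule: infinite_finite_induct) (auto simp: zero_hardy.rep_eq plus_hardy.rep_eq)

lemma to_L2_sums_iff: "(\<lambda>n. to_L2 (X n)) sums to_L2 x \<longleftrightarrow> X sums x"
  unfolding sums_def tendsto_to_L2_iff[symmetric] to_L2_sum ..

definition hardy_power :: "nat \<Rightarrow> hardy" where
  "hardy_power n = of_L2 (circle_power (int n))"

lemma to_L2_hardy_power: "to_L2 (hardy_power n) = circle_power (int n)"
  unfolding hardy_power_def by (rule of_L2_inverse) (simp add: hardy_L2_def fourier_coeff_circle_power)

lemma hardy_power_sums:
  "(\<lambda>n. fourier_coeff (to_L2 f) (int n) *\<^sub>C hardy_power n) sums f"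
  unfolding to_L2_sums_iff[symmetric]
  by (simp add: scaleC_hardy.rep_eq to_L2_hardy_power hardy_L2_fourier_sums hardy.to_L2)

lemma boundary_hardy_power_AE: "AE z in circle_measure. boundary (hardy_power n) z = z ^ n"
  using rep_circle_power_AE[of "int n"] by (simp add: to_L2_hardy_power)

lemma shift_hardy_power: "shift (hardy_power n) = hardy_power (Suc n)"
proof (rule hardy_eqI)
  show "AE z in circle_measure. boundary (shift (hardy_power n)) z = boundary (hardy_power (Suc n)) z"
    using boundary_shift_AE[of "hardy_power n"] boundary_hardy_power_AE[of n] boundary_hardy_power_AE[of "Suc n"]
    by eventually_elim simp
qed

lemma bounded_clinear_sums:
  assumes "bounded_clinear A"
  shows "(\<lambda>n. fourier_coeff (to_L2 f) (int n) *\<^sub>C A (hardy_power n)) sums A f"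
proof -
  have "(\<lambda>n. A (fourier_coeff (to_L2 f) (int n) *\<^sub>C hardy_power n)) sums A f"
    using assms by (intro bounded_linear.sums[OF _ hardy_power_sums]) (simp add: bounded_clinear_def)
  then show ?thesis by (simp add: bounded_clinear_linear[OF assms])
qed

lemma bounded_clinear_eqI:
  assumes "bounded_clinear A" "bounded_clinear B" "\<And>n. A (hardy_power n) = B (hardy_power n)"
  shows "A f = B f"
  using bounded_clinear_sums[OF assms(1), of f] bounded_clinear_sums[OF assms(2), of f]
  by (simp add: assms(3) sums_unique2)

text \<open>The function $\varphi$ is recovered from the operator by applying it to the constant $1$.\<close>

lemma T_op_one_eval:
  assumes "\<phi> \<in> Hinf" "w \<in> ball 0 1"
  shows "hardy_eval (to_L2 (T_op \<phi> (hardy_power 0))) w = \<phi> w"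
proof -
  obtain x where x: "x \<in> hardy_L2" "\<forall>w\<in>ball 0 1. hardy_eval x w = \<phi> w"
    using Hinf_boundary_function[OF assms(1)] by blast
  have "to_L2 (T_op \<phi> (hardy_power 0)) = x"
  proof (rule circle_L2_eqI)
    show "AE z in circle_measure. boundary (T_op \<phi> (hardy_power 0)) z = rep_circle_L2 x z"
      using boundary_T_op_AE[OF assms(1), of "hardy_power 0"] boundary_hardy_power_AE[of 0]
        radial_limit_boundary_function(1)[OF x]
      by eventually_elim simp
  qed
  with x(2) assms(2) show ?thesis by simp
qed

lemma T_op_zero:
  assumes "\<phi> \<in> Hinf" "AE z in circle_measure. radial_limit \<phi> z = 0"
  shows "T_op \<phi> f = 0"
proof (rule hardy_eqI)
  show "AE z in circle_measure. boundary (T_op \<phi> f) z = boundary 0 z"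
    using boundary_T_op_AE[OF assms(1), of f] rep_zero_AE assms(2)
    by eventually_elim (simp add: zero_hardy.rep_eq)
qed

section \<open>Operators commuting with the shift\<close>

text \<open>The reproducing kernel $\sum \bar w^n z^n$ of the point $w$.\<close>

lemma szego_kernel:
  assumes w: "cmod w < 1"
  obtains k where "\<And>n. fourier_coeff (to_L2 k) (int n) = cnj w ^ n" "k \<noteq> 0"
    "\<And>f. cinner f k = hardy_eval (to_L2 f) w"
proof -
  have "summable (\<lambda>n. norm (cnj w ^ n *\<^sub>C circle_power (int n)))"
    using w by (simp add: norm_scaleC norm_circle_power norm_power summable_geometric)
  from summable_sums[OF summable_norm_cancel[OF this]]
  obtain x where x: "(\<lambda>n. cnj w ^ n *\<^sub>C circle_power (int n)) sums x" by blast
  define k where "k = of_L2 x"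
  have "to_L2 k = x" unfolding k_def by (rule of_L2_inverse) (rule hardy_L2_sums[OF x])
  then have coeff: "fourier_coeff (to_L2 k) (int n) = cnj w ^ n" for n
    using fourier_coeff_sums[OF x] by simp
  have "k \<noteq> 0"
    using coeff[of 0] by (auto simp: zero_hardy.rep_eq fourier_coeff_eq_cinner cinner_zero_left)
  have "cinner f k = hardy_eval (to_L2 f) w" for f
  proof -
    have "(\<lambda>n. cinner (fourier_coeff (to_L2 k) (int n) *\<^sub>C hardy_power n) f) sums cinner k f"
      by (rule bounded_linear.sums[OF bounded_linear_cinner_left hardy_power_sums])
    then have "(\<lambda>n. cnj (cinner (fourier_coeff (to_L2 k) (int n) *\<^sub>C hardy_power n) f)) sums cnj (cinner k f)"
      by (simp only: sums_cnj)
    moreover have "cnj (cinner (fourier_coeff (to_L2 k) (int n) *\<^sub>C hardy_power n) f)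
        = fourier_coeff (to_L2 f) (int n) * w ^ n" for n
      unfolding cinner_commute[symmetric] cinner_scaleC_right coeff
      by (simp add: cinner_hardy.rep_eq to_L2_hardy_power fourier_coeff_eq_cinner)
    ultimately have "(\<lambda>n. fourier_coeff (to_L2 f) (int n) * w ^ n) sums cinner f k"
      by (simp only: cinner_commute[symmetric])
    then show ?thesis using hardy_eval_sums[OF w] by (rule sums_unique2)
  qed
  with coeff \<open>k \<noteq> 0\<close> show thesis by (rule that)
qed

text \<open>Let $u = Y1$ and let $\varphi$ be the analytic extension of $u$. Commutation gives $Y z^n = z^n u$, so $Y$ is
  multiplication by $u$ on polynomials, and only the boundedness of $\varphi$ needs an argument. Expanding the
  reproducing kernel $k_w$ into powers gives $\langle Y k_w, k_w\rangle = \varphi(w) \|k_w\|^2$, whence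
  $|\varphi(w)| \le \|Y\|$.\<close>

theorem commutant_of_shift:
  assumes Y: "bounded_clinear Y" and comm: "\<And>f. Y (shift f) = shift (Y f)"
  obtains \<phi> where "\<phi> \<in> Hinf" "\<And>f. Y f = T_op \<phi> f"
proof -
  define u where "u = Y (hardy_power 0)"
  define \<phi> where "\<phi> = hardy_eval (to_L2 u)"
  obtain K where K: "\<And>f. norm (Y f) \<le> norm f * K"
    using Y bounded_linear.bounded unfolding bounded_clinear_def by blast
  have Y_power: "hardy_eval (to_L2 (Y (hardy_power n))) w = w ^ n * \<phi> w" if "cmod w < 1" for n w
    by (induction n)
      (simp_all add: \<phi>_def u_def comm hardy_eval_shift that flip: shift_hardy_power)
  have "cmod (\<phi> w) \<le> K" if "w \<in> ball 0 1" for w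
  proof -
    have w: "cmod w < 1" using that by simp
    obtain k where k: "\<And>n. fourier_coeff (to_L2 k) (int n) = cnj w ^ n" "k \<noteq> 0"
      "\<And>f. cinner f k = hardy_eval (to_L2 f) w"
      using szego_kernel[OF w] by blast
    have "(\<lambda>n. cinner (fourier_coeff (to_L2 k) (int n) *\<^sub>C Y (hardy_power n)) k) sums cinner (Y k) k"
      by (rule bounded_linear.sums[OF bounded_linear_cinner_left bounded_clinear_sums[OF Y]])
    then have "(\<lambda>n. cnj w ^ n * w ^ n * \<phi> w) sums cinner (Y k) k"
      unfolding cinner_scaleC_left k(1) by (simp only: k(3) Y_power[OF w] mult.assoc)
    moreover have "(\<lambda>n. cnj w ^ n * w ^ n * \<phi> w) sums (cinner k k * \<phi> w)"
      using sums_mult2[OF hardy_eval_sums[OF w, of "to_L2 k"], of "\<phi> w"] by (simp add: k)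
    ultimately have "cinner (Y k) k = cinner k k * \<phi> w"
      by (rule sums_unique2)
    then have "(norm k)\<^sup>2 * cmod (\<phi> w) = cmod (cinner (Y k) k)"
      by (simp add: cinner_self norm_mult norm_power)
    also have "\<dots> \<le> norm (Y k) * norm k" by (rule norm_cinner_le)
    also have "\<dots> \<le> (norm k * K) * norm k" by (intro mult_right_mono K) simp
    finally have "(norm k)\<^sup>2 * cmod (\<phi> w) \<le> (norm k)\<^sup>2 * K"
      by (simp add: power2_eq_square ac_simps)
    then show ?thesis using k(2) by simp
  qed
  then have "bounded (\<phi> ` ball 0 1)"
    unfolding bounded_iff by blast
  moreover have "\<phi> holomorphic_on ball 0 1"
    unfolding \<phi>_def by (rule hardy_eval_holomorphic)
  ultimately have \<phi>: "\<phi> \<in> Hinf"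
    by (simp add: Hinf_def)
  have one: "T_op \<phi> (hardy_power 0) = u"
  proof (rule hardy_eqI)
    have "AE z in circle_measure. boundary u z = radial_limit \<phi> z"
      by (rule radial_limit_boundary_function(1)[OF hardy.to_L2]) (simp add: \<phi>_def)
    then show "AE z in circle_measure. boundary (T_op \<phi> (hardy_power 0)) z = boundary u z"
      using boundary_T_op_AE[OF \<phi>, of "hardy_power 0"] boundary_hardy_power_AE[of 0]
      by eventually_elim simp
  qed
  have "Y (hardy_power n) = T_op \<phi> (hardy_power n)" for n
  proof (induction n)
    case (Suc n)
    then show ?case
      by (simp add: comm shift_T_op_commute[OF \<phi>, symmetric] flip: shift_hardy_power)
  qed (simp add: one u_def)
  then have "Y f = T_op \<phi> f" for f
    by (rule bounded_clinear_eqI[OF Y bounded_clinear_T_op[OF \<phi>]])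
  with \<phi> show thesis by (rule that)
qed

section \<open>The projections defined by an inner function\<close>

lemma range_space_eq: "\<theta> \<in> Hinf \<Longrightarrow> range_space \<theta> = range (T_op \<theta>)"
  by (auto simp: range_space_def image_iff simp flip: to_L2_T_op hardy.to_L2_inject)

lemma T_op_range_invariant:
  assumes "\<phi> \<in> Hinf" "\<theta> \<in> Hinf" "r \<in> range_space \<theta>"
  shows "T_op \<phi> r \<in> range_space \<theta>"
  using assms(3) unfolding range_space_eq[OF assms(2)]
  by (auto simp: T_op_commute[OF assms(1,2)])

lemma inner_function_Hinf: "inner_function \<theta> \<Longrightarrow> \<theta> \<in> Hinf"
  by (simp add: inner_function_def)

lemma cinner_T_op_right:
  assumes "\<theta> \<in> Hinf"
  shows "cinner f (T_op \<theta> g) = cinner (mult_op (\<lambda>z. cnj (radial_limit \<theta> z)) (to_L2 f)) (to_L2 g)"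
  using cinner_mult_op[OF essentially_bounded_cnj[OF Hinf_radial_limit_bounded[OF assms]], of "to_L2 f" "to_L2 g"]
  by (simp add: cinner_hardy.rep_eq to_L2_T_op[OF assms])

lemma cinner_T_op_inner:
  assumes "inner_function \<theta>"
  shows "cinner (T_op \<theta> f) (T_op \<theta> g) = cinner f g"
  unfolding cinner_hardy.rep_eq cinner_circle_eq
proof (rule integral_cong_AE)
  note \<theta> = inner_function_Hinf[OF assms]
  have "AE z in circle_measure. cmod (radial_limit \<theta> z) = 1"
    using assms by (simp add: inner_function_def)
  then show "AE z in circle_measure. boundary (T_op \<theta> f) z * cnj (boundary (T_op \<theta> g) z)
      = boundary f z * cnj (boundary g z)"
    using boundary_T_op_AE[OF \<theta>, of f] boundary_T_op_AE[OF \<theta>, of g]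
  proof eventually_elim
    case (elim z)
    have "radial_limit \<theta> z * cnj (radial_limit \<theta> z) = 1"
      using elim(1) by (simp flip: complex_norm_square)
    then have "radial_limit \<theta> z * cnj (radial_limit \<theta> z) * (boundary f z * cnj (boundary g z))
        = boundary f z * cnj (boundary g z)"
      by simp
    then show ?case unfolding elim complex_cnj_mult by (simp only: ac_simps)
  qed
qed measurable

lemma norm_T_op_inner: "inner_function \<theta> \<Longrightarrow> norm (T_op \<theta> f) = norm f"
  using cinner_T_op_inner[of \<theta> f f] unfolding cinner_self
  by (metis norm_ge_zero of_real_eq_iff power2_eq_imp_eq)

lemma T_op_inner_inject: "inner_function \<theta> \<Longrightarrow> T_op \<theta> f = T_op \<theta> g \<longleftrightarrow> f = g"
  using norm_T_op_inner[of \<theta> "f - g"] T_op_linear(2)[OF inner_function_Hinf, of \<theta> f g]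
  by (metis norm_eq_zero right_minus_eq)

lemma model_space_iff:
  "\<theta> \<in> Hinf \<Longrightarrow> k \<in> model_space \<theta> \<longleftrightarrow> (\<forall>g. cinner k (T_op \<theta> g) = 0)"
  by (auto simp: model_space_def corth_comp_def range_space_eq)

lemma model_space_diff:
  "k \<in> model_space \<theta> \<Longrightarrow> l \<in> model_space \<theta> \<Longrightarrow> k - l \<in> model_space \<theta>"
  by (auto simp: model_space_def corth_comp_def cinner_diff_left)

lemma range_space_diff:
  assumes "\<theta> \<in> Hinf" "r \<in> range_space \<theta>" "s \<in> range_space \<theta>"
  shows "r - s \<in> range_space \<theta>"
  using assms by (auto simp: range_space_eq T_op_linear(2)[symmetric])

lemma range_space_add:
  assumes "\<theta> \<in> Hinf" "r \<in> range_space \<theta>" "s \<in> range_space \<theta>"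
  shows "r + s \<in> range_space \<theta>"
  using assms by (auto simp: range_space_eq T_op_linear(1)[symmetric])

lemma orth_proj_range_eqI:
  assumes "\<theta> \<in> Hinf" "p \<in> range_space \<theta>" "f - p \<in> model_space \<theta>"
  shows "orth_proj (range_space \<theta>) f = p"
  by (rule orth_proj_eqI) (use assms range_space_diff in \<open>auto simp: model_space_def\<close>)

text \<open>The projection onto $\theta H^2$ is $f \mapsto \theta P_+(\bar\theta f)$ with the Riesz projection $P_+$: the difference
  $f - \theta P_+(\bar\theta f) = \theta (\bar\theta f - P_+(\bar\theta f))$ is orthogonal to $\theta H^2$ because multiplication by $\theta$ is
  isometric.\<close>

lemma orth_proj_range:
  assumes "inner_function \<theta>"
  shows "orth_proj (range_space \<theta>) f \<in> range_space \<theta>"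
    and "f - orth_proj (range_space \<theta>) f \<in> model_space \<theta>"
proof -
  note \<theta> = inner_function_Hinf[OF assms]
  let ?y = "mult_op (\<lambda>z. cnj (radial_limit \<theta> z)) (to_L2 f)"
  define g where "g = of_L2 (hardy_part ?y)"
  have g: "to_L2 g = hardy_part ?y"
    unfolding g_def by (rule of_L2_inverse[OF hardy_part_in_hardy_L2])
  have "cinner (f - T_op \<theta> g) (T_op \<theta> h) = 0" for h
  proof -
    have "cinner (T_op \<theta> g) (T_op \<theta> h) = cinner (hardy_part ?y) (to_L2 h)"
      unfolding cinner_T_op_inner[OF assms] by (simp only: cinner_hardy.rep_eq g)
    then have "cinner (f - T_op \<theta> g) (T_op \<theta> h) = cinner (?y - hardy_part ?y) (to_L2 h)"
      by (simp only: cinner_diff_left cinner_T_op_right[OF \<theta>, of f])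
    then show ?thesis
      by (simp only: hardy_part_orthogonal[OF hardy.to_L2])
  qed
  then have "f - T_op \<theta> g \<in> model_space \<theta>"
    by (simp add: model_space_iff[OF \<theta>])
  moreover have "T_op \<theta> g \<in> range_space \<theta>"
    by (simp add: range_space_eq[OF \<theta>])
  ultimately show "orth_proj (range_space \<theta>) f \<in> range_space \<theta>"
    "f - orth_proj (range_space \<theta>) f \<in> model_space \<theta>"
    using orth_proj_range_eqI[OF \<theta>] by auto
qed

lemma orth_proj_model:
  assumes "inner_function \<theta>"
  shows "orth_proj (model_space \<theta>) f = f - orth_proj (range_space \<theta>) f"
proof (rule orth_proj_eqI)
  show "f - (f - orth_proj (range_space \<theta>) f) \<in> corth_comp (model_space \<theta>)"
    using orth_proj_range(1)[OF assms, of f] cinner_commute[of "orth_proj (range_space \<theta>) f"]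
    by (auto simp: corth_comp_def model_space_def)
qed (use orth_proj_range(2)[OF assms] model_space_diff in auto)

lemma orth_proj_model_in: "inner_function \<theta> \<Longrightarrow> orth_proj (model_space \<theta>) f \<in> model_space \<theta>"
  using orth_proj_range(2) by (simp add: orth_proj_model)

lemma zero_in_model_space: "0 \<in> model_space \<theta>"
  by (simp add: model_space_def corth_comp_def cinner_zero_left)

lemma orth_proj_on_range:
  assumes "inner_function \<theta>" "r \<in> range_space \<theta>"
  shows "orth_proj (range_space \<theta>) r = r" "orth_proj (model_space \<theta>) r = 0"
  using orth_proj_range_eqI[OF inner_function_Hinf[OF assms(1)] assms(2), of r]
  by (simp_all add: orth_proj_model[OF assms(1)] zero_in_model_space)

lemma orth_proj_on_model:
  assumes "inner_function \<theta>" "k \<in> model_space \<theta>"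
  shows "orth_proj (range_space \<theta>) k = 0" "orth_proj (model_space \<theta>) k = k"
proof -
  note \<theta> = inner_function_Hinf[OF assms(1)]
  have "0 \<in> range_space \<theta>"
    unfolding range_space_eq[OF \<theta>] using T_op_linear(4)[OF \<theta>] by (metis rangeI)
  then show "orth_proj (range_space \<theta>) k = 0"
    using assms(2) by (intro orth_proj_range_eqI[OF \<theta>]) auto
  then show "orth_proj (model_space \<theta>) k = k"
    by (simp add: orth_proj_model[OF assms(1)])
qed

lemma bounded_clinear_orth_proj_range:
  assumes "inner_function \<theta>"
  shows "bounded_clinear (orth_proj (range_space \<theta>))"
proof -
  let ?P = "orth_proj (range_space \<theta>)"
  note \<theta> = inner_function_Hinf[OF assms] and P = orth_proj_range[OF assms]
  have add: "?P (f + g) = ?P f + ?P g" for f g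
  proof (rule orth_proj_range_eqI[OF \<theta>])
    show "?P f + ?P g \<in> range_space \<theta>" by (intro range_space_add \<theta> P)
    have "cinner (f - ?P f) r = 0" "cinner (g - ?P g) r = 0" if "r \<in> range_space \<theta>" for r
      using P(2) that by (auto simp: model_space_def corth_comp_def)
    then show "f + g - (?P f + ?P g) \<in> model_space \<theta>"
      by (simp add: model_space_def corth_comp_def cinner_diff_left cinner_add_left)
  qed
  have scale: "?P (c *\<^sub>C f) = c *\<^sub>C ?P f" for c f
  proof (rule orth_proj_range_eqI[OF \<theta>])
    show "c *\<^sub>C ?P f \<in> range_space \<theta>"
      using P(1)[of f] by (auto simp: range_space_eq[OF \<theta>] T_op_linear(3)[OF \<theta>, symmetric])
    have "cinner (f - ?P f) r = 0" if "r \<in> range_space \<theta>" for r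
      using P(2) that by (auto simp: model_space_def corth_comp_def)
    then show "c *\<^sub>C f - c *\<^sub>C ?P f \<in> model_space \<theta>"
      by (simp add: model_space_def corth_comp_def cinner_scaleC_left flip: scaleC_diff_right)
  qed
  have "norm (?P f) \<le> norm f" for f
  proof (rule power2_le_imp_le)
    have "cinner (f - ?P f) (?P f) = 0"
      using P by (auto simp: model_space_def corth_comp_def)
    from pythagoras_cinner[OF this] show "(norm (?P f))\<^sup>2 \<le> (norm f)\<^sup>2" by simp
  qed simp
  then have "bounded_linear ?P"
    by (intro bounded_linear_intro[where K = 1]) (auto simp: add scale scaleR_scaleC)
  with scale show ?thesis by (simp add: bounded_clinear_def)
qed

lemma bounded_clinear_diff:
  assumes "bounded_clinear A" "bounded_clinear B"
  shows "bounded_clinear (\<lambda>f. A f - B f)"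
  using assms by (auto simp: bounded_clinear_def scaleC_diff_right intro: bounded_linear_sub)

lemma bounded_clinear_compose:
  assumes "bounded_clinear A" "bounded_clinear B"
  shows "bounded_clinear (\<lambda>f. A (B f))"
  using assms by (auto simp: bounded_clinear_def intro: bounded_linear_compose)

lemma bounded_clinear_id: "bounded_clinear (\<lambda>f. f)"
  by (simp add: bounded_clinear_def bounded_linear_ident)

section \<open>A model space function bounded away from zero\<close>

text \<open>The inner product with $1$ is the value of the analytic extension at $0$, and $\theta z^n$ vanishes at $0$ for
  $n \ge 1$.\<close>

lemma T_op_coeff_zero:
  assumes "\<theta> \<in> Hinf"
  shows "cinner (T_op \<theta> h) (hardy_power 0)
    = cinner (T_op \<theta> (hardy_power 0)) (hardy_power 0) * cinner h (hardy_power 0)"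
proof -
  have eval0: "cinner f (hardy_power 0) = hardy_eval (to_L2 f) 0" for f
    using powser_zero[of "\<lambda>n. fourier_coeff (to_L2 f) (int n)"]
    by (simp add: hardy_eval_def cinner_hardy.rep_eq to_L2_hardy_power fourier_coeff_eq_cinner)
  have shift0: "cinner (T_op \<theta> (hardy_power (Suc n))) (hardy_power 0) = 0" for n
    by (simp add: eval0 hardy_eval_shift flip: shift_hardy_power shift_T_op_commute[OF assms])
  have "(\<lambda>n. cinner (fourier_coeff (to_L2 h) (int n) *\<^sub>C T_op \<theta> (hardy_power n)) (hardy_power 0))
      sums cinner (T_op \<theta> h) (hardy_power 0)"
    by (rule bounded_linear.sums[OF bounded_linear_cinner_left bounded_clinear_sums[OF bounded_clinear_T_op[OF assms]]])
  moreover have "cinner (fourier_coeff (to_L2 h) (int n) *\<^sub>C T_op \<theta> (hardy_power n)) (hardy_power 0)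
      = (if n = 0 then cinner (T_op \<theta> (hardy_power 0)) (hardy_power 0) * cinner h (hardy_power 0) else 0)" for n
    by (cases n) (simp_all add: cinner_scaleC_left shift0,
        simp add: cinner_hardy.rep_eq to_L2_hardy_power fourier_coeff_eq_cinner)
  ultimately show ?thesis
    using sums_single[of 0 "\<lambda>_. cinner (T_op \<theta> (hardy_power 0)) (hardy_power 0) * cinner h (hardy_power 0)"]
    by (simp add: sums_unique2)
qed

lemma cinner_hardy_power: "cinner (hardy_power m) (hardy_power n) = (if m = n then 1 else 0)"
  by (simp add: cinner_hardy.rep_eq to_L2_hardy_power cinner_circle_power)

text \<open>Here $\langle \theta, 1\rangle = \theta(0)$ and $\|\theta - \theta(0)\|^2 = 1 - |\theta(0)|^2$. If $|\theta(0)| \ge 1$, this forces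
  $\theta = \theta(0)$ on the circle and hence in the disc.\<close>

lemma inner_function_mean_less_1:
  assumes "inner_function \<theta>" and nc: "\<not> \<theta> constant_on ball 0 1"
  shows "cmod (cinner (T_op \<theta> (hardy_power 0)) (hardy_power 0)) < 1"
proof (rule ccontr)
  note \<theta> = inner_function_Hinf[OF assms(1)]
  let ?e = "hardy_power 0" and ?t = "T_op \<theta> (hardy_power 0)"
  define a where "a = cinner ?t ?e"
  assume "\<not> cmod (cinner ?t ?e) < 1"
  then have a: "1 \<le> (cmod a)\<^sup>2" by (simp add: a_def)
  have "norm ?e = 1" by (simp add: norm_hardy.rep_eq to_L2_hardy_power norm_circle_power)
  have "cinner (?t - a *\<^sub>C ?e) (a *\<^sub>C ?e) = 0"
    by (simp add: cinner_diff_left cinner_scaleC_left cinner_scaleC_right cinner_hardy_power a_def)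
  from pythagoras_cinner[OF this] have "(norm (?t - a *\<^sub>C ?e))\<^sup>2 + (cmod a)\<^sup>2 = 1"
    by (simp add: norm_T_op_inner[OF assms(1)] norm_scaleC \<open>norm ?e = 1\<close>)
  with a have "(norm (?t - a *\<^sub>C ?e))\<^sup>2 \<le> 0" by linarith
  then have t: "?t = a *\<^sub>C ?e" by simp
  have "\<theta> w = a" if "w \<in> ball 0 1" for w
  proof -
    have "(\<lambda>n. fourier_coeff (to_L2 ?t) (int n) * w ^ n) = (\<lambda>n. if n = 0 then a else 0)"
      unfolding t by (auto simp: scaleC_hardy.rep_eq to_L2_hardy_power fourier_coeff_scaleC fourier_coeff_circle_power)
    then have "hardy_eval (to_L2 ?t) w = a"
      unfolding hardy_eval_def using sums_single[of 0 "\<lambda>_. a"] by (simp add: sums_iff)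
    then show ?thesis using T_op_one_eval[OF \<theta> that] by simp
  qed
  with nc show False by (auto simp: constant_on_def)
qed

text \<open>The witness is $1 - \overline{\theta(0)}\,\theta$, which is orthogonal to $\theta H^2$ because
  $\langle 1, \theta h\rangle = \overline{\theta(0) h(0)}$ and whose modulus is at least $1 - |\theta(0)| > 0$.
  It supplies the vector $h_0$, and since it vanishes almost nowhere it also determines the second symbol.\<close>

lemma model_space_nonvanishing:
  assumes "inner_function \<theta>" and nc: "\<not> \<theta> constant_on ball 0 1"
  obtains k where "k \<in> model_space \<theta>" "AE z in circle_measure. boundary k z \<noteq> 0" "k \<noteq> 0"
proof -
  note \<theta> = inner_function_Hinf[OF assms(1)]
  let ?e = "hardy_power 0" and ?t = "T_op \<theta> (hardy_power 0)"
  define a where "a = cinner ?t ?e"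
  have a: "cmod a < 1" unfolding a_def by (rule inner_function_mean_less_1[OF assms])
  define k where "k = ?e - cnj a *\<^sub>C ?t"
  have "cinner k (T_op \<theta> h) = 0" for h
  proof -
    have "cinner ?e (T_op \<theta> h) = cnj (a * cinner h ?e)"
      unfolding a_def by (subst T_op_coeff_zero[OF \<theta>, symmetric]) (rule cinner_commute)
    also have "\<dots> = cnj a * cinner ?e h"
      using cinner_commute[of ?e h] by simp
    finally show ?thesis
      by (simp add: k_def cinner_diff_left cinner_scaleC_left cinner_T_op_inner[OF assms(1)])
  qed
  then have model: "k \<in> model_space \<theta>" by (simp add: model_space_iff[OF \<theta>])
  have "AE z in circle_measure. cmod (radial_limit \<theta> z) = 1"
    using assms by (simp add: inner_function_def)
  then have ne: "AE z in circle_measure. boundary k z \<noteq> 0"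
    using boundary_T_op_AE[OF \<theta>, of ?e] boundary_hardy_power_AE[of 0]
      rep_scaleC_AE[of "cnj a" "to_L2 ?t"] rep_diff_AE[of "to_L2 ?e" "cnj a *\<^sub>C to_L2 ?t"]
  proof eventually_elim
    case (elim z)
    have "boundary k z = 1 - cnj a * radial_limit \<theta> z"
      using elim by (simp add: k_def minus_hardy.rep_eq scaleC_hardy.rep_eq)
    moreover have "cmod (cnj a * radial_limit \<theta> z) < 1"
      using elim(1) a by (simp add: norm_mult)
    ultimately show ?case by auto
  qed
  moreover have "k \<noteq> 0"
  proof
    assume "k = 0"
    with ne have "AE z in circle_measure. rep_circle_L2 0 z \<noteq> 0"
      by (simp add: zero_hardy.rep_eq)
    with rep_zero_AE have "AE z in circle_measure. False"
      by eventually_elim simp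
    then show False
      using emeasure_circle_measure by (simp add: trivial_limit_def[symmetric] ae_filter_eq_bot_iff)
  qed
  ultimately show thesis using model that by blast
qed

section \<open>Paired operators\<close>

lemma paired_op_on_range:
  assumes "inner_function \<theta>" "\<psi> \<in> Hinf" "r \<in> range_space \<theta>"
  shows "paired_op \<theta> \<phi> \<psi> r = T_op \<phi> r"
  by (simp add: paired_op_def orth_proj_on_range[OF assms(1,3)] T_op_linear(4)[OF assms(2)])

lemma paired_op_on_model:
  assumes "inner_function \<theta>" "\<phi> \<in> Hinf" "k \<in> model_space \<theta>"
  shows "paired_op \<theta> \<phi> \<psi> k = T_op \<psi> k"
  by (simp add: paired_op_def orth_proj_on_model[OF assms(1,3)] T_op_linear(4)[OF assms(2)])

lemma Hinf_eqI_radial_limit: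
  assumes "\<phi> \<in> Hinf" "\<phi>' \<in> Hinf" "AE z in circle_measure. radial_limit \<phi> z = radial_limit \<phi>' z"
    and "w \<in> ball 0 1"
  shows "\<phi> w = \<phi>' w"
proof -
  have "T_op \<phi> (hardy_power 0) = T_op \<phi>' (hardy_power 0)"
  proof (rule hardy_eqI)
    show "AE z in circle_measure. boundary (T_op \<phi> (hardy_power 0)) z = boundary (T_op \<phi>' (hardy_power 0)) z"
      using assms(3) boundary_T_op_AE[OF assms(1), of "hardy_power 0"] boundary_T_op_AE[OF assms(2), of "hardy_power 0"]
      by eventually_elim simp
  qed
  then show ?thesis
    using T_op_one_eval[OF assms(1,4)] T_op_one_eval[OF assms(2,4)] by simp
qed

lemma radial_limit_eq_if_T_op_eq:
  assumes "\<phi> \<in> Hinf" "\<phi>' \<in> Hinf" "T_op \<phi> f = T_op \<phi>' f" "AE z in circle_measure. boundary f z \<noteq> 0"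
  shows "AE z in circle_measure. radial_limit \<phi> z = radial_limit \<phi>' z"
  using assms(4) boundary_T_op_AE[OF assms(1), of f] boundary_T_op_AE[OF assms(2), of f]
  by eventually_elim (simp add: assms(3))

text \<open>The operator maps $\theta$ to $\varphi\theta$ and a model space function $k$ to $\psi k$. Choosing $k$ nonvanishing allows
  division on the circle, so the boundary values of both symbols are determined.\<close>

lemma paired_op_symbols_unique:
  assumes \<theta>: "inner_function \<theta>" and nc: "\<not> \<theta> constant_on ball 0 1"
    and H: "\<phi> \<in> Hinf" "\<psi> \<in> Hinf" "\<phi>' \<in> Hinf" "\<psi>' \<in> Hinf"
    and eq: "paired_op \<theta> \<phi> \<psi> = paired_op \<theta> \<phi>' \<psi>'" and w: "w \<in> ball 0 1"
  shows "\<phi> w = \<phi>' w \<and> \<psi> w = \<psi>' w"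
proof
  note \<theta>' = inner_function_Hinf[OF \<theta>]
  let ?t = "T_op \<theta> (hardy_power 0)"
  have "?t \<in> range_space \<theta>" by (simp add: range_space_eq[OF \<theta>'])
  then have "T_op \<phi> ?t = T_op \<phi>' ?t"
    using fun_cong[OF eq, of ?t] by (simp add: paired_op_on_range[OF \<theta>] H)
  moreover have "AE z in circle_measure. boundary ?t z \<noteq> 0"
    using \<theta> boundary_T_op_AE[OF \<theta>', of "hardy_power 0"] boundary_hardy_power_AE[of 0]
    unfolding inner_function_def by (auto elim: eventually_elim2)
  ultimately have "AE z in circle_measure. radial_limit \<phi> z = radial_limit \<phi>' z"
    using H by (intro radial_limit_eq_if_T_op_eq)
  then show "\<phi> w = \<phi>' w"
    using H w by (intro Hinf_eqI_radial_limit)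
  obtain k where k: "k \<in> model_space \<theta>" "AE z in circle_measure. boundary k z \<noteq> 0"
    using model_space_nonvanishing[OF \<theta> nc] by blast
  have "T_op \<psi> k = T_op \<psi>' k"
    using fun_cong[OF eq, of k] by (simp add: paired_op_on_model[OF \<theta>] H k)
  then have "AE z in circle_measure. radial_limit \<psi> z = radial_limit \<psi>' z"
    using H k(2) by (intro radial_limit_eq_if_T_op_eq)
  then show "\<psi> w = \<psi>' w"
    using H w by (intro Hinf_eqI_radial_limit)
qed

text \<open>Split $f = p + q$ with $p \in \theta H^2$ and $q \in K_\theta$. On $p$ both $X$ and $S$ stay in $\theta H^2$ and commute. The
  only failure comes from the component $u$ of $Sq$ in $\theta H^2$, on which $X$ acts by $\varphi$ instead of $\psi$.\<close>

lemma paired_op_commutator: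
  assumes \<theta>: "inner_function \<theta>" and X: "bounded_clinear X"
    and H: "\<phi> \<in> Hinf" "\<psi> \<in> Hinf" and eq: "X = paired_op \<theta> \<phi> \<psi>"
  shows "commutator X shift = (\<lambda>f. X f - T_op \<psi> f)
    \<circ> orth_proj (range_space \<theta>) \<circ> shift \<circ> orth_proj (model_space \<theta>)"
proof
  fix f
  note \<theta>' = inner_function_Hinf[OF \<theta>]
  let ?P = "orth_proj (range_space \<theta>)" and ?Q = "orth_proj (model_space \<theta>)"
  define p q u where "p = ?P f" and "q = ?Q f" and "u = ?P (shift q)"
  have f: "f = p + q" by (simp add: p_def q_def orth_proj_model[OF \<theta>])
  have p: "p \<in> range_space \<theta>" and u: "u \<in> range_space \<theta>"
    by (simp_all add: p_def u_def orth_proj_range[OF \<theta>])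
  have q: "q \<in> model_space \<theta>" by (simp add: q_def orth_proj_model_in[OF \<theta>])
  have v: "shift q - u \<in> model_space \<theta>" by (simp add: u_def orth_proj_range[OF \<theta>])
  have sp: "shift p \<in> range_space \<theta>"
    unfolding shift_eq_T_op by (rule T_op_range_invariant[OF identity_in_Hinf \<theta>' p])
  note XR = paired_op_on_range[OF \<theta> H(2), of _ \<phi>, folded eq]
    and XM = paired_op_on_model[OF \<theta> H(1), of _ \<psi>, folded eq]
  note X_lin = bounded_clinear_linear[OF X]
  have "X (u + (shift q - u)) = T_op \<phi> u + (T_op \<psi> (shift q) - T_op \<psi> u)"
    by (simp only: X_lin(1) XR[OF u] XM[OF v] T_op_linear(2)[OF H(2)])
  then have "X (shift f) = T_op \<phi> (shift p) + (T_op \<phi> u + (T_op \<psi> (shift q) - T_op \<psi> u))"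
    by (simp add: f shift_linear X_lin(1) XR[OF sp])
  moreover have "shift (X f) = T_op \<phi> (shift p) + T_op \<psi> (shift q)"
    by (simp add: f X_lin XR[OF p] XM[OF q] shift_linear shift_T_op_commute H)
  ultimately have "commutator X shift f = T_op \<phi> u - T_op \<psi> u"
    by (simp add: commutator_def)
  then show "commutator X shift f = ((\<lambda>f. X f - T_op \<psi> f) \<circ> ?P \<circ> shift \<circ> ?Q) f"
    by (simp add: u_def[unfolded q_def, symmetric] XR[OF u])
qed

text \<open>The commutator identity is used twice, each time through \<open>commutant_of_shift\<close>. On $\theta H^2$ its right-hand
  side vanishes, so $Y = \theta^{-1} X \theta$ commutes with the shift and $X$ is multiplication by some $\varphi$ there. On
  the model space it shows that $D = (X - T_\nu) Q$ commutes with the shift on all of $H^2$. So $D$ is a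
  multiplication operator too; as it annihilates $\theta$, which vanishes almost nowhere, it is $0$, and
  $X = T_\nu$ on the model space.\<close>

lemma paired_op_if_commutator:
  assumes \<theta>: "inner_function \<theta>" and X: "bounded_clinear X"
    and inv: "X ` range_space \<theta> \<subseteq> range_space \<theta>" and \<nu>: "\<nu> \<in> Hinf"
    and comm: "commutator X shift = (\<lambda>f. X f - T_op \<nu> f)
      \<circ> orth_proj (range_space \<theta>) \<circ> shift \<circ> orth_proj (model_space \<theta>)"
  obtains \<phi> where "\<phi> \<in> Hinf" "X = paired_op \<theta> \<phi> \<nu>"
proof -
  note \<theta>' = inner_function_Hinf[OF \<theta>] and X_lin = bounded_clinear_linear[OF X]
  let ?P = "orth_proj (range_space \<theta>)" and ?Q = "orth_proj (model_space \<theta>)"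
  have comm': "X (shift f) - shift (X f) = X (?P (shift (?Q f))) - T_op \<nu> (?P (shift (?Q f)))" for f
    using fun_cong[OF comm, of f] by (simp add: commutator_def)
  note P_lin = bounded_clinear_linear[OF bounded_clinear_orth_proj_range[OF \<theta>]]
  have P0: "?P 0 = 0" by (rule P_lin(4))
  \<comment> \<open>On $\theta H^2$ the projection onto the model space vanishes.\<close>
  have XR: "X (shift r) = shift (X r)" if "r \<in> range_space \<theta>" for r
    using comm'[of r]
    by (simp add: orth_proj_on_range[OF \<theta> that] shift_linear(4) P0 X_lin(4) T_op_linear(4)[OF \<nu>])
  have range_T: "T_op \<theta> g \<in> range_space \<theta>" for g by (simp add: range_space_eq[OF \<theta>'])
  have "\<exists>h. T_op \<theta> h = X (T_op \<theta> g)" for g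
  proof -
    have "X (T_op \<theta> g) \<in> range (T_op \<theta>)"
      using inv range_T[of g] unfolding range_space_eq[OF \<theta>'] by blast
    then show ?thesis by (metis imageE)
  qed
  then obtain Y where Y: "\<And>g. T_op \<theta> (Y g) = X (T_op \<theta> g)" by metis
  have "bounded_clinear Y"
  proof -
    have add: "Y (f + g) = Y f + Y g" for f g
      by (rule T_op_inner_inject[OF \<theta>, THEN iffD1]) (simp add: Y T_op_linear[OF \<theta>'] X_lin)
    have scale: "Y (c *\<^sub>C f) = c *\<^sub>C Y f" for c f
      by (rule T_op_inner_inject[OF \<theta>, THEN iffD1]) (simp add: Y T_op_linear[OF \<theta>'] X_lin)
    obtain K where "\<And>f. norm (X f) \<le> norm f * K"
      using X bounded_linear.bounded unfolding bounded_clinear_def by blast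
    then have "norm (Y f) \<le> norm f * K" for f
      using norm_T_op_inner[OF \<theta>, of "Y f"] norm_T_op_inner[OF \<theta>, of f] Y by metis
    then have "bounded_linear Y"
      by (intro bounded_linear_intro[where K = K]) (auto simp: add scale scaleR_scaleC)
    with scale show ?thesis by (simp add: bounded_clinear_def)
  qed
  moreover have "Y (shift g) = shift (Y g)" for g
    by (rule T_op_inner_inject[OF \<theta>, THEN iffD1])
      (simp add: Y shift_T_op_commute[OF \<theta>', symmetric] XR[OF range_T])
  ultimately obtain \<phi> where \<phi>: "\<phi> \<in> Hinf" "\<And>g. Y g = T_op \<phi> g"
    using commutant_of_shift by blast
  have X_range: "X r = T_op \<phi> r" if "r \<in> range_space \<theta>" for r
    using that Y by (auto simp: range_space_eq[OF \<theta>'] \<phi>(2) T_op_commute[OF \<phi>(1) \<theta>'])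
  \<comment> \<open>This is $(X - T_\nu) Q$, with $Q f$ written as $f - P f$.\<close>
  define D where "D f = X (f - ?P f) - T_op \<nu> (f - ?P f)" for f
  have "bounded_clinear D"
    unfolding D_def
    by (intro bounded_clinear_diff bounded_clinear_compose[OF X] bounded_clinear_compose[OF bounded_clinear_T_op[OF \<nu>]]
        bounded_clinear_id bounded_clinear_orth_proj_range[OF \<theta>])
  moreover have "D (shift f) = shift (D f)" for f
  proof -
    define q where "q = f - ?P f"
    have q: "?Q q = q"
      by (simp add: q_def orth_proj_on_model[OF \<theta>] orth_proj_range[OF \<theta>])
    have "shift (?P f) \<in> range_space \<theta>"
      unfolding shift_eq_T_op by (intro T_op_range_invariant identity_in_Hinf \<theta>' orth_proj_range[OF \<theta>])
    then have "?P (shift (?P f)) = shift (?P f)" by (rule orth_proj_on_range[OF \<theta>])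
    then have "shift f - ?P (shift f) = shift q - ?P (shift q)"
      by (simp add: q_def shift_linear P_lin)
    then have "D (shift f) = (X (shift q) - X (?P (shift q))) - (T_op \<nu> (shift q) - T_op \<nu> (?P (shift q)))"
      by (simp add: D_def X_lin T_op_linear[OF \<nu>])
    also have "\<dots> = shift (X q) - T_op \<nu> (shift q)"
      using comm'[of q] by (simp add: q algebra_simps)
    also have "\<dots> = shift (D f)"
      by (simp add: D_def q_def shift_linear shift_T_op_commute[OF \<nu>])
    finally show ?thesis .
  qed
  ultimately obtain \<delta> where \<delta>: "\<delta> \<in> Hinf" "\<And>f. D f = T_op \<delta> f"
    using commutant_of_shift by blast
  have "D (T_op \<theta> (hardy_power 0)) = 0"
    by (simp add: D_def orth_proj_on_range[OF \<theta> range_T] X_lin(4) T_op_linear(4)[OF \<nu>])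
  then have "T_op \<theta> (T_op \<delta> (hardy_power 0)) = T_op \<theta> 0"
    unfolding T_op_commute[OF \<theta>' \<delta>(1)] T_op_linear(4)[OF \<theta>'] \<delta>(2) .
  then have eq0: "T_op \<delta> (hardy_power 0) = 0"
    by (simp add: T_op_inner_inject[OF \<theta>])
  have "AE z in circle_measure. radial_limit \<delta> z = 0"
    using boundary_T_op_AE[OF \<delta>(1), of "hardy_power 0", unfolded eq0 zero_hardy.rep_eq]
      boundary_hardy_power_AE[of 0] rep_zero_AE
    by eventually_elim simp
  then have D0: "D f = 0" for f
    using T_op_zero[OF \<delta>(1)] \<delta>(2) by simp
  have "X f = paired_op \<theta> \<phi> \<nu> f" for f
  proof -
    have "X f = X (?P f) + X (f - ?P f)" by (simp flip: X_lin(1))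
    also have "X (f - ?P f) = T_op \<nu> (f - ?P f)" using D0[of f] by (simp add: D_def)
    finally show ?thesis
      by (simp add: paired_op_def X_range orth_proj_range(1)[OF \<theta>] orth_proj_model[OF \<theta>])
  qed
  then show thesis using \<phi>(1) that by blast
qed

theorem theorem5p2:
  fixes \<theta> :: "complex \<Rightarrow> complex" and X :: "hardy \<Rightarrow> hardy"
  assumes "inner_function \<theta>" and "\<not> \<theta> constant_on ball 0 1"
    and "bounded_clinear X"
  shows "(is_paired \<theta> X \<longleftrightarrow>
            X ` range_space \<theta> \<subseteq> range_space \<theta> \<and>
            (\<exists>h\<^sub>0\<in>model_space \<theta>. h\<^sub>0 \<noteq> 0 \<and>
              (\<exists>\<nu>\<in>Hinf.
                to_L2 (X h\<^sub>0) = mult_op (radial_limit \<nu>) (to_L2 h\<^sub>0) \<and>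
                commutator X shift =
                  (\<lambda>f. X f - toeplitz (radial_limit \<nu>) f)
                    \<circ> orth_proj (range_space \<theta>) \<circ> shift \<circ> orth_proj (model_space \<theta>))))
         \<and> (\<forall>\<phi>\<in>Hinf. \<forall>\<psi>\<in>Hinf. \<forall>\<phi>'\<in>Hinf. \<forall>\<psi>'\<in>Hinf.
              X = paired_op \<theta> \<phi> \<psi> \<longrightarrow> X = paired_op \<theta> \<phi>' \<psi>' \<longrightarrow>
              (\<forall>z\<in>ball 0 1. \<phi> z = \<phi>' z \<and> \<psi> z = \<psi>' z))"
    (is "(_ \<longleftrightarrow> ?inv \<and> ?comm) \<and> ?unique")
proof (intro conjI iffI)
  note \<theta>' = inner_function_Hinf[OF assms(1)]
  assume "is_paired \<theta> X"
  then obtain \<phi> \<psi> where H: "\<phi> \<in> Hinf" "\<psi> \<in> Hinf" and X: "X = paired_op \<theta> \<phi> \<psi>"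
    by (auto simp: is_paired_def)
  show ?inv
    by (auto simp: X paired_op_on_range[OF assms(1) H(2)] T_op_range_invariant[OF H(1) \<theta>'])
  obtain k where k: "k \<in> model_space \<theta>" "k \<noteq> 0"
    using model_space_nonvanishing[OF assms(1,2)] by blast
  have "to_L2 (X k) = mult_op (radial_limit \<psi>) (to_L2 k)"
    by (simp add: X paired_op_on_model[OF assms(1) H(1) k(1)] to_L2_T_op[OF H(2)])
  with k H(2) paired_op_commutator[OF assms(1,3) H X] show ?comm by blast
next
  assume "?inv \<and> ?comm"
  then obtain \<nu> where "\<nu> \<in> Hinf" "commutator X shift = (\<lambda>f. X f - toeplitz (radial_limit \<nu>) f)
      \<circ> orth_proj (range_space \<theta>) \<circ> shift \<circ> orth_proj (model_space \<theta>)" and ?inv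
    by blast
  then show "is_paired \<theta> X"
    using paired_op_if_commutator[OF assms(1,3)] unfolding is_paired_def by metis
next
  show ?unique
  proof (intro ballI impI)
    fix \<phi> \<psi> \<phi>' \<psi>' and z :: complex
    assume H: "\<phi> \<in> Hinf" "\<psi> \<in> Hinf" "\<phi>' \<in> Hinf" "\<psi>' \<in> Hinf"
      and eq: "X = paired_op \<theta> \<phi> \<psi>" "X = paired_op \<theta> \<phi>' \<psi>'" and z: "z \<in> ball 0 1"
    show "\<phi> z = \<phi>' z \<and> \<psi> z = \<psi>' z"
      by (rule paired_op_symbols_unique[OF assms(1,2) H trans[OF eq(1)[symmetric] eq(2)] z])
  qed
qed

end
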